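(* Suppose that $\mathcal X$ is a semi-abelian category. Consider an object $X$ and a cokernel $$K\xrightarrow{k}B\xrightarrow{f}A\to0$$ in $\mathcal X$ (that is, $f$ is a cokernel of $k$). Then $$(X\diamond K\diamond B)\rtimes(X\diamond K)\longrightarrow X\diamond B\xrightarrow{1_X\diamond f}X\diamond A\to0$$ is a right exact sequence in $\mathcal X$, where the first arrow is the morphism which restricts to $S_{1,2}^{X,B}\circ(1_X\diamond k\diamond 1_B)$ on $X\diamond K\diamond B$ and to $1_X\diamond k$ on $X\diamond K$.
   Context: A semi-abelian category is a pointed, Barr-exact, Bourn-protomodular category with finite coproducts. A sequence $K\xrightarrow{k}B\xrightarrow{f}A\to0$ is right exact if $k$ is proper (its image is a normal subobject of its codomain) and $f$ is a cokernel of $k$. The cosmash product $X\diamond Y$ is the kernel $\iota_{X,Y}$ of the canonical morphism $X+Y\to X\times Y$. The ternary cosmash product $X\diamond Y\diamond Z$ is the kernel $\iota_{X,Y,Z}$ of the canonical morphism $X+Y+Z\to(X+Y)\times(X+Z)\times(Y+Z)$ whose components kill $Z$, $Y$, $X$ respectively and are the coproduct inclusions on the other summands. Both are functorial. The folding operation $S_{1,2}^{X,Y}\colon X\diamond Y\diamond Y\to X\diamond Y$ is the morphism with $\iota_{X,Y}\circ S_{1,2}^{X,Y}=(1_X+\nabla_Y)\circ\iota_{X,Y,Y}$, where $\nabla_Y$ is the codiagonal. $X\diamond K\diamond B$ is canonically the kernel of $X\diamond(K+B)\to(X\diamond K)\times(X\diamond B)$. The object $(X\diamond K\diamond B)\rtimes(X\diamond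 K)$ denotes the kernel $V$ of the morphism $X\diamond(K+B)\to X\diamond B$ induced by $K+B\to B$ (zero on $K$, identity on $B$). It fits into a split short exact sequence $0\to X\diamond K\diamond B\to V\rightleftarrows X\diamond K\to0$, with splitting induced by the coproduct inclusion $K\to K+B$. A morphism out of $V$ is determined by its restrictions to $X\diamond K\diamond B$ and, along the splitting, to $X\diamond K$. *)

theory Defs
  imports Main
begin

section \<open>Categories\<close>

text \<open>
  Hom-sets are disjoint, and composition is in applicative order: \<open>g \<cdot> f\<close> is \<open>f\<close> followed by
  \<open>g\<close>. Nothing is required of \<open>Dom\<close>, \<open>Cod\<close>, \<open>ident\<close> and composition outside the carriers.
\<close>

record ('o, 'm) cat_data =
  Obj :: "'o set"
  Arr :: "'m set"
  Dom :: "'m \<Rightarrow> 'o"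
  Cod :: "'m \<Rightarrow> 'o"
  ident :: "'o \<Rightarrow> 'm"
  cmp :: "'m \<Rightarrow> 'm \<Rightarrow> 'm"  (infixr "\<cdot>\<index>" 75)

definition hom :: "('o, 'm, 'x) cat_data_scheme \<Rightarrow> 'o \<Rightarrow> 'o \<Rightarrow> 'm set" where
  "hom C X Y = {f \<in> Arr C. Dom C f = X \<and> Cod C f = Y}"

locale category =
  fixes C :: "('o, 'm, 'x) cat_data_scheme" (structure)
  assumes Dom_in_Obj: "f \<in> Arr C \<Longrightarrow> Dom C f \<in> Obj C"
    and Cod_in_Obj: "f \<in> Arr C \<Longrightarrow> Cod C f \<in> Obj C"
    and ident_in_hom: "X \<in> Obj C \<Longrightarrow> ident C X \<in> hom C X X"
    and cmp_in_hom: "f \<in> hom C X Y \<Longrightarrow> g \<in> hom C Y Z \<Longrightarrow> g \<cdot> f \<in> hom C X Z"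
    and cmp_ident_right: "f \<in> hom C X Y \<Longrightarrow> f \<cdot> ident C X = f"
    and cmp_ident_left: "f \<in> hom C X Y \<Longrightarrow> ident C Y \<cdot> f = f"
    and cmp_assoc: "f \<in> hom C W X \<Longrightarrow> g \<in> hom C X Y \<Longrightarrow> h \<in> hom C Y Z \<Longrightarrow>
      (h \<cdot> g) \<cdot> f = h \<cdot> (g \<cdot> f)"


section \<open>Limits, colimits and special morphisms\<close>

definition iso :: "('o, 'm, 'x) cat_data_scheme \<Rightarrow> 'm \<Rightarrow> bool" where
  "iso C f \<longleftrightarrow> (\<exists>X Y g. f \<in> hom C X Y \<and> g \<in> hom C Y X \<and>
     g \<cdot> f = ident C X \<and> f \<cdot> g = ident C Y)" for C (structure)

definition monic :: "('o, 'm, 'x) cat_data_scheme \<Rightarrow> 'm \<Rightarrow> bool" where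
  "monic C m \<longleftrightarrow> m \<in> Arr C \<and>
     (\<forall>T. \<forall>g \<in> hom C T (Dom C m). \<forall>h \<in> hom C T (Dom C m). m \<cdot> g = m \<cdot> h \<longrightarrow> g = h)"
  for C (structure)

definition initial_obj :: "('o, 'm, 'x) cat_data_scheme \<Rightarrow> 'o \<Rightarrow> bool" where
  "initial_obj C Z \<longleftrightarrow> Z \<in> Obj C \<and> (\<forall>X \<in> Obj C. \<exists>!f. f \<in> hom C Z X)"

definition terminal_obj :: "('o, 'm, 'x) cat_data_scheme \<Rightarrow> 'o \<Rightarrow> bool" where
  "terminal_obj C Z \<longleftrightarrow> Z \<in> Obj C \<and> (\<forall>X \<in> Obj C. \<exists>!f. f \<in> hom C X Z)"

definition is_product ::
  "('o, 'm, 'x) cat_data_scheme \<Rightarrow> 'o \<Rightarrow> 'o \<Rightarrow> 'm \<Rightarrow> 'm \<Rightarrow> bool" where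
  "is_product C X Y p q \<longleftrightarrow> (\<exists>P. p \<in> hom C P X \<and> q \<in> hom C P Y \<and>
     (\<forall>T. \<forall>f \<in> hom C T X. \<forall>g \<in> hom C T Y.
        \<exists>!h. h \<in> hom C T P \<and> p \<cdot> h = f \<and> q \<cdot> h = g))" for C (structure)

definition is_coproduct ::
  "('o, 'm, 'x) cat_data_scheme \<Rightarrow> 'o \<Rightarrow> 'o \<Rightarrow> 'm \<Rightarrow> 'm \<Rightarrow> bool" where
  "is_coproduct C X Y i j \<longleftrightarrow> (\<exists>S. i \<in> hom C X S \<and> j \<in> hom C Y S \<and>
     (\<forall>T. \<forall>f \<in> hom C X T. \<forall>g \<in> hom C Y T.
        \<exists>!h. h \<in> hom C S T \<and> h \<cdot> i = f \<and> h \<cdot> j = g))" for C (structure)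

text \<open>\<open>is_pullback C f g a b\<close>: the square \<open>f \<cdot> a = g \<cdot> b\<close> is a pullback.\<close>

definition is_pullback ::
  "('o, 'm, 'x) cat_data_scheme \<Rightarrow> 'm \<Rightarrow> 'm \<Rightarrow> 'm \<Rightarrow> 'm \<Rightarrow> bool" where
  "is_pullback C f g a b \<longleftrightarrow> (\<exists>X Y Z P.
     f \<in> hom C X Z \<and> g \<in> hom C Y Z \<and> a \<in> hom C P X \<and> b \<in> hom C P Y \<and> f \<cdot> a = g \<cdot> b \<and>
     (\<forall>T. \<forall>u \<in> hom C T X. \<forall>v \<in> hom C T Y. f \<cdot> u = g \<cdot> v \<longrightarrow>
        (\<exists>!h. h \<in> hom C T P \<and> a \<cdot> h = u \<and> b \<cdot> h = v)))" for C (structure)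

definition is_coequalizer ::
  "('o, 'm, 'x) cat_data_scheme \<Rightarrow> 'm \<Rightarrow> 'm \<Rightarrow> 'm \<Rightarrow> bool" where
  "is_coequalizer C e a b \<longleftrightarrow> (\<exists>R X Q.
     a \<in> hom C R X \<and> b \<in> hom C R X \<and> e \<in> hom C X Q \<and> e \<cdot> a = e \<cdot> b \<and>
     (\<forall>T. \<forall>g \<in> hom C X T. g \<cdot> a = g \<cdot> b \<longrightarrow> (\<exists>!h. h \<in> hom C Q T \<and> h \<cdot> e = g)))"
  for C (structure)

definition regular_epi :: "('o, 'm, 'x) cat_data_scheme \<Rightarrow> 'm \<Rightarrow> bool" where
  "regular_epi C e \<longleftrightarrow> (\<exists>a b. is_coequalizer C e a b)"

definition is_kernel_pair ::
  "('o, 'm, 'x) cat_data_scheme \<Rightarrow> 'm \<Rightarrow> 'm \<Rightarrow> 'm \<Rightarrow> bool" where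
  "is_kernel_pair C f a b \<longleftrightarrow> is_pullback C f f a b"

text \<open>
  An internal equivalence relation \<open>(r, s)\<close> from \<open>R\<close> to \<open>X\<close>: for every \<open>T\<close>, the map
  \<open>h \<mapsto> (r \<cdot> h, s \<cdot> h)\<close> embeds \<open>hom T R\<close> into \<open>hom T X \<times> hom T X\<close> as an equivalence relation.
\<close>

definition internal_equiv :: "('o, 'm, 'x) cat_data_scheme \<Rightarrow> 'm \<Rightarrow> 'm \<Rightarrow> bool" where
  "internal_equiv C r s \<longleftrightarrow> (\<exists>R X. r \<in> hom C R X \<and> s \<in> hom C R X \<and>
     (\<forall>T \<in> Obj C. inj_on (\<lambda>h. (r \<cdot> h, s \<cdot> h)) (hom C T R) \<and>
        equiv (hom C T X) ((\<lambda>h. (r \<cdot> h, s \<cdot> h)) ` hom C T R)))" for C (structure)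


section \<open>Semi-abelian categories\<close>

definition zero_obj :: "('o, 'm, 'x) cat_data_scheme \<Rightarrow> 'o \<Rightarrow> bool" where
  "zero_obj C Z \<longleftrightarrow> initial_obj C Z \<and> terminal_obj C Z"

definition pointed :: "('o, 'm, 'x) cat_data_scheme \<Rightarrow> bool" where
  "pointed C \<longleftrightarrow> (\<exists>Z. zero_obj C Z)"

definition finitely_complete :: "('o, 'm, 'x) cat_data_scheme \<Rightarrow> bool" where
  "finitely_complete C \<longleftrightarrow> (\<exists>Z. terminal_obj C Z) \<and>
     (\<forall>X Y Z. \<forall>f \<in> hom C X Z. \<forall>g \<in> hom C Y Z. \<exists>a b. is_pullback C f g a b)"

definition has_finite_coproducts :: "('o, 'm, 'x) cat_data_scheme \<Rightarrow> bool" where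
  "has_finite_coproducts C \<longleftrightarrow> (\<exists>Z. initial_obj C Z) \<and>
     (\<forall>X \<in> Obj C. \<forall>Y \<in> Obj C. \<exists>i j. is_coproduct C X Y i j)"

definition regular_category :: "('o, 'm, 'x) cat_data_scheme \<Rightarrow> bool" where
  "regular_category C \<longleftrightarrow> finitely_complete C \<and>
     (\<forall>f a b. is_kernel_pair C f a b \<longrightarrow> (\<exists>e. is_coequalizer C e a b)) \<and>
     (\<forall>f g a b. is_pullback C f g a b \<and> regular_epi C f \<longrightarrow> regular_epi C b)"

definition barr_exact :: "('o, 'm, 'x) cat_data_scheme \<Rightarrow> bool" where
  "barr_exact C \<longleftrightarrow> regular_category C \<and>
     (\<forall>r s. internal_equiv C r s \<longrightarrow> (\<exists>f. is_kernel_pair C f r s))"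

text \<open>
  Points over \<open>B\<close> are split epimorphisms with codomain \<open>B\<close> together with a chosen splitting.
\<close>

definition is_point ::
  "('o, 'm, 'x) cat_data_scheme \<Rightarrow> 'o \<Rightarrow> 'o \<Rightarrow> 'm \<Rightarrow> 'm \<Rightarrow> bool" where
  "is_point C E B p s \<longleftrightarrow> p \<in> hom C E B \<and> s \<in> hom C B E \<and> p \<cdot> s = ident C B"
  for C (structure)

text \<open>
  Bourn-protomodularity: for every \<open>v : D \<rightarrow> B\<close>, the change-of-base functor from points over
  \<open>B\<close> to points over \<open>D\<close> reflects isomorphisms. Here \<open>h : (p, s) \<rightarrow> (p', s')\<close> is a morphism of
  points over \<open>B\<close> and \<open>w\<close> is its image under change of base; its compatibility with
  the induced splittings is automatic, and a morphism of points is invertible as soon as its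
  underlying morphism is.
\<close>

definition protomodular :: "('o, 'm, 'x) cat_data_scheme \<Rightarrow> bool" where
  "protomodular C \<longleftrightarrow> finitely_complete C \<and>
     (\<forall>E E' B D p s p' s' h v a b a' b' w.
        is_point C E B p s \<and> is_point C E' B p' s' \<and>
        h \<in> hom C E E' \<and> p' \<cdot> h = p \<and> h \<cdot> s = s' \<and>
        v \<in> hom C D B \<and> is_pullback C p v a b \<and> is_pullback C p' v a' b' \<and>
        w \<in> hom C (Dom C a) (Dom C a') \<and> a' \<cdot> w = h \<cdot> a \<and> b' \<cdot> w = b \<and>
        iso C w \<longrightarrow> iso C h)" for C (structure)

locale semi_abelian = category +
  assumes pointed: "pointed C"
    and barr_exact: "barr_exact C"
    and protomodular: "protomodular C"
    and has_finite_coproducts: "has_finite_coproducts C"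


section \<open>Kernels, cokernels and right exact sequences\<close>

definition zero_arr :: "('o, 'm, 'x) cat_data_scheme \<Rightarrow> 'o \<Rightarrow> 'o \<Rightarrow> 'm" where
  "zero_arr C X Y = (THE f. \<exists>Z g h.
     zero_obj C Z \<and> g \<in> hom C X Z \<and> h \<in> hom C Z Y \<and> f = h \<cdot> g)" for C (structure)

definition is_kernel :: "('o, 'm, 'x) cat_data_scheme \<Rightarrow> 'm \<Rightarrow> 'm \<Rightarrow> bool" where
  "is_kernel C k f \<longleftrightarrow> (\<exists>K X Y.
     k \<in> hom C K X \<and> f \<in> hom C X Y \<and> f \<cdot> k = zero_arr C K Y \<and>
     (\<forall>T. \<forall>g \<in> hom C T X. f \<cdot> g = zero_arr C T Y \<longrightarrow> (\<exists>!h. h \<in> hom C T K \<and> k \<cdot> h = g)))"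
  for C (structure)

definition is_cokernel :: "('o, 'm, 'x) cat_data_scheme \<Rightarrow> 'm \<Rightarrow> 'm \<Rightarrow> bool" where
  "is_cokernel C f k \<longleftrightarrow> (\<exists>K X Y.
     k \<in> hom C K X \<and> f \<in> hom C X Y \<and> f \<cdot> k = zero_arr C K Y \<and>
     (\<forall>T. \<forall>g \<in> hom C X T. g \<cdot> k = zero_arr C K T \<longrightarrow> (\<exists>!h. h \<in> hom C Y T \<and> h \<cdot> f = g)))"
  for C (structure)

definition normal_mono :: "('o, 'm, 'x) cat_data_scheme \<Rightarrow> 'm \<Rightarrow> bool" where
  "normal_mono C m \<longleftrightarrow> (\<exists>f. is_kernel C m f)"

definition is_image :: "('o, 'm, 'x) cat_data_scheme \<Rightarrow> 'm \<Rightarrow> 'm \<Rightarrow> bool" where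
  "is_image C m f \<longleftrightarrow> monic C m \<and>
     (\<exists>e \<in> hom C (Dom C f) (Dom C m). regular_epi C e \<and> f = m \<cdot> e)" for C (structure)

definition proper :: "('o, 'm, 'x) cat_data_scheme \<Rightarrow> 'm \<Rightarrow> bool" where
  "proper C f \<longleftrightarrow> (\<exists>m. is_image C m f \<and> normal_mono C m)"

definition right_exact :: "('o, 'm, 'x) cat_data_scheme \<Rightarrow> 'm \<Rightarrow> 'm \<Rightarrow> bool" where
  "right_exact C k f \<longleftrightarrow> proper C k \<and> is_cokernel C f k"


section \<open>Chosen products, coproducts and kernels\<close>

definition inl :: "('o, 'm, 'x) cat_data_scheme \<Rightarrow> 'o \<Rightarrow> 'o \<Rightarrow> 'm" where
  "inl C X Y = fst (SOME (i, j). is_coproduct C X Y i j)"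

definition inr :: "('o, 'm, 'x) cat_data_scheme \<Rightarrow> 'o \<Rightarrow> 'o \<Rightarrow> 'm" where
  "inr C X Y = snd (SOME (i, j). is_coproduct C X Y i j)"

definition coprod :: "('o, 'm, 'x) cat_data_scheme \<Rightarrow> 'o \<Rightarrow> 'o \<Rightarrow> 'o"
    (infixr "\<amalg>\<index>" 65) where
  "X \<amalg>\<^bsub>C\<^esub> Y = Cod C (inl C X Y)"

definition copair :: "('o, 'm, 'x) cat_data_scheme \<Rightarrow> 'm \<Rightarrow> 'm \<Rightarrow> 'm" where
  "copair C f g = (THE h. h \<in> hom C (Dom C f \<amalg> Dom C g) (Cod C f) \<and>
     h \<cdot> inl C (Dom C f) (Dom C g) = f \<and> h \<cdot> inr C (Dom C f) (Dom C g) = g)"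
  for C (structure)

definition coprod_map :: "('o, 'm, 'x) cat_data_scheme \<Rightarrow> 'm \<Rightarrow> 'm \<Rightarrow> 'm" where
  "coprod_map C f g =
     copair C (inl C (Cod C f) (Cod C g) \<cdot> f) (inr C (Cod C f) (Cod C g) \<cdot> g)"
  for C (structure)

definition codiagonal :: "('o, 'm, 'x) cat_data_scheme \<Rightarrow> 'o \<Rightarrow> 'm" where
  "codiagonal C Y = copair C (ident C Y) (ident C Y)"

definition pr1 :: "('o, 'm, 'x) cat_data_scheme \<Rightarrow> 'o \<Rightarrow> 'o \<Rightarrow> 'm" where
  "pr1 C X Y = fst (SOME (p, q). is_product C X Y p q)"

definition pr2 :: "('o, 'm, 'x) cat_data_scheme \<Rightarrow> 'o \<Rightarrow> 'o \<Rightarrow> 'm" where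
  "pr2 C X Y = snd (SOME (p, q). is_product C X Y p q)"

definition prod_obj :: "('o, 'm, 'x) cat_data_scheme \<Rightarrow> 'o \<Rightarrow> 'o \<Rightarrow> 'o" where
  "prod_obj C X Y = Dom C (pr1 C X Y)"

definition tuple :: "('o, 'm, 'x) cat_data_scheme \<Rightarrow> 'm \<Rightarrow> 'm \<Rightarrow> 'm" where
  "tuple C f g = (THE h. h \<in> hom C (Dom C f) (prod_obj C (Cod C f) (Cod C g)) \<and>
     pr1 C (Cod C f) (Cod C g) \<cdot> h = f \<and> pr2 C (Cod C f) (Cod C g) \<cdot> h = g)"
  for C (structure)

definition ker :: "('o, 'm, 'x) cat_data_scheme \<Rightarrow> 'm \<Rightarrow> 'm" where
  "ker C f = (SOME k. is_kernel C k f)"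

text \<open>The factorisation of \<open>g\<close> through the monomorphism \<open>m\<close>, where it exists.\<close>

definition factor_through :: "('o, 'm, 'x) cat_data_scheme \<Rightarrow> 'm \<Rightarrow> 'm \<Rightarrow> 'm" where
  "factor_through C m g = (THE h. h \<in> hom C (Dom C g) (Dom C m) \<and> m \<cdot> h = g)"
  for C (structure)


section \<open>Cosmash products\<close>

definition cosmash_incl :: "('o, 'm, 'x) cat_data_scheme \<Rightarrow> 'o \<Rightarrow> 'o \<Rightarrow> 'm" where
  "cosmash_incl C X Y = ker C (tuple C
     (copair C (ident C X) (zero_arr C Y X))
     (copair C (zero_arr C X Y) (ident C Y)))"

definition cosmash :: "('o, 'm, 'x) cat_data_scheme \<Rightarrow> 'o \<Rightarrow> 'o \<Rightarrow> 'o"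
    (infix "\<diamond>\<index>" 70) where
  "X \<diamond>\<^bsub>C\<^esub> Y = Dom C (cosmash_incl C X Y)"

definition cosmash_map :: "('o, 'm, 'x) cat_data_scheme \<Rightarrow> 'm \<Rightarrow> 'm \<Rightarrow> 'm" where
  "cosmash_map C f g = factor_through C (cosmash_incl C (Cod C f) (Cod C g))
     (coprod_map C f g \<cdot> cosmash_incl C (Dom C f) (Dom C g))" for C (structure)

text \<open>
  The triple coproduct is bracketed as \<open>X \<amalg> (Y \<amalg> Z)\<close>, and the triple product
  as \<open>(X \<amalg> Y) \<times> ((X \<amalg> Z) \<times> (Y \<amalg> Z))\<close>.
\<close>

definition cosmash3_incl :: "('o, 'm, 'x) cat_data_scheme \<Rightarrow> 'o \<Rightarrow> 'o \<Rightarrow> 'o \<Rightarrow> 'm" where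
  "cosmash3_incl C X Y Z = ker C (tuple C
     (copair C (inl C X Y) (copair C (inr C X Y) (zero_arr C Z (X \<amalg> Y))))
     (tuple C
       (copair C (inl C X Z) (copair C (zero_arr C Y (X \<amalg> Z)) (inr C X Z)))
       (copair C (zero_arr C X (Y \<amalg> Z)) (ident C (Y \<amalg> Z)))))" for C (structure)

definition cosmash3 :: "('o, 'm, 'x) cat_data_scheme \<Rightarrow> 'o \<Rightarrow> 'o \<Rightarrow> 'o \<Rightarrow> 'o" where
  "cosmash3 C X Y Z = Dom C (cosmash3_incl C X Y Z)"

definition cosmash3_map :: "('o, 'm, 'x) cat_data_scheme \<Rightarrow> 'm \<Rightarrow> 'm \<Rightarrow> 'm \<Rightarrow> 'm" where
  "cosmash3_map C f g h = factor_through C (cosmash3_incl C (Cod C f) (Cod C g) (Cod C h))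
     (coprod_map C f (coprod_map C g h) \<cdot> cosmash3_incl C (Dom C f) (Dom C g) (Dom C h))"
  for C (structure)

text \<open>The folding operation from \<open>X \<diamond> Y \<diamond> Y\<close> to \<open>X \<diamond> Y\<close>.\<close>

definition S12 :: "('o, 'm, 'x) cat_data_scheme \<Rightarrow> 'o \<Rightarrow> 'o \<Rightarrow> 'm" where
  "S12 C X Y = factor_through C (cosmash_incl C X Y)
     (coprod_map C (ident C X) (codiagonal C Y) \<cdot> cosmash3_incl C X Y Y)" for C (structure)

text \<open>
  The object \<open>(X \<diamond> K \<diamond> B) \<rtimes> (X \<diamond> K)\<close>, given by its inclusion into \<open>X \<diamond> (K \<amalg> B)\<close>, together
  with the canonical morphisms to it from \<open>X \<diamond> K \<diamond> B\<close> (both are subobjects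
  of \<open>X \<amalg> (K \<amalg> B)\<close>) and from \<open>X \<diamond> K\<close> (induced by the coproduct inclusion of \<open>K\<close>).
\<close>

definition semidirect_incl :: "('o, 'm, 'x) cat_data_scheme \<Rightarrow> 'o \<Rightarrow> 'o \<Rightarrow> 'o \<Rightarrow> 'm" where
  "semidirect_incl C X K B =
     ker C (cosmash_map C (ident C X) (copair C (zero_arr C K B) (ident C B)))"

definition semidirect :: "('o, 'm, 'x) cat_data_scheme \<Rightarrow> 'o \<Rightarrow> 'o \<Rightarrow> 'o \<Rightarrow> 'o" where
  "semidirect C X K B = Dom C (semidirect_incl C X K B)"

definition semidirect_ker :: "('o, 'm, 'x) cat_data_scheme \<Rightarrow> 'o \<Rightarrow> 'o \<Rightarrow> 'o \<Rightarrow> 'm" where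
  "semidirect_ker C X K B = factor_through C (semidirect_incl C X K B)
     (factor_through C (cosmash_incl C X (K \<amalg> B)) (cosmash3_incl C X K B))" for C (structure)

definition semidirect_split :: "('o, 'm, 'x) cat_data_scheme \<Rightarrow> 'o \<Rightarrow> 'o \<Rightarrow> 'o \<Rightarrow> 'm" where
  "semidirect_split C X K B = factor_through C (semidirect_incl C X K B)
     (cosmash_map C (ident C X) (inl C K B))"

text \<open>
  The morphism \<open>h\<close> out of \<open>(X \<diamond> K \<diamond> B) \<rtimes> (X \<diamond> K)\<close> restricts to \<open>a\<close> on \<open>X \<diamond> K \<diamond> B\<close> and
  to \<open>b\<close> on \<open>X \<diamond> K\<close>.
\<close>

definition restricts_to ::
  "('o, 'm, 'x) cat_data_scheme \<Rightarrow> 'o \<Rightarrow> 'o \<Rightarrow> 'o \<Rightarrow> 'm \<Rightarrow> 'm \<Rightarrow> 'm \<Rightarrow> bool" where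
  "restricts_to C X K B h a b \<longleftrightarrow> h \<in> hom C (semidirect C X K B) (Cod C b) \<and>
     h \<cdot> semidirect_ker C X K B = a \<and> h \<cdot> semidirect_split C X K B = b" for C (structure)

end

theory Submission
  imports Defs
begin

text \<open>
  Write \<open>c\<^sub>1, c\<^sub>0 : K \<amalg> B \<rightarrow> B\<close> for the morphisms that restrict to \<open>k\<close> and to \<open>0\<close> on \<open>K\<close> and to the identity on
  \<open>B\<close>. The only morphism with the prescribed restrictions is \<open>h = (1 \<diamond> c\<^sub>1) \<cdot> ker (1 \<diamond> c\<^sub>0)\<close>, because the
  kernel and the section of a split epimorphism are jointly epic. Since a regular epimorphism is the
  cokernel of its kernel, it remains to see that \<open>1 \<diamond> f\<close> is a regular epimorphism and that \<open>h\<close> covers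
  its kernel. In groups, both follow by lifting an element to the coproducts, where \<open>1 + f\<close> is the
  coequalizer of the reflexive graph \<open>(1 + c\<^sub>1, 1 + c\<^sub>0)\<close>, and dividing by a correction term that
  comes from the second summand. The division is replaced by a lemma on the restriction of regular
  epimorphisms to kernels, valid in every pointed regular protomodular category; exactness enters
  only to see that a reflexive graph covers the kernel pair of its coequalizer.
\<close>

section \<open>Categories\<close>

text \<open>In groups, the kernel of \<open>1 + f\<close> is the normal closure of the image of
  \<open>K\<close> in \<open>X \<amalg> B\<close>, and the image of \<open>K\<close> itself is in
  general not normal there, even if it is normal in \<open>B\<close>. The kernel of
  \<open>1 + c\<^sub>0\<close> is the normal closure of \<open>K\<close> in
  \<open>X \<amalg> (K \<amalg> B)\<close>: it contains the formal conjugates of \<open>K\<close>,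
  and \<open>1 + c\<^sub>1\<close> evaluates them in \<open>X \<amalg> B\<close>. This explains the
  extra free copy of \<open>B\<close>. The semidirect product is the part of that kernel that lies
  in \<open>X \<diamond> (K \<amalg> B)\<close>. Protomodularity itself is applied in one place,
  \<open>monic_iso_if_contains_kernel\<close>. Its model is the remark that a subgroup which
  contains the kernel of a homomorphism and is mapped onto its codomain is the whole group. Joint
  epicity of a kernel and a section, difunctionality of relations and the restriction of regular
  epimorphisms to kernels are each obtained by finding a subobject to which this remark
  applies.\<close>

context category
begin

lemma in_hom: "f \<in> hom C X Y \<longleftrightarrow> f \<in> Arr C \<and> Dom C f = X \<and> Cod C f = Y"
  by (auto simp: hom_def)

declare Dom_in_Obj [simp] Cod_in_Obj [simp]

lemma cmp_simps [simp]:
  assumes "f \<in> Arr C" "g \<in> Arr C" "Dom C g = Cod C f"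
  shows cmp_Arr: "g \<cdot> f \<in> Arr C" and Dom_cmp: "Dom C (g \<cdot> f) = Dom C f"
    and Cod_cmp: "Cod C (g \<cdot> f) = Cod C g"
  using cmp_in_hom[of f "Dom C f" "Cod C f" g "Cod C g"] assms by (auto simp: in_hom)

lemma ident_simps [simp]:
  assumes "X \<in> Obj C"
  shows "ident C X \<in> Arr C" "Dom C (ident C X) = X" "Cod C (ident C X) = X"
  using ident_in_hom[OF assms] by (auto simp: in_hom)

lemma ident_cmp [simp]: "f \<in> Arr C \<Longrightarrow> Cod C f = X \<Longrightarrow> ident C X \<cdot> f = f"
  by (rule cmp_ident_left) (auto simp: in_hom)

lemma cmp_ident [simp]: "f \<in> Arr C \<Longrightarrow> Dom C f = X \<Longrightarrow> f \<cdot> ident C X = f"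
  by (rule cmp_ident_right) (auto simp: in_hom)

lemma cmp_assoc_Arr [simp]:
  assumes "f \<in> Arr C" "g \<in> Arr C" "h \<in> Arr C" "Dom C g = Cod C f" "Dom C h = Cod C g"
  shows "(h \<cdot> g) \<cdot> f = h \<cdot> (g \<cdot> f)"
  using assms by (intro cmp_assoc) (auto simp: in_hom)

text \<open>
  With composites associated to the right, an equation between composites rewrites only at the
  end of a chain; the next two lemmas turn it into a rewrite rule that applies in the middle.
\<close>

lemma cmp_extend:
  assumes "a \<cdot> b = c" "a \<in> Arr C" "b \<in> Arr C" "Dom C a = Cod C b" "t \<in> Arr C" "Cod C t = Dom C b"
  shows "a \<cdot> (b \<cdot> t) = c \<cdot> t"
  using assms by (metis cmp_assoc_Arr)

lemma cmp_extend3: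
  assumes "a \<cdot> (b \<cdot> c) = d" "a \<in> Arr C" "b \<in> Arr C" "c \<in> Arr C" "Dom C a = Cod C b" "Dom C b = Cod C c"
    "t \<in> Arr C" "Cod C t = Dom C c"
  shows "a \<cdot> (b \<cdot> (c \<cdot> t)) = d \<cdot> t"
  using assms cmp_extend[of a "b \<cdot> c" d t] by simp

lemma monicD:
  assumes "monic C m" "m \<cdot> g = m \<cdot> h" "g \<in> Arr C" "h \<in> Arr C" "Cod C g = Dom C m" "Cod C h = Dom C m"
  shows "g = h"
proof -
  have m: "m \<in> Arr C" using assms(1) by (simp add: monic_def)
  \<comment> \<open>Hom-sets are disjoint, so an equation between composites already forces equal
    domains. The same device recovers missing domains and codomains throughout.\<close>
  have "Dom C g = Dom C h"
    using arg_cong[OF assms(2), of "Dom C"] assms(3-) m by simp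
  then have "g \<in> hom C (Dom C g) (Dom C m)" "h \<in> hom C (Dom C g) (Dom C m)"
    using assms by (auto simp: in_hom)
  then show ?thesis using assms(1,2) unfolding monic_def by blast
qed

lemma monic_Arr [simp]: "monic C m \<Longrightarrow> m \<in> Arr C"
  by (simp add: monic_def)

lemma monicI:
  assumes "m \<in> Arr C"
    "\<And>g h. g \<in> Arr C \<Longrightarrow> h \<in> Arr C \<Longrightarrow> Dom C g = Dom C h \<Longrightarrow> Cod C g = Dom C m \<Longrightarrow> Cod C h = Dom C m
       \<Longrightarrow> m \<cdot> g = m \<cdot> h \<Longrightarrow> g = h"
  shows "monic C m"
  unfolding monic_def
proof (intro conjI allI ballI impI)
  fix T g h assume "g \<in> hom C T (Dom C m)" "h \<in> hom C T (Dom C m)" "m \<cdot> g = m \<cdot> h"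
  then show "g = h" using assms(2)[of g h] by (simp add: in_hom)
qed fact

lemma isoI:
  assumes "f \<in> Arr C" "g \<in> Arr C" "Dom C g = Cod C f" "Cod C g = Dom C f"
    "g \<cdot> f = ident C (Dom C f)" "f \<cdot> g = ident C (Cod C f)"
  shows "iso C f"
  using assms unfolding iso_def in_hom by blast

lemma isoE:
  assumes "iso C f"
  obtains g where "f \<in> Arr C" "g \<in> Arr C" "Dom C g = Cod C f" "Cod C g = Dom C f"
    "g \<cdot> f = ident C (Dom C f)" "f \<cdot> g = ident C (Cod C f)"
  using assms by (auto simp: iso_def in_hom)

text \<open>Cancel \<open>m\<close> on the left in \<open>m \<cdot> s \<cdot> m = m\<close>.\<close>

lemma monic_split_epi_iso:
  assumes "monic C m" "s \<in> Arr C" "Cod C s = Dom C m" "m \<cdot> s = ident C (Cod C m)"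
  shows "iso C m"
proof -
  have m [simp]: "m \<in> Arr C" using assms(1) by simp
  have [simp]: "Dom C s = Cod C m"
    using arg_cong[OF assms(4), of "Dom C"] assms(2,3) by simp
  have "s \<cdot> m = ident C (Dom C m)"
    by (rule monicD[OF assms(1)]) (use assms(2,3) in \<open>simp_all add: assms(4)[THEN cmp_extend]\<close>)
  then show ?thesis using assms by (intro isoI[of m s]) auto
qed

section \<open>Pullbacks, coequalizers and regular epimorphisms\<close>

lemma is_pullbackE:
  assumes "is_pullback C f g a b"
  obtains "f \<in> Arr C" "g \<in> Arr C" "a \<in> Arr C" "b \<in> Arr C" "Cod C g = Cod C f"
    "Cod C a = Dom C f" "Cod C b = Dom C g" "Dom C b = Dom C a" "f \<cdot> a = g \<cdot> b"
  using assms unfolding is_pullback_def in_hom by auto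

lemma is_pullback_Ex1:
  assumes "is_pullback C f g a b" "u \<in> Arr C" "v \<in> Arr C" "Dom C u = Dom C v"
    "Cod C u = Dom C f" "Cod C v = Dom C g" "f \<cdot> u = g \<cdot> v"
  shows "\<exists>!h. h \<in> hom C (Dom C v) (Dom C a) \<and> a \<cdot> h = u \<and> b \<cdot> h = v"
proof -
  obtain X Y Z P where *: "f \<in> hom C X Z" "g \<in> hom C Y Z" "a \<in> hom C P X"
    and univ: "\<forall>T. \<forall>u\<in>hom C T X. \<forall>v\<in>hom C T Y. f \<cdot> u = g \<cdot> v \<longrightarrow>
      (\<exists>!h. h \<in> hom C T P \<and> a \<cdot> h = u \<and> b \<cdot> h = v)"
    using assms(1) unfolding is_pullback_def by blast
  then have P: "P = Dom C a" and "u \<in> hom C (Dom C v) X" "v \<in> hom C (Dom C v) Y"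
    using assms by (auto simp: in_hom)
  then show ?thesis unfolding P[symmetric] using univ assms(7) by blast
qed

lemma is_pullback_lift:
  assumes "is_pullback C f g a b" "u \<in> Arr C" "v \<in> Arr C" "Dom C u = Dom C v"
    "Cod C u = Dom C f" "Cod C v = Dom C g" "f \<cdot> u = g \<cdot> v"
  shows "\<exists>h. h \<in> Arr C \<and> Dom C h = Dom C v \<and> Cod C h = Dom C a \<and> a \<cdot> h = u \<and> b \<cdot> h = v"
  using is_pullback_Ex1[OF assms] by (auto simp: in_hom)

text \<open>The objects \<open>D\<close> and \<open>P\<close> are free variables, so that the rule
  resolves against goals in which the domains have been simplified already. The primed rules for
  coequalizers and kernels have the same purpose.\<close>

lemma is_pullback_lift':
  assumes "is_pullback C f g a b" "u \<in> Arr C" "v \<in> Arr C" "Dom C u = D" "Dom C v = D"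
    "Cod C u = Dom C f" "Cod C v = Dom C g" "f \<cdot> u = g \<cdot> v" "Dom C a = P"
  shows "\<exists>h. h \<in> Arr C \<and> Dom C h = D \<and> Cod C h = P \<and> a \<cdot> h = u \<and> b \<cdot> h = v"
  using is_pullback_lift[OF assms(1-3) trans[OF assms(4) assms(5)[symmetric]] assms(6-8)] unfolding assms(5,9) .

lemma is_pullback_eqI:
  assumes "is_pullback C f g a b" "a \<cdot> u = a \<cdot> v" "b \<cdot> u = b \<cdot> v" "u \<in> Arr C" "v \<in> Arr C"
    "Cod C u = Dom C a" "Cod C v = Dom C a"
  shows "u = v"
proof -
  have [simp]: "f \<in> Arr C" "g \<in> Arr C" "a \<in> Arr C" "b \<in> Arr C" "Cod C g = Cod C f"
    "Cod C a = Dom C f" "Cod C b = Dom C g" "Dom C b = Dom C a" and fg: "f \<cdot> a = g \<cdot> b"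
    using assms(1) by (auto elim!: is_pullbackE)
  have "Dom C u = Dom C v"
    using arg_cong[OF assms(2), of "Dom C"] assms(4-) by simp
  then have "u \<in> hom C (Dom C u) (Dom C a)" "v \<in> hom C (Dom C u) (Dom C a)"
    using assms by (auto simp: in_hom)
  moreover have "\<exists>!h. h \<in> hom C (Dom C u) (Dom C a) \<and> a \<cdot> h = a \<cdot> u \<and> b \<cdot> h = b \<cdot> u"
    using is_pullback_Ex1[OF assms(1), of "a \<cdot> u" "b \<cdot> u"] assms(4-) fg by (simp add: fg[THEN cmp_extend])
  ultimately show ?thesis using assms(2,3) by metis
qed

lemma is_pullbackI:
  assumes "f \<in> Arr C" "g \<in> Arr C" "a \<in> Arr C" "b \<in> Arr C" "Cod C g = Cod C f"
    "Cod C a = Dom C f" "Cod C b = Dom C g" "Dom C b = Dom C a" "f \<cdot> a = g \<cdot> b"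
    and lift: "\<And>u v. u \<in> Arr C \<Longrightarrow> v \<in> Arr C \<Longrightarrow> Dom C u = Dom C v \<Longrightarrow> Cod C u = Dom C f \<Longrightarrow>
      Cod C v = Dom C g \<Longrightarrow> f \<cdot> u = g \<cdot> v \<Longrightarrow>
      \<exists>h. h \<in> Arr C \<and> Dom C h = Dom C v \<and> Cod C h = Dom C a \<and> a \<cdot> h = u \<and> b \<cdot> h = v"
    and uniq: "\<And>u v. u \<in> Arr C \<Longrightarrow> v \<in> Arr C \<Longrightarrow> Dom C u = Dom C v \<Longrightarrow>
      Cod C u = Dom C a \<Longrightarrow> Cod C v = Dom C a \<Longrightarrow> a \<cdot> u = a \<cdot> v \<Longrightarrow> b \<cdot> u = b \<cdot> v \<Longrightarrow> u = v"
  shows "is_pullback C f g a b"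
  unfolding is_pullback_def
proof (intro exI conjI allI ballI impI)
  fix T u v assume "u \<in> hom C T (Dom C f)" "v \<in> hom C T (Dom C g)" "f \<cdot> u = g \<cdot> v"
  then show "\<exists>!h. h \<in> hom C T (Dom C a) \<and> a \<cdot> h = u \<and> b \<cdot> h = v"
    using lift[of u v] uniq by (auto simp: in_hom)
qed (use assms in \<open>auto simp: in_hom\<close>)

lemma is_coequalizerE:
  assumes "is_coequalizer C e a b"
  obtains "a \<in> Arr C" "b \<in> Arr C" "e \<in> Arr C" "Dom C b = Dom C a" "Cod C a = Dom C e"
    "Cod C b = Dom C e" "e \<cdot> a = e \<cdot> b"
  using assms unfolding is_coequalizer_def in_hom by auto

lemma is_coequalizer_Ex1:
  assumes "is_coequalizer C e a b" "g \<in> Arr C" "Dom C g = Dom C e" "g \<cdot> a = g \<cdot> b"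
  shows "\<exists>!h. h \<in> hom C (Cod C e) (Cod C g) \<and> h \<cdot> e = g"
proof -
  obtain R X Q where *: "e \<in> hom C X Q"
    and univ: "\<forall>T. \<forall>g\<in>hom C X T. g \<cdot> a = g \<cdot> b \<longrightarrow> (\<exists>!h. h \<in> hom C Q T \<and> h \<cdot> e = g)"
    using assms(1) unfolding is_coequalizer_def by blast
  then have Q: "Q = Cod C e" and "g \<in> hom C X (Cod C g)" using assms by (auto simp: in_hom)
  then show ?thesis unfolding Q[symmetric] using univ assms(4) by blast
qed

lemma is_coequalizer_lift:
  assumes "is_coequalizer C e a b" "g \<in> Arr C" "Dom C g = Dom C e" "g \<cdot> a = g \<cdot> b"
  shows "\<exists>h. h \<in> Arr C \<and> Dom C h = Cod C e \<and> Cod C h = Cod C g \<and> h \<cdot> e = g"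
  using is_coequalizer_Ex1[OF assms] by (auto simp: in_hom)

lemma is_coequalizer_lift':
  assumes "is_coequalizer C e a b" "g \<in> Arr C" "Dom C g = Dom C e" "g \<cdot> a = g \<cdot> b" "Cod C e = D" "Cod C g = Q"
  shows "\<exists>h. h \<in> Arr C \<and> Dom C h = D \<and> Cod C h = Q \<and> h \<cdot> e = g"
  using is_coequalizer_lift[OF assms(1-4)] unfolding assms(5,6) .

lemma is_coequalizer_eqI:
  assumes "is_coequalizer C e a b" "u \<cdot> e = v \<cdot> e" "u \<in> Arr C" "v \<in> Arr C" "Dom C u = Cod C e" "Dom C v = Cod C e"
  shows "u = v"
proof -
  have [simp]: "a \<in> Arr C" "b \<in> Arr C" "e \<in> Arr C" "Dom C b = Dom C a" "Cod C a = Dom C e"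
    "Cod C b = Dom C e" and ab: "e \<cdot> a = e \<cdot> b"
    using assms(1) by (auto elim!: is_coequalizerE)
  have "Cod C u = Cod C v"
    using arg_cong[OF assms(2), of "Cod C"] assms(3-) by simp
  then have "u \<in> hom C (Cod C e) (Cod C (u \<cdot> e))" "v \<in> hom C (Cod C e) (Cod C (u \<cdot> e))"
    using assms(3-) by (auto simp: in_hom)
  moreover have "\<exists>!h. h \<in> hom C (Cod C e) (Cod C (u \<cdot> e)) \<and> h \<cdot> e = u \<cdot> e"
    using assms(3-) ab by (intro is_coequalizer_Ex1[OF assms(1)]) auto
  ultimately show ?thesis using assms(2) by metis
qed

lemma is_coequalizerI:
  assumes "a \<in> Arr C" "b \<in> Arr C" "e \<in> Arr C" "Dom C b = Dom C a" "Cod C a = Dom C e"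
    "Cod C b = Dom C e" "e \<cdot> a = e \<cdot> b"
    and lift: "\<And>g. g \<in> Arr C \<Longrightarrow> Dom C g = Dom C e \<Longrightarrow> g \<cdot> a = g \<cdot> b \<Longrightarrow>
      \<exists>h. h \<in> Arr C \<and> Dom C h = Cod C e \<and> Cod C h = Cod C g \<and> h \<cdot> e = g"
    and uniq: "\<And>u v. u \<in> Arr C \<Longrightarrow> v \<in> Arr C \<Longrightarrow> Dom C u = Cod C e \<Longrightarrow> Dom C v = Cod C e \<Longrightarrow>
      Cod C u = Cod C v \<Longrightarrow> u \<cdot> e = v \<cdot> e \<Longrightarrow> u = v"
  shows "is_coequalizer C e a b"
  unfolding is_coequalizer_def
proof (intro exI conjI allI ballI impI)
  fix T g assume "g \<in> hom C (Dom C e) T" "g \<cdot> a = g \<cdot> b"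
  then show "\<exists>!h. h \<in> hom C (Cod C e) T \<and> h \<cdot> e = g"
    using lift[of g] uniq by (auto simp: in_hom)
qed (use assms in \<open>auto simp: in_hom\<close>)

lemma regular_epi_Arr [simp]: "regular_epi C e \<Longrightarrow> e \<in> Arr C"
  unfolding regular_epi_def by (auto elim!: is_coequalizerE)

lemma regular_epi_eqI:
  assumes "regular_epi C e" "u \<cdot> e = v \<cdot> e" "u \<in> Arr C" "v \<in> Arr C" "Dom C u = Cod C e" "Dom C v = Cod C e"
  shows "u = v"
proof -
  obtain a b where "is_coequalizer C e a b" using assms(1) unfolding regular_epi_def by blast
  then show ?thesis using assms(2-) by (rule is_coequalizer_eqI)
qed

text \<open>The coequalized pair consists of the idempotent \<open>s \<cdot> p\<close> and the
  identity: if \<open>g \<cdot> s \<cdot> p = g\<close>, then \<open>g\<close> factors through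
  \<open>p\<close> as \<open>g \<cdot> s\<close>.\<close>

lemma split_epi_regular_epi:
  assumes "p \<in> Arr C" "s \<in> Arr C" "Dom C s = Cod C p" "Cod C s = Dom C p" "p \<cdot> s = ident C (Cod C p)"
  shows "regular_epi C p"
proof -
  have "is_coequalizer C p (s \<cdot> p) (ident C (Dom C p))"
  proof (rule is_coequalizerI)
    fix g assume "g \<in> Arr C" "Dom C g = Dom C p" "g \<cdot> (s \<cdot> p) = g \<cdot> ident C (Dom C p)"
    then show "\<exists>h. h \<in> Arr C \<and> Dom C h = Cod C p \<and> Cod C h = Cod C g \<and> h \<cdot> p = g"
      using assms by (intro exI[of _ "g \<cdot> s"]) auto
  next
    fix u v assume *: "u \<in> Arr C" "v \<in> Arr C" "Dom C u = Cod C p" "Dom C v = Cod C p"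
      "Cod C u = Cod C v" "u \<cdot> p = v \<cdot> p"
    have "u = (u \<cdot> p) \<cdot> s" using assms *(1-5) by simp
    also have "\<dots> = v" unfolding *(6) using assms *(1-5) by simp
    finally show "u = v" .
  qed (use assms in \<open>auto simp: assms(5)[THEN cmp_extend]\<close>)
  then show ?thesis unfolding regular_epi_def by blast
qed

lemma iso_regular_epi: "iso C f \<Longrightarrow> regular_epi C f"
  by (erule isoE) (rule split_epi_regular_epi)

text \<open>The monomorphism cancels from the equation of the coequalized pair, so \<open>x\<close>
  itself factors through \<open>m \<cdot> x\<close>, and the factor is a section of
  \<open>m\<close>.\<close>

lemma regular_epi_monic_iso:
  assumes "monic C m" "regular_epi C (m \<cdot> x)" "x \<in> Arr C" "Cod C x = Dom C m"
  shows "iso C m"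
proof -
  obtain a b where co: "is_coequalizer C (m \<cdot> x) a b" using assms(2) unfolding regular_epi_def by blast
  have [simp]: "m \<in> Arr C" "x \<in> Arr C" "Cod C x = Dom C m" using assms by auto
  have [simp]: "a \<in> Arr C" "b \<in> Arr C" "Dom C b = Dom C a" "Cod C a = Dom C x"
    "Cod C b = Dom C x" and ab: "(m \<cdot> x) \<cdot> a = (m \<cdot> x) \<cdot> b"
    using co by (auto elim!: is_coequalizerE)
  have "x \<cdot> a = x \<cdot> b" by (rule monicD[OF assms(1)]) (use ab in simp_all)
  then obtain t where t [simp]: "t \<in> Arr C" "Dom C t = Cod C m" "Cod C t = Dom C m"
    and tm: "t \<cdot> (m \<cdot> x) = x"
    using is_coequalizer_lift[OF co, of x] by auto
  have "m \<cdot> t = ident C (Cod C m)"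
    by (rule regular_epi_eqI[OF assms(2)]) (simp_all add: tm)
  then show ?thesis by (intro monic_split_epi_iso[OF assms(1), of t]) auto
qed

end

section \<open>Pointed regular protomodular categories\<close>

locale homological = category +
  assumes pointed: "pointed C"
    and regular: "regular_category C"
    and protomodular: "protomodular C"
begin

section \<open>Zero morphisms, kernels, products and equalizers\<close>

lemma zero_arr_eq:
  assumes "zero_obj C Z" "g \<in> Arr C" "Cod C g = Z" "h \<in> Arr C" "Dom C h = Z"
  shows "zero_arr C (Dom C g) (Cod C h) = h \<cdot> g"
  unfolding zero_arr_def
proof (rule the_equality)
  show "\<exists>Z g' h'. zero_obj C Z \<and> g' \<in> hom C (Dom C g) Z \<and> h' \<in> hom C Z (Cod C h) \<and> h \<cdot> g = h' \<cdot> g'"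
    using assms by (auto simp: in_hom)
next
  fix f assume "\<exists>Z g' h'. zero_obj C Z \<and> g' \<in> hom C (Dom C g) Z \<and> h' \<in> hom C Z (Cod C h) \<and> f = h' \<cdot> g'"
  then obtain Z' g' h' where *: "zero_obj C Z'" "g' \<in> hom C (Dom C g) Z'" "h' \<in> hom C Z' (Cod C h)"
    "f = h' \<cdot> g'" by blast
  \<comment> \<open>Two factorisations may use different zero objects; the unique arrow
    \<open>i\<close> between these connects them.\<close>
  have "\<exists>!f. f \<in> hom C Z Z'" "\<exists>!f. f \<in> hom C (Dom C g) Z'" "\<exists>!f. f \<in> hom C Z (Cod C h)"
    using assms *(1) unfolding zero_obj_def initial_obj_def terminal_obj_def by auto
  moreover then obtain i where i: "i \<in> hom C Z Z'" by blast
  moreover have "i \<cdot> g \<in> hom C (Dom C g) Z'" "h' \<cdot> i \<in> hom C Z (Cod C h)" "h \<in> hom C Z (Cod C h)"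
    using i * assms by (auto simp: in_hom)
  ultimately have "g' = i \<cdot> g" "h = h' \<cdot> i" using * by blast+
  then show "f = h \<cdot> g" using * i assms by (auto simp: in_hom)
qed

lemma zero_arr_factors:
  assumes "X \<in> Obj C" "Y \<in> Obj C" "zero_obj C Z"
  obtains g h where "g \<in> Arr C" "Dom C g = X" "Cod C g = Z" "h \<in> Arr C" "Dom C h = Z" "Cod C h = Y"
    "zero_arr C X Y = h \<cdot> g"
proof -
  have "\<exists>!g. g \<in> hom C X Z" "\<exists>!h. h \<in> hom C Z Y"
    using assms unfolding zero_obj_def initial_obj_def terminal_obj_def by auto
  then obtain g h where "g \<in> hom C X Z" "h \<in> hom C Z Y" by blast
  moreover then have "zero_arr C X Y = h \<cdot> g" using zero_arr_eq[OF assms(3), of g h] by (auto simp: in_hom)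
  ultimately show thesis using that by (auto simp: in_hom)
qed

lemma zero_arr_simps [simp]:
  assumes "X \<in> Obj C" "Y \<in> Obj C"
  shows "zero_arr C X Y \<in> Arr C" "Dom C (zero_arr C X Y) = X" "Cod C (zero_arr C X Y) = Y"
proof -
  obtain Z where Z: "zero_obj C Z" using pointed unfolding pointed_def by blast
  obtain g h where "g \<in> Arr C" "Dom C g = X" "Cod C g = Z" "h \<in> Arr C" "Dom C h = Z" "Cod C h = Y"
    "zero_arr C X Y = h \<cdot> g" using zero_arr_factors[OF assms Z] .
  then show "zero_arr C X Y \<in> Arr C" "Dom C (zero_arr C X Y) = X" "Cod C (zero_arr C X Y) = Y" by auto
qed

lemma cmp_zero [simp]:
  assumes "f \<in> Arr C" "Dom C f = Y" "X \<in> Obj C"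
  shows "f \<cdot> zero_arr C X Y = zero_arr C X (Cod C f)"
proof -
  obtain Z where Z: "zero_obj C Z" using pointed unfolding pointed_def by blast
  have "Y \<in> Obj C" using assms Dom_in_Obj by blast
  then obtain g h where *: "g \<in> Arr C" "Dom C g = X" "Cod C g = Z" "h \<in> Arr C" "Dom C h = Z" "Cod C h = Y"
    "zero_arr C X Y = h \<cdot> g" using zero_arr_factors[OF assms(3) _ Z] by metis
  then show ?thesis using zero_arr_eq[OF Z, of g "f \<cdot> h"] assms by simp
qed

lemma zero_cmp [simp]:
  assumes "f \<in> Arr C" "Cod C f = X" "Y \<in> Obj C"
  shows "zero_arr C X Y \<cdot> f = zero_arr C (Dom C f) Y"
proof -
  obtain Z where Z: "zero_obj C Z" using pointed unfolding pointed_def by blast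
  have "X \<in> Obj C" using assms Cod_in_Obj by blast
  then obtain g h where *: "g \<in> Arr C" "Dom C g = X" "Cod C g = Z" "h \<in> Arr C" "Dom C h = Z" "Cod C h = Y"
    "zero_arr C X Y = h \<cdot> g" using zero_arr_factors[OF _ assms(3) Z] by metis
  then show ?thesis using zero_arr_eq[OF Z, of "g \<cdot> f" h] assms by simp
qed

lemma finitely_complete: "finitely_complete C"
  using regular by (simp add: regular_category_def)

lemma pullback_exists:
  assumes "f \<in> Arr C" "g \<in> Arr C" "Cod C g = Cod C f"
  shows "\<exists>a b. is_pullback C f g a b"
  using finitely_complete assms unfolding finitely_complete_def
  by (metis in_hom)

lemma is_kernelE:
  assumes "is_kernel C k f"
  obtains "k \<in> Arr C" "f \<in> Arr C" "Cod C k = Dom C f" "f \<cdot> k = zero_arr C (Dom C k) (Cod C f)"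
  using assms unfolding is_kernel_def in_hom by auto

lemma is_kernel_Ex1:
  assumes "is_kernel C k f" "g \<in> Arr C" "Cod C g = Dom C f" "f \<cdot> g = zero_arr C (Dom C g) (Cod C f)"
  shows "\<exists>!h. h \<in> hom C (Dom C g) (Dom C k) \<and> k \<cdot> h = g"
proof -
  obtain K X Y where *: "k \<in> hom C K X" "f \<in> hom C X Y"
    and univ: "\<forall>T. \<forall>g\<in>hom C T X. f \<cdot> g = zero_arr C T Y \<longrightarrow> (\<exists>!h. h \<in> hom C T K \<and> k \<cdot> h = g)"
    using assms(1) unfolding is_kernel_def by blast
  then have K: "K = Dom C k" and "g \<in> hom C (Dom C g) X" "f \<cdot> g = zero_arr C (Dom C g) Y"
    using assms by (auto simp: in_hom)
  then show ?thesis unfolding K[symmetric] using univ by blast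
qed

lemma is_kernel_lift:
  assumes "is_kernel C k f" "g \<in> Arr C" "Cod C g = Dom C f" "f \<cdot> g = zero_arr C (Dom C g) (Cod C f)"
  shows "\<exists>h. h \<in> Arr C \<and> Dom C h = Dom C g \<and> Cod C h = Dom C k \<and> k \<cdot> h = g"
  using is_kernel_Ex1[OF assms] by (auto simp: in_hom)

lemma is_kernel_lift':
  assumes "is_kernel C k f" "g \<in> Arr C" "Cod C g = Dom C f" "f \<cdot> g = zero_arr C (Dom C g) (Cod C f)"
    "Dom C g = D" "Dom C k = K"
  shows "\<exists>h. h \<in> Arr C \<and> Dom C h = D \<and> Cod C h = K \<and> k \<cdot> h = g"
  using is_kernel_lift[OF assms(1-4)] unfolding assms(5,6) .

lemma is_kernel_monic:
  assumes "is_kernel C k f"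
  shows "monic C k"
proof -
  have [simp]: "k \<in> Arr C" "f \<in> Arr C" "Cod C k = Dom C f" and
    0: "f \<cdot> k = zero_arr C (Dom C k) (Cod C f)"
    using assms by (auto elim!: is_kernelE)
  show ?thesis
  proof (rule monicI)
    fix g h assume *: "g \<in> Arr C" "h \<in> Arr C" "Dom C g = Dom C h" "Cod C g = Dom C k"
      "Cod C h = Dom C k" "k \<cdot> g = k \<cdot> h"
    then have "\<exists>!x. x \<in> hom C (Dom C (k \<cdot> h)) (Dom C k) \<and> k \<cdot> x = k \<cdot> h"
      by (intro is_kernel_Ex1[OF assms]) (auto simp: 0[THEN cmp_extend])
    moreover have "g \<in> hom C (Dom C (k \<cdot> h)) (Dom C k)" "h \<in> hom C (Dom C (k \<cdot> h)) (Dom C k)"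
      using * by (auto simp: in_hom)
    ultimately show "g = h" using *(6) by metis
  qed simp
qed

lemma is_kernelI:
  assumes "monic C k" "f \<in> Arr C" "Cod C k = Dom C f" "f \<cdot> k = zero_arr C (Dom C k) (Cod C f)"
    and lift: "\<And>g. g \<in> Arr C \<Longrightarrow> Cod C g = Dom C f \<Longrightarrow> f \<cdot> g = zero_arr C (Dom C g) (Cod C f) \<Longrightarrow>
      \<exists>h. h \<in> Arr C \<and> Dom C h = Dom C g \<and> Cod C h = Dom C k \<and> k \<cdot> h = g"
  shows "is_kernel C k f"
  unfolding is_kernel_def
proof (intro exI conjI allI ballI impI)
  fix T g assume "g \<in> hom C T (Dom C f)" "f \<cdot> g = zero_arr C T (Cod C f)"
  then obtain h where h: "h \<in> hom C T (Dom C k)" "k \<cdot> h = g"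
    using lift[of g] by (auto simp: in_hom)
  then show "\<exists>!h. h \<in> hom C T (Dom C k) \<and> k \<cdot> h = g"
    using monicD[OF assms(1)] by (intro ex1I[of _ h]) (auto simp: in_hom)
qed (use assms in \<open>auto simp: in_hom\<close>)

lemma terminal_eqI:
  assumes "terminal_obj C Z" "u \<in> Arr C" "v \<in> Arr C" "Dom C u = Dom C v" "Cod C u = Z" "Cod C v = Z"
  shows "u = v"
proof -
  have "u \<in> hom C (Dom C u) Z" "v \<in> hom C (Dom C u) Z" "Dom C u \<in> Obj C"
    using assms by (auto simp: in_hom)
  then show ?thesis using assms(1) unfolding terminal_obj_def by blast
qed

text \<open>Pull back along the arrow out of a zero object. The second leg of the pullback ends in a
  terminal object and so carries no information, which leaves a monic first leg.\<close>

lemma kernel_exists: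
  assumes "f \<in> Arr C"
  shows "\<exists>k. is_kernel C k f"
proof -
  note [simp] = assms
  obtain Z where Z: "zero_obj C Z" using pointed unfolding pointed_def by blast
  then have [simp]: "Z \<in> Obj C" and t: "terminal_obj C Z" by (auto simp: zero_obj_def initial_obj_def)
  obtain k b where pb: "is_pullback C f (zero_arr C Z (Cod C f)) k b"
    using pullback_exists[of f "zero_arr C Z (Cod C f)"] by auto
  have [simp]: "k \<in> Arr C" "b \<in> Arr C" "Cod C k = Dom C f" "Cod C b = Z" "Dom C b = Dom C k"
    and e: "f \<cdot> k = zero_arr C Z (Cod C f) \<cdot> b"
    using pb by (auto elim!: is_pullbackE)
  have "is_kernel C k f"
  proof (rule is_kernelI)
    show "monic C k"
    proof (rule monicI)
      fix g h assume *: "g \<in> Arr C" "h \<in> Arr C" "Dom C g = Dom C h" "Cod C g = Dom C k"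
        "Cod C h = Dom C k" "k \<cdot> g = k \<cdot> h"
      moreover have "b \<cdot> g = b \<cdot> h" by (rule terminal_eqI[OF t]) (use * in auto)
      ultimately show "g = h" using is_pullback_eqI[OF pb, of g h] by auto
    qed simp
  next
    fix g assume "g \<in> Arr C" "Cod C g = Dom C f" "f \<cdot> g = zero_arr C (Dom C g) (Cod C f)"
    then show "\<exists>h. h \<in> Arr C \<and> Dom C h = Dom C g \<and> Cod C h = Dom C k \<and> k \<cdot> h = g"
      using is_pullback_lift[OF pb, of g "zero_arr C (Dom C g) Z"] by auto
  qed (use e in auto)
  then show ?thesis by blast
qed

lemma product_exists:
  assumes "X \<in> Obj C" "Y \<in> Obj C"
  shows "\<exists>p q. is_product C X Y p q"
proof -
  note [simp] = assms
  obtain Z where Z: "zero_obj C Z" using pointed unfolding pointed_def by blast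
  then have [simp]: "Z \<in> Obj C" and t: "terminal_obj C Z" by (auto simp: zero_obj_def initial_obj_def)
  obtain p q where pb: "is_pullback C (zero_arr C X Z) (zero_arr C Y Z) p q"
    using pullback_exists[of "zero_arr C X Z" "zero_arr C Y Z"] by auto
  have [simp]: "p \<in> Arr C" "q \<in> Arr C" "Cod C p = X" "Cod C q = Y" "Dom C q = Dom C p"
    using pb by (auto elim!: is_pullbackE)
  have "is_product C X Y p q"
    unfolding is_product_def
  proof (intro exI conjI allI ballI)
    fix T f g assume "f \<in> hom C T X" "g \<in> hom C T Y"
    then show "\<exists>!h. h \<in> hom C T (Dom C p) \<and> p \<cdot> h = f \<and> q \<cdot> h = g"
      using is_pullback_Ex1[OF pb, of f g] by (auto simp: in_hom)
  qed (auto simp: in_hom)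
  then show ?thesis by blast
qed

lemma is_product_prod:
  assumes "X \<in> Obj C" "Y \<in> Obj C"
  shows "is_product C X Y (pr1 C X Y) (pr2 C X Y)"
proof -
  have "\<exists>pq. case pq of (p, q) \<Rightarrow> is_product C X Y p q" using product_exists[OF assms] by auto
  from someI_ex[OF this] show ?thesis unfolding pr1_def pr2_def by (simp add: case_prod_unfold)
qed

lemma pr_simps [simp]:
  assumes "X \<in> Obj C" "Y \<in> Obj C"
  shows "pr1 C X Y \<in> Arr C" "pr2 C X Y \<in> Arr C" "Dom C (pr1 C X Y) = prod_obj C X Y"
    "Dom C (pr2 C X Y) = prod_obj C X Y" "Cod C (pr1 C X Y) = X" "Cod C (pr2 C X Y) = Y"
    "prod_obj C X Y \<in> Obj C"
  using is_product_prod[OF assms] unfolding is_product_def in_hom prod_obj_def by auto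

lemma product_Ex1:
  assumes "f \<in> Arr C" "g \<in> Arr C" "Dom C f = Dom C g"
  shows "\<exists>!h. h \<in> hom C (Dom C f) (prod_obj C (Cod C f) (Cod C g)) \<and>
     pr1 C (Cod C f) (Cod C g) \<cdot> h = f \<and> pr2 C (Cod C f) (Cod C g) \<cdot> h = g"
proof -
  have "f \<in> hom C (Dom C f) (Cod C f)" "g \<in> hom C (Dom C f) (Cod C g)"
    using assms by (auto simp: in_hom)
  moreover have "Dom C (pr1 C (Cod C f) (Cod C g)) = prod_obj C (Cod C f) (Cod C g)"
    using assms by simp
  ultimately show ?thesis
    using is_product_prod[of "Cod C f" "Cod C g"] assms unfolding is_product_def
    by (metis Cod_in_Obj in_hom)
qed

lemma tuple_simps [simp]:
  assumes "f \<in> Arr C" "g \<in> Arr C" "Dom C f = Dom C g"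
  shows "tuple C f g \<in> Arr C" "Dom C (tuple C f g) = Dom C g"
    "Cod C (tuple C f g) = prod_obj C (Cod C f) (Cod C g)"
    "Cod C f = X \<Longrightarrow> Cod C g = Y \<Longrightarrow> pr1 C X Y \<cdot> tuple C f g = f"
    "Cod C f = X \<Longrightarrow> Cod C g = Y \<Longrightarrow> pr2 C X Y \<cdot> tuple C f g = g"
proof -
  have "tuple C f g \<in> hom C (Dom C f) (prod_obj C (Cod C f) (Cod C g)) \<and>
     pr1 C (Cod C f) (Cod C g) \<cdot> tuple C f g = f \<and> pr2 C (Cod C f) (Cod C g) \<cdot> tuple C f g = g"
    unfolding tuple_def by (rule theI'[OF product_Ex1[OF assms]])
  then show "tuple C f g \<in> Arr C" "Dom C (tuple C f g) = Dom C g"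
    "Cod C (tuple C f g) = prod_obj C (Cod C f) (Cod C g)"
    "Cod C f = X \<Longrightarrow> Cod C g = Y \<Longrightarrow> pr1 C X Y \<cdot> tuple C f g = f"
    "Cod C f = X \<Longrightarrow> Cod C g = Y \<Longrightarrow> pr2 C X Y \<cdot> tuple C f g = g"
    using assms(3) by (auto simp: in_hom)
qed

lemma tuple_cmp_simps [simp]:
  assumes "f \<in> Arr C" "g \<in> Arr C" "Dom C f = Dom C g" "t \<in> Arr C" "Cod C t = Dom C g"
  shows "Cod C f = X \<Longrightarrow> Cod C g = Y \<Longrightarrow> pr1 C X Y \<cdot> (tuple C f g \<cdot> t) = f \<cdot> t"
    "Cod C f = X \<Longrightarrow> Cod C g = Y \<Longrightarrow> pr2 C X Y \<cdot> (tuple C f g \<cdot> t) = g \<cdot> t"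
  using assms cmp_extend[of "pr1 C X Y" "tuple C f g" f t] cmp_extend[of "pr2 C X Y" "tuple C f g" g t] by auto

lemma prod_eqI:
  assumes "pr1 C X Y \<cdot> u = pr1 C X Y \<cdot> v" "pr2 C X Y \<cdot> u = pr2 C X Y \<cdot> v" "u \<in> Arr C" "v \<in> Arr C"
    "Cod C u = prod_obj C X Y" "Cod C v = prod_obj C X Y" "X \<in> Obj C" "Y \<in> Obj C"
  shows "u = v"
proof -
  have "Dom C u = Dom C v" using arg_cong[OF assms(1), of "Dom C"] assms(3-) by simp
  then have "u \<in> hom C (Dom C u) (prod_obj C X Y)" "v \<in> hom C (Dom C u) (prod_obj C X Y)"
    using assms by (auto simp: in_hom)
  moreover have "\<exists>!h. h \<in> hom C (Dom C u) (prod_obj C X Y) \<and>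
     pr1 C X Y \<cdot> h = pr1 C X Y \<cdot> u \<and> pr2 C X Y \<cdot> h = pr2 C X Y \<cdot> u"
    using product_Ex1[of "pr1 C X Y \<cdot> u" "pr2 C X Y \<cdot> u"] assms(3-) by simp
  ultimately show ?thesis using assms(1,2) by metis
qed

text \<open>The equalizer is the intersection of the graphs of \<open>u\<close> and
  \<open>v\<close>: the first coordinate forces the two legs of the pullback to coincide, and the
  second yields the equation.\<close>

lemma equalizer_exists:
  assumes "u \<in> Arr C" "v \<in> Arr C" "Dom C u = Dom C v" "Cod C u = Cod C v"
  shows "\<exists>m. monic C m \<and> Cod C m = Dom C u \<and> u \<cdot> m = v \<cdot> m \<and>
    (\<forall>g. g \<in> Arr C \<longrightarrow> Cod C g = Dom C u \<longrightarrow> u \<cdot> g = v \<cdot> g \<longrightarrow>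
      (\<exists>h. h \<in> Arr C \<and> Dom C h = Dom C g \<and> Cod C h = Dom C m \<and> m \<cdot> h = g))"
proof -
  note [simp] = assms
  let ?X = "Dom C u" and ?Y = "Cod C u"
  let ?f = "tuple C (ident C ?X) u" and ?g = "tuple C (ident C ?X) v"
  obtain m n where pb: "is_pullback C ?f ?g m n"
    using pullback_exists[of ?f ?g] by auto
  have [simp]: "m \<in> Arr C" "n \<in> Arr C" "Cod C m = ?X" "Cod C n = ?X" "Dom C n = Dom C m"
    and e: "?f \<cdot> m = ?g \<cdot> n"
    using pb by (auto elim!: is_pullbackE)
  have mn: "n = m" using arg_cong[OF e, of "\<lambda>x. pr1 C ?X ?Y \<cdot> x"] by simp
  have uv: "u \<cdot> m = v \<cdot> n" using arg_cong[OF e, of "\<lambda>x. pr2 C ?X ?Y \<cdot> x"] by simp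
  have "monic C m"
  proof (rule monicI)
    fix g h assume "g \<in> Arr C" "h \<in> Arr C" "Cod C g = Dom C m" "Cod C h = Dom C m" "m \<cdot> g = m \<cdot> h"
    then show "g = h" using is_pullback_eqI[OF pb, of g h] by (simp add: mn)
  qed simp
  moreover have "\<exists>h. h \<in> Arr C \<and> Dom C h = Dom C g \<and> Cod C h = Dom C m \<and> m \<cdot> h = g"
    if [simp]: "g \<in> Arr C" "Cod C g = Dom C u" and e: "u \<cdot> g = v \<cdot> g" for g
  proof -
    have "?f \<cdot> g = ?g \<cdot> g" by (rule prod_eqI[of ?X ?Y]) (use e in auto)
    then show ?thesis using is_pullback_lift[OF pb, of g g] by auto
  qed
  moreover have "u \<cdot> m = v \<cdot> m" using uv by (simp add: mn)
  ultimately show ?thesis by (intro exI[of _ m]) simp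
qed

subsection \<open>Regular epimorphisms and images\<close>

lemma pullback_regular_epi:
  "is_pullback C f g a b \<Longrightarrow> regular_epi C f \<Longrightarrow> regular_epi C b"
  using regular unfolding regular_category_def by blast

text \<open>The substitute for choosing a preimage of the generalized element \<open>u\<close>: it
  exists after passing to a cover \<open>t\<close>.\<close>

lemma regular_epi_local_lift:
  assumes "regular_epi C e" "u \<in> Arr C" "Cod C u = Cod C e"
  shows "\<exists>t x. regular_epi C t \<and> Cod C t = Dom C u \<and> x \<in> Arr C \<and> Dom C x = Dom C t \<and>
    Cod C x = Dom C e \<and> e \<cdot> x = u \<cdot> t"
proof -
  obtain a b where pb: "is_pullback C e u a b"
    using pullback_exists[of e u] assms by auto
  then have "regular_epi C b" using pullback_regular_epi assms by blast
  with pb show ?thesis by (intro exI[of _ b] exI[of _ a]) (auto elim!: is_pullbackE)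
qed

text \<open>Take for \<open>e\<close> the coequalizer of the kernel pair of \<open>f\<close>. The
  induced \<open>m\<close> is monic: two elements identified by \<open>m\<close> lift along
  \<open>e\<close> after two successive covers, the lifts form a pair in the kernel pair of
  \<open>f\<close>, and \<open>e\<close> identifies such pairs. The covers are then cancelled one
  after the other.\<close>

lemma image_factorization:
  assumes "f \<in> Arr C"
  shows "\<exists>m e. monic C m \<and> regular_epi C e \<and> Dom C e = Dom C f \<and> Cod C e = Dom C m \<and>
    Cod C m = Cod C f \<and> m \<cdot> e = f"
proof -
  note [simp] = assms
  obtain a b where pb: "is_pullback C f f a b"
    using pullback_exists[of f f] by auto
  have [simp]: "a \<in> Arr C" "b \<in> Arr C" "Cod C a = Dom C f" "Cod C b = Dom C f" "Dom C b = Dom C a"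
    and ab: "f \<cdot> a = f \<cdot> b"
    using pb by (auto elim!: is_pullbackE)
  obtain e where co: "is_coequalizer C e a b"
    using pb regular unfolding regular_category_def is_kernel_pair_def by blast
  have [simp]: "e \<in> Arr C" "Dom C e = Dom C f" and eab: "e \<cdot> a = e \<cdot> b"
    using co by (auto elim!: is_coequalizerE)
  have re: "regular_epi C e" using co unfolding regular_epi_def by blast
  obtain m where [simp]: "m \<in> Arr C" "Dom C m = Cod C e" "Cod C m = Cod C f" and m: "m \<cdot> e = f"
    using is_coequalizer_lift[OF co, of f] ab by auto
  have "monic C m"
  proof (rule monicI)
    fix u v assume [simp]: "u \<in> Arr C" "v \<in> Arr C" "Dom C u = Dom C v" "Cod C u = Dom C m" "Cod C v = Dom C m"
      and muv: "m \<cdot> u = m \<cdot> v"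
    obtain t x where t: "regular_epi C t" and [simp]: "Cod C t = Dom C v" "x \<in> Arr C" "Dom C x = Dom C t"
      "Cod C x = Dom C f" and ex: "e \<cdot> x = u \<cdot> t"
      using regular_epi_local_lift[OF re, of u] by auto
    have [simp]: "t \<in> Arr C" using t by simp
    obtain t' y where t': "regular_epi C t'" and [simp]: "Cod C t' = Dom C t" "y \<in> Arr C" "Dom C y = Dom C t'"
      "Cod C y = Dom C f" and ey: "e \<cdot> y = (v \<cdot> t) \<cdot> t'"
      using regular_epi_local_lift[OF re, of "v \<cdot> t"] by auto
    have [simp]: "t' \<in> Arr C" using t' by simp
    have "m \<cdot> (e \<cdot> (x \<cdot> t')) = m \<cdot> (e \<cdot> y)" by (simp add: ex[THEN cmp_extend] ey muv[THEN cmp_extend])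
    then have "f \<cdot> (x \<cdot> t') = f \<cdot> y" by (simp add: m[THEN cmp_extend])
    then obtain z where [simp]: "z \<in> Arr C" "Dom C z = Dom C y" "Cod C z = Dom C a"
      and z: "a \<cdot> z = x \<cdot> t'" "b \<cdot> z = y"
      using is_pullback_lift[OF pb, of "x \<cdot> t'" y] by auto
    have "(e \<cdot> a) \<cdot> z = (e \<cdot> b) \<cdot> z" using eab by simp
    then have "(u \<cdot> t) \<cdot> t' = (v \<cdot> t) \<cdot> t'" by (simp add: z ey) (simp add: ex[THEN cmp_extend])
    then have "u \<cdot> t = v \<cdot> t" by (rule regular_epi_eqI[OF t']) auto
    then show "u = v" by (rule regular_epi_eqI[OF t]) auto
  qed simp
  then show ?thesis using re m by (intro exI[of _ m] exI[of _ e]) simp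
qed

text \<open>The converse of \<open>regular_epi_monic_iso\<close>, applied to the image of
  \<open>f\<close>. It reduces the closure properties of regular epimorphisms to statements about a
  single monomorphism.\<close>

lemma regular_epiI_monic:
  assumes "f \<in> Arr C"
    and "\<And>m x. monic C m \<Longrightarrow> x \<in> Arr C \<Longrightarrow> Cod C x = Dom C m \<Longrightarrow> m \<cdot> x = f \<Longrightarrow> iso C m"
  shows "regular_epi C f"
proof -
  obtain m e where *: "monic C m" "regular_epi C e" "Dom C e = Dom C f" "Cod C e = Dom C m"
    "Cod C m = Cod C f" "m \<cdot> e = f" using image_factorization[OF assms(1)] by blast
  then obtain a b where co: "is_coequalizer C e a b" unfolding regular_epi_def by blast
  have [simp]: "m \<in> Arr C" "e \<in> Arr C" "Cod C e = Dom C m" using * by auto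
  have [simp]: "a \<in> Arr C" "b \<in> Arr C" "Dom C b = Dom C a" "Cod C a = Dom C e"
    "Cod C b = Dom C e" and ab: "e \<cdot> a = e \<cdot> b"
    using co by (auto elim!: is_coequalizerE)
  have "iso C m" by (rule assms(2)[of m e]) (use * in auto)
  then obtain n where [simp]: "n \<in> Arr C" "Dom C n = Cod C m" "Cod C n = Dom C m"
    and n: "n \<cdot> m = ident C (Dom C m)" "m \<cdot> n = ident C (Cod C m)" by (auto elim: isoE)
  have "is_coequalizer C (m \<cdot> e) a b"
  proof (rule is_coequalizerI)
    fix g assume g: "g \<in> Arr C" "Dom C g = Dom C (m \<cdot> e)" "g \<cdot> a = g \<cdot> b"
    then obtain h where "h \<in> Arr C" "Dom C h = Cod C e" "Cod C h = Cod C g" "h \<cdot> e = g"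
      using is_coequalizer_lift[OF co, of g] by auto
    then show "\<exists>h. h \<in> Arr C \<and> Dom C h = Cod C (m \<cdot> e) \<and> Cod C h = Cod C g \<and> h \<cdot> (m \<cdot> e) = g"
      by (intro exI[of _ "h \<cdot> n"]) (simp add: n(1)[THEN cmp_extend])
  next
    fix u v assume uv: "u \<in> Arr C" "v \<in> Arr C" "Dom C u = Cod C (m \<cdot> e)" "Dom C v = Cod C (m \<cdot> e)"
      "u \<cdot> (m \<cdot> e) = v \<cdot> (m \<cdot> e)"
    then have "u \<cdot> m = v \<cdot> m" using regular_epi_eqI[OF *(2), of "u \<cdot> m" "v \<cdot> m"] by auto
    then have "(u \<cdot> m) \<cdot> n = (v \<cdot> m) \<cdot> n" by simp
    then show "u = v" using uv by (simp add: n)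
  qed (use ab in auto)
  then show ?thesis unfolding *(6) regular_epi_def by blast
qed

text \<open>If \<open>g \<cdot> f\<close> factors through a monomorphism \<open>m\<close>, then its
  other factor coequalizes the pair that \<open>f\<close> coequalizes. Hence it factors through
  \<open>f\<close>, and so \<open>g\<close> factors through \<open>m\<close>.\<close>

lemma regular_epi_cmp:
  assumes "regular_epi C f" "regular_epi C g" "Dom C g = Cod C f"
  shows "regular_epi C (g \<cdot> f)"
proof (rule regular_epiI_monic)
  have [simp]: "f \<in> Arr C" "g \<in> Arr C" "Dom C g = Cod C f" using assms by auto
  show "g \<cdot> f \<in> Arr C" by simp
  fix m x assume m: "monic C m" and [simp]: "x \<in> Arr C" "Cod C x = Dom C m" and e: "m \<cdot> x = g \<cdot> f"
  have [simp]: "m \<in> Arr C" using m by simp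
  have [simp]: "Dom C x = Dom C f" "Cod C m = Cod C g"
    using arg_cong[OF e, of "Dom C"] arg_cong[OF e, of "Cod C"] by simp_all
  obtain a b where co: "is_coequalizer C f a b" using assms(1) unfolding regular_epi_def by blast
  have [simp]: "a \<in> Arr C" "b \<in> Arr C" "Dom C b = Dom C a" "Cod C a = Dom C f"
    "Cod C b = Dom C f" and ab: "f \<cdot> a = f \<cdot> b"
    using co by (auto elim!: is_coequalizerE)
  have "x \<cdot> a = x \<cdot> b" by (rule monicD[OF m]) (simp_all add: e[THEN cmp_extend] ab)
  then obtain y where [simp]: "y \<in> Arr C" "Dom C y = Cod C f" "Cod C y = Dom C m" and y: "y \<cdot> f = x"
    using is_coequalizer_lift[OF co, of x] by auto
  have "m \<cdot> y = g" by (rule regular_epi_eqI[OF assms(1)]) (simp_all add: y e)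
  then show "iso C m" using assms(2) by (intro regular_epi_monic_iso[OF m, of y]) auto
qed

lemma regular_epi_cancel:
  assumes "regular_epi C (g \<cdot> f)" "g \<in> Arr C" "f \<in> Arr C" "Dom C g = Cod C f"
  shows "regular_epi C g"
proof (rule regular_epiI_monic)
  note [simp] = assms(2-)
  fix m x assume m: "monic C m" and [simp]: "x \<in> Arr C" "Cod C x = Dom C m" and e: "m \<cdot> x = g"
  have [simp]: "m \<in> Arr C" using m by simp
  have [simp]: "Dom C x = Cod C f"
    using arg_cong[OF e, of "Dom C"] by simp
  have "regular_epi C (m \<cdot> (x \<cdot> f))" using assms(1) by (simp add: e[symmetric])
  then show "iso C m" by (intro regular_epi_monic_iso[OF m]) auto
qed fact

lemma zero_obj_exists:
  obtains Z where "zero_obj C Z" "Z \<in> Obj C" "terminal_obj C Z"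
  using pointed unfolding pointed_def zero_obj_def initial_obj_def by blast

subsection \<open>Consequences of protomodularity\<close>

lemma protomodularD:
  assumes "is_point C E B p s" "is_point C E' B p' s'" "h \<in> hom C E E'" "p' \<cdot> h = p" "h \<cdot> s = s'"
    "v \<in> hom C D B" "is_pullback C p v a b" "is_pullback C p' v a' b'"
    "w \<in> hom C (Dom C a) (Dom C a')" "a' \<cdot> w = h \<cdot> a" "b' \<cdot> w = b" "iso C w"
  shows "iso C h"
  using protomodular assms unfolding protomodular_def by blast

text \<open>
  The pullbacks of \<open>\<pi> \<cdot> m\<close> along itself and along \<open>\<pi>\<close> are points over \<open>Dom m\<close> with the same kernel,
  since \<open>ker \<pi>\<close> factors through \<open>m\<close>. By protomodularity they agree, which makes \<open>m\<close> a regular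
  epimorphism as well.
\<close>

lemma monic_iso_if_contains_kernel:
  assumes m: "monic C m" and [simp]: "\<pi> \<in> Arr C" "Dom C \<pi> = Cod C m"
    and re: "regular_epi C (\<pi> \<cdot> m)" and kn: "is_kernel C n \<pi>"
    and [simp]: "n' \<in> Arr C" "Cod C n' = Dom C m" and n': "m \<cdot> n' = n"
  shows "iso C m"
proof -
  have [simp]: "m \<in> Arr C" using m by simp
  have [simp]: "n \<in> Arr C" "Cod C n = Cod C m" and pin: "\<pi> \<cdot> n = zero_arr C (Dom C n) (Cod C \<pi>)"
    using kn by (auto elim!: is_kernelE)
  have [simp]: "Dom C n = Dom C n'" using arg_cong[OF n', of "Dom C"] by simp
  have pin': "\<pi> \<cdot> (m \<cdot> n') = zero_arr C (Dom C n') (Cod C \<pi>)" using pin by (simp add: n')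
  obtain a b where pb: "is_pullback C (\<pi> \<cdot> m) (\<pi> \<cdot> m) a b"
    using pullback_exists[of "\<pi> \<cdot> m" "\<pi> \<cdot> m"] by auto
  have [simp]: "a \<in> Arr C" "b \<in> Arr C" "Cod C a = Dom C m" "Cod C b = Dom C m" "Dom C b = Dom C a"
    and ab: "\<pi> \<cdot> (m \<cdot> a) = \<pi> \<cdot> (m \<cdot> b)"
    using pb by (auto elim!: is_pullbackE)
  obtain a' b' where pb': "is_pullback C (\<pi> \<cdot> m) \<pi> a' b'"
    using pullback_exists[of "\<pi> \<cdot> m" \<pi>] by auto
  have [simp]: "a' \<in> Arr C" "b' \<in> Arr C" "Cod C a' = Dom C m" "Cod C b' = Cod C m" "Dom C b' = Dom C a'"
    and ab': "\<pi> \<cdot> (m \<cdot> a') = \<pi> \<cdot> b'"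
    using pb' by (auto elim!: is_pullbackE)
  obtain s where [simp]: "s \<in> Arr C" "Dom C s = Dom C m" "Cod C s = Dom C a"
    and s: "a \<cdot> s = ident C (Dom C m)" "b \<cdot> s = ident C (Dom C m)"
    by atomize_elim (rule is_pullback_lift'[OF pb], simp_all)
  obtain s' where [simp]: "s' \<in> Arr C" "Dom C s' = Dom C m" "Cod C s' = Dom C a'"
    and s': "a' \<cdot> s' = ident C (Dom C m)" "b' \<cdot> s' = m"
    by atomize_elim (rule is_pullback_lift'[OF pb'], simp_all)
  obtain h where [simp]: "h \<in> Arr C" "Dom C h = Dom C a" "Cod C h = Dom C a'"
    and h: "a' \<cdot> h = a" "b' \<cdot> h = m \<cdot> b"
    by atomize_elim (rule is_pullback_lift'[OF pb'], simp_all add: ab)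
  have hs: "h \<cdot> s = s'"
    by (rule is_pullback_eqI[OF pb']) (simp_all add: h[THEN cmp_extend] s s')
  obtain Z where [simp]: "Z \<in> Obj C" using zero_obj_exists by blast
  \<comment> \<open>Change of base along an arrow out of a zero object turns the two points
    \<open>(a, s)\<close> and \<open>(a', s')\<close> into their kernels, so \<open>w\<close> below
    is the morphism that \<open>h\<close> induces between kernels.\<close>
  let ?v = "zero_arr C Z (Dom C m)"
  obtain \<kappa> \<tau> where k: "is_pullback C a ?v \<kappa> \<tau>"
    using pullback_exists[of a ?v] by auto
  have [simp]: "\<kappa> \<in> Arr C" "\<tau> \<in> Arr C" "Cod C \<kappa> = Dom C a" "Cod C \<tau> = Z" "Dom C \<tau> = Dom C \<kappa>"
    and ak: "a \<cdot> \<kappa> = zero_arr C (Dom C \<kappa>) (Dom C m)"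
    using k by (auto elim!: is_pullbackE)
  obtain \<kappa>' \<tau>' where k': "is_pullback C a' ?v \<kappa>' \<tau>'"
    using pullback_exists[of a' ?v] by auto
  have [simp]: "\<kappa>' \<in> Arr C" "\<tau>' \<in> Arr C" "Cod C \<kappa>' = Dom C a'" "Cod C \<tau>' = Z" "Dom C \<tau>' = Dom C \<kappa>'"
    and ak': "a' \<cdot> \<kappa>' = zero_arr C (Dom C \<kappa>') (Dom C m)"
    using k' by (auto elim!: is_pullbackE)
  obtain w where [simp]: "w \<in> Arr C" "Dom C w = Dom C \<kappa>" "Cod C w = Dom C \<kappa>'"
    and w: "\<kappa>' \<cdot> w = h \<cdot> \<kappa>" "\<tau>' \<cdot> w = \<tau>"
    by atomize_elim (rule is_pullback_lift'[OF k'], simp_all add: h[THEN cmp_extend] ak)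
  have pbk: "\<pi> \<cdot> (b' \<cdot> \<kappa>') = zero_arr C (Dom C \<kappa>') (Cod C \<pi>)"
    using ab'[THEN cmp_extend3] cmp_extend[OF ab'[symmetric], of \<kappa>'] ak' by simp
  \<comment> \<open>Construction of the inverse of \<open>w\<close>. An element of the kernel of
    \<open>a'\<close> is a pair whose first entry is zero and whose second entry lies in the kernel
    of \<open>\<pi>\<close>. The latter comes from the domain of \<open>m\<close> through
    \<open>n'\<close>, which gives the pair \<open>z\<close> in the kernel of
    \<open>a\<close>.\<close>
  obtain y where [simp]: "y \<in> Arr C" "Dom C y = Dom C \<kappa>'" "Cod C y = Dom C n'" and y: "n \<cdot> y = b' \<cdot> \<kappa>'"
    by atomize_elim (rule is_kernel_lift'[OF kn], simp_all add: pbk)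
  obtain z where [simp]: "z \<in> Arr C" "Dom C z = Dom C \<kappa>'" "Cod C z = Dom C a"
    and z: "a \<cdot> z = zero_arr C (Dom C \<kappa>') (Dom C m)" "b \<cdot> z = n' \<cdot> y"
    by atomize_elim (rule is_pullback_lift'[OF pb], simp_all add: pin' pin'[THEN cmp_extend3])
  obtain z' where [simp]: "z' \<in> Arr C" "Dom C z' = Dom C \<kappa>'" "Cod C z' = Dom C \<kappa>"
    and z': "\<kappa> \<cdot> z' = z" "\<tau> \<cdot> z' = \<tau>'"
    by atomize_elim (rule is_pullback_lift'[OF k], simp_all add: z)
  have mb: "m \<cdot> (b \<cdot> z) = b' \<cdot> \<kappa>'" using y by (simp add: z n'[THEN cmp_extend])
  have "h \<cdot> z = \<kappa>'"
    by (rule is_pullback_eqI[OF pb']) (simp_all add: h[THEN cmp_extend] z(1) ak' mb)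
  then have wz: "w \<cdot> z' = ident C (Dom C \<kappa>')"
    by (intro is_pullback_eqI[OF k', of "w \<cdot> z'" "ident C (Dom C \<kappa>')"]) (simp_all add: w[THEN cmp_extend] z')
  have "m \<cdot> (b \<cdot> (z \<cdot> w)) = m \<cdot> (b \<cdot> \<kappa>)"
    using cmp_extend[OF h(2), of \<kappa>] by (simp add: mb[THEN cmp_extend3] w)
  then have "b \<cdot> (z \<cdot> w) = b \<cdot> \<kappa>"
    using monicD[OF m, of "b \<cdot> (z \<cdot> w)" "b \<cdot> \<kappa>"] by simp
  then have "z \<cdot> w = \<kappa>"
    by (intro is_pullback_eqI[OF pb, of "z \<cdot> w" "\<kappa>"]) (simp_all add: z(1)[THEN cmp_extend] ak)
  then have zw: "z' \<cdot> w = ident C (Dom C \<kappa>)"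
    by (intro is_pullback_eqI[OF k, of "z' \<cdot> w" "ident C (Dom C \<kappa>)"]) (simp_all add: w z'[THEN cmp_extend])
  have "iso C w" by (rule isoI[of w z']) (simp_all add: wz zw)
  then have "iso C h"
    by (intro protomodularD[of "Dom C a" "Dom C m" a s "Dom C a'" a' s' h ?v Z \<kappa> \<tau> \<kappa>' \<tau>' w])
      (simp_all add: is_point_def in_hom s s' h hs w k k')
  then obtain h' where [simp]: "h' \<in> Arr C" "Dom C h' = Dom C a'" "Cod C h' = Dom C a"
    and h': "h \<cdot> h' = ident C (Dom C a')"
    by (auto elim: isoE)
  have "m \<cdot> (b \<cdot> h') = b'"
    using cmp_extend[OF h(2), of h'] by (simp add: h')
  moreover have "regular_epi C b'" using pullback_regular_epi[OF pb' re] .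
  ultimately show ?thesis by (intro regular_epi_monic_iso[OF m, of "b \<cdot> h'"]) auto
qed

text \<open>The equalizer of \<open>u\<close> and \<open>v\<close> contains both the kernel and the
  section. Thus \<open>p\<close> restricted to it is still split, and the equalizer is the whole
  object.\<close>

lemma kernel_section_jointly_epic:
  assumes "is_kernel C k p" "s \<in> Arr C" "Cod C s = Dom C p" "p \<cdot> s = ident C (Cod C p)"
    and uv: "u \<in> Arr C" "v \<in> Arr C" "Dom C u = Dom C p" "Dom C v = Dom C p"
      "u \<cdot> k = v \<cdot> k" "u \<cdot> s = v \<cdot> s"
  shows "u = v"
proof -
  note [simp] = assms(2,3) uv(1-4)
  have [simp]: "k \<in> Arr C" "p \<in> Arr C" "Cod C k = Dom C p"
    using assms(1) by (auto elim!: is_kernelE)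
  have [simp]: "Dom C s = Cod C p" using arg_cong[OF assms(4), of "Dom C"] by simp
  have [simp]: "Cod C u = Cod C v" using arg_cong[OF uv(6), of "Cod C"] by simp
  obtain m where m: "monic C m" and [simp]: "Cod C m = Dom C p" and um: "u \<cdot> m = v \<cdot> m"
    and lift: "\<And>g. g \<in> Arr C \<Longrightarrow> Cod C g = Dom C u \<Longrightarrow> u \<cdot> g = v \<cdot> g \<Longrightarrow>
      \<exists>h. h \<in> Arr C \<and> Dom C h = Dom C g \<and> Cod C h = Dom C m \<and> m \<cdot> h = g"
    using equalizer_exists[of u v] by auto
  have [simp]: "m \<in> Arr C" using m by simp
  obtain k' where k': "k' \<in> Arr C" "Cod C k' = Dom C m" "m \<cdot> k' = k" using lift[of k] uv(5) by auto
  obtain s' where s': "s' \<in> Arr C" "Dom C s' = Cod C p" "Cod C s' = Dom C m" "m \<cdot> s' = s" using lift[of s] uv(6) by auto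
  have "regular_epi C (p \<cdot> m)"
    by (rule split_epi_regular_epi[of _ s']) (simp_all add: s' assms(4))
  then have "iso C m"
    by (intro monic_iso_if_contains_kernel[OF m, of p k k']) (simp_all add: k' assms(1))
  then show "u = v" by (intro regular_epi_eqI[OF iso_regular_epi um]) auto
qed

text \<open>Whichever pair \<open>g\<close> coequalizes factors through the kernel pair, so
  coequalizing the kernel pair is the stronger condition on \<open>u\<close>.\<close>

lemma regular_epi_kernel_pair_coequalizer:
  assumes "regular_epi C g" and pb: "is_pullback C g g a b"
  shows "is_coequalizer C g a b"
proof -
  obtain c d where co: "is_coequalizer C g c d" using assms(1) unfolding regular_epi_def by blast
  have [simp]: "c \<in> Arr C" "d \<in> Arr C" "g \<in> Arr C" "Dom C d = Dom C c" "Cod C c = Dom C g"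
    "Cod C d = Dom C g" and cd: "g \<cdot> c = g \<cdot> d"
    using co by (auto elim!: is_coequalizerE)
  have [simp]: "a \<in> Arr C" "b \<in> Arr C" "Cod C a = Dom C g" "Cod C b = Dom C g" "Dom C b = Dom C a"
    and ab: "g \<cdot> a = g \<cdot> b"
    using pb by (auto elim!: is_pullbackE)
  show ?thesis
  proof (rule is_coequalizerI)
    fix u assume [simp]: "u \<in> Arr C" "Dom C u = Dom C g" and u: "u \<cdot> a = u \<cdot> b"
    obtain x where [simp]: "x \<in> Arr C" "Dom C x = Dom C c" "Cod C x = Dom C a" and x: "a \<cdot> x = c" "b \<cdot> x = d"
      by atomize_elim (rule is_pullback_lift'[OF pb], simp_all add: cd)
    have uc: "u \<cdot> c = u \<cdot> d" using cmp_extend[OF u, of x] by (simp add: x)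
    show "\<exists>h. h \<in> Arr C \<and> Dom C h = Cod C g \<and> Cod C h = Cod C u \<and> h \<cdot> g = u"
      by (rule is_coequalizer_lift'[OF co]) (simp_all add: uc)
  next
    fix u v assume "u \<in> Arr C" "v \<in> Arr C" "Dom C u = Cod C g" "Dom C v = Cod C g" "u \<cdot> g = v \<cdot> g"
    then show "u = v" using is_coequalizer_eqI[OF co, of u v] by simp
  qed (simp_all add: ab)
qed

text \<open>It suffices that \<open>u\<close> coequalizes the kernel pair of \<open>g\<close>. The
  projection \<open>a\<close> is split by the diagonal \<open>s\<close>, so the equation can be
  tested on \<open>s\<close>, where it is trivial, and on the kernel of \<open>a\<close>. There
  \<open>b\<close> takes values in the kernel of \<open>g\<close>, which \<open>u\<close>
  kills.\<close>

lemma regular_epi_cokernel_of_kernel: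
  assumes re: "regular_epi C g" and kn: "is_kernel C n g"
    and [simp]: "u \<in> Arr C" "Dom C u = Dom C g" and un: "u \<cdot> n = zero_arr C (Dom C n) (Cod C u)"
  shows "\<exists>t. t \<in> Arr C \<and> Dom C t = Cod C g \<and> Cod C t = Cod C u \<and> t \<cdot> g = u"
proof -
  have [simp]: "n \<in> Arr C" "g \<in> Arr C" "Cod C n = Dom C g" and gn: "g \<cdot> n = zero_arr C (Dom C n) (Cod C g)"
    using kn by (auto elim!: is_kernelE)
  obtain a b where pb: "is_pullback C g g a b" using pullback_exists[of g g] by auto
  have [simp]: "a \<in> Arr C" "b \<in> Arr C" "Cod C a = Dom C g" "Cod C b = Dom C g" "Dom C b = Dom C a"
    and ab: "g \<cdot> a = g \<cdot> b"
    using pb by (auto elim!: is_pullbackE)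
  obtain s where [simp]: "s \<in> Arr C" "Dom C s = Dom C g" "Cod C s = Dom C a"
    and s: "a \<cdot> s = ident C (Dom C g)" "b \<cdot> s = ident C (Dom C g)"
    by atomize_elim (rule is_pullback_lift'[OF pb], simp_all)
  obtain \<kappa> where ka: "is_kernel C \<kappa> a" using kernel_exists[of a] by auto
  then have [simp]: "\<kappa> \<in> Arr C" "Cod C \<kappa> = Dom C a" and ak: "a \<cdot> \<kappa> = zero_arr C (Dom C \<kappa>) (Dom C g)"
    by (auto elim!: is_kernelE)
  have gbk: "g \<cdot> (b \<cdot> \<kappa>) = zero_arr C (Dom C \<kappa>) (Cod C g)" using cmp_extend[OF ab, of \<kappa>] ak by simp
  obtain y where [simp]: "y \<in> Arr C" "Dom C y = Dom C \<kappa>" "Cod C y = Dom C n" and y: "n \<cdot> y = b \<cdot> \<kappa>"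
    by atomize_elim (rule is_kernel_lift'[OF kn], simp_all add: gbk)
  have "u \<cdot> a = u \<cdot> b"
    by (rule kernel_section_jointly_epic[OF ka, of s])
      (simp_all add: s ak y[symmetric] un[THEN cmp_extend])
  then show ?thesis
    by (intro is_coequalizer_lift[OF regular_epi_kernel_pair_coequalizer[OF re pb]]) simp_all
qed

text \<open>
  In groups: lift \<open>x \<in> ker d'\<close> to \<open>y\<close> along \<open>\<alpha>\<close>; then \<open>d y \<in> ker \<beta>\<close>, and \<open>y\<close> divided by \<open>j (d y)\<close> is a
  lift of \<open>x\<close> in \<open>ker d\<close>. In general, the image of the comparison from the domain of \<open>\<alpha>\<close> to the
  pullback of \<open>d'\<close> and \<open>\<beta>\<close> contains the kernel of the projection to the codomain of \<open>\<alpha>\<close>.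
\<close>

lemma kernel_restriction_regular_epi:
  assumes re: "regular_epi C \<alpha>" and arr: "d \<in> Arr C" "d' \<in> Arr C" "\<beta> \<in> Arr C" "Dom C d = Dom C \<alpha>" "Dom C d' = Cod C \<alpha>"
      "Dom C \<beta> = Cod C d" "Cod C \<beta> = Cod C d'" "d' \<cdot> \<alpha> = \<beta> \<cdot> d"
    and k: "is_kernel C k d" and k': "is_kernel C k' d'" and n: "is_kernel C n \<beta>"
    and j: "j \<in> Arr C" "Cod C j = Dom C d" "d \<cdot> j = n" "\<alpha> \<cdot> j = zero_arr C (Dom C j) (Cod C \<alpha>)"
    and \<phi>: "\<phi> \<in> Arr C" "Cod C \<phi> = Dom C k'" "k' \<cdot> \<phi> = \<alpha> \<cdot> k"
  shows "regular_epi C \<phi>"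
proof -
  note [simp] = arr(1-7) j(1,2) \<phi>(1,2)
  have [simp]: "\<alpha> \<in> Arr C" using re by simp
  have [simp]: "k \<in> Arr C" "Cod C k = Dom C \<alpha>" and dk: "d \<cdot> k = zero_arr C (Dom C k) (Cod C d)"
    using k by (auto elim!: is_kernelE)
  have [simp]: "k' \<in> Arr C" "Cod C k' = Cod C \<alpha>" and dk': "d' \<cdot> k' = zero_arr C (Dom C k') (Cod C d')"
    using k' by (auto elim!: is_kernelE)
  have [simp]: "n \<in> Arr C" "Cod C n = Cod C d" and bn: "\<beta> \<cdot> n = zero_arr C (Dom C n) (Cod C d')"
    using n by (auto elim!: is_kernelE)
  have [simp]: "Dom C n = Dom C j" using arg_cong[OF j(3), of "Dom C"] by simp
  have [simp]: "Dom C \<phi> = Dom C k" using arg_cong[OF \<phi>(3), of "Dom C"] by simp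
  obtain p q where pb: "is_pullback C d' \<beta> p q" using pullback_exists[of d' \<beta>] by auto
  have [simp]: "p \<in> Arr C" "q \<in> Arr C" "Cod C p = Cod C \<alpha>" "Cod C q = Cod C d" "Dom C q = Dom C p"
    and pq: "d' \<cdot> p = \<beta> \<cdot> q"
    using pb by (auto elim!: is_pullbackE)
  obtain c where [simp]: "c \<in> Arr C" "Dom C c = Dom C \<alpha>" "Cod C c = Dom C p" and c: "p \<cdot> c = \<alpha>" "q \<cdot> c = d"
    by atomize_elim (rule is_pullback_lift'[OF pb], simp_all add: arr)
  obtain m e where m: "monic C m" and e: "regular_epi C e" and [simp]: "Dom C e = Dom C \<alpha>" "Cod C e = Dom C m"
    "Cod C m = Dom C p" and me: "m \<cdot> e = c"
    using image_factorization[of c] by auto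
  have [simp]: "m \<in> Arr C" "e \<in> Arr C" using m e by auto
  have rep: "regular_epi C (p \<cdot> m)"
    by (rule regular_epi_cancel[of _ e]) (simp_all add: me c re)
  obtain n1 where n1: "is_kernel C n1 p" using kernel_exists[of p] by auto
  have [simp]: "n1 \<in> Arr C" "Cod C n1 = Dom C p" and pn1: "p \<cdot> n1 = zero_arr C (Dom C n1) (Cod C \<alpha>)"
    using n1 by (auto elim!: is_kernelE)
  have bqn: "\<beta> \<cdot> (q \<cdot> n1) = zero_arr C (Dom C n1) (Cod C d')" using cmp_extend[OF pq, of n1] pn1 by simp
  obtain y where [simp]: "y \<in> Arr C" "Dom C y = Dom C n1" "Cod C y = Dom C j" and y: "n \<cdot> y = q \<cdot> n1"
    by atomize_elim (rule is_kernel_lift'[OF n], simp_all add: bqn)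
  \<comment> \<open>The kernel of \<open>p\<close> consists of the pairs with first entry zero and
    second entry in the kernel of \<open>\<beta>\<close>. Since \<open>\<alpha> \<cdot> j\<close> is
    zero and \<open>d \<cdot> j = n\<close>, \<open>j\<close> lifts these pairs along
    \<open>c\<close>.\<close>
  have "c \<cdot> (j \<cdot> y) = n1"
    by (rule is_pullback_eqI[OF pb])
      (simp_all add: c[THEN cmp_extend] j(3,4)[THEN cmp_extend] pn1 y)
  then have "iso C m"
    by (intro monic_iso_if_contains_kernel[OF m _ _ rep n1, of "e \<cdot> (j \<cdot> y)"]) (simp_all add: me[THEN cmp_extend])
  then have rec: "regular_epi C c"
    using regular_epi_cmp[OF e, of m] iso_regular_epi by (simp add: me)
  \<comment> \<open>\<open>l\<close> embeds the kernel of \<open>d'\<close> as the pairs with second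
    entry zero. The pullback of \<open>c\<close> along it is \<open>\<phi>\<close>, so regularity
    passes from \<open>c\<close> to \<open>\<phi>\<close>.\<close>
  obtain l where [simp]: "l \<in> Arr C" "Dom C l = Dom C k'" "Cod C l = Dom C p" and l: "p \<cdot> l = k'"
    "q \<cdot> l = zero_arr C (Dom C k') (Cod C d)"
    by atomize_elim (rule is_pullback_lift'[OF pb], simp_all add: dk')
  have "is_pullback C c l k \<phi>"
  proof (rule is_pullbackI)
    show "c \<cdot> k = l \<cdot> \<phi>"
      by (rule is_pullback_eqI[OF pb]) (simp_all add: c[THEN cmp_extend] l[THEN cmp_extend] dk \<phi>(3))
    fix u v assume [simp]: "u \<in> Arr C" "v \<in> Arr C" "Dom C u = Dom C v" "Cod C u = Dom C c" "Cod C v = Dom C l"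
      and uv: "c \<cdot> u = l \<cdot> v"
    have "q \<cdot> (c \<cdot> u) = q \<cdot> (l \<cdot> v)" "p \<cdot> (c \<cdot> u) = p \<cdot> (l \<cdot> v)" using uv by simp_all
    then have du: "d \<cdot> u = zero_arr C (Dom C v) (Cod C d)" and au: "\<alpha> \<cdot> u = k' \<cdot> v"
      by (simp_all add: c[THEN cmp_extend] l[THEN cmp_extend])
    obtain h where [simp]: "h \<in> Arr C" "Dom C h = Dom C v" "Cod C h = Dom C k" and h: "k \<cdot> h = u"
      by atomize_elim (rule is_kernel_lift'[OF k], simp_all add: du)
    have "\<phi> \<cdot> h = v"
      by (rule monicD[OF is_kernel_monic[OF k']]) (simp_all add: \<phi>(3)[THEN cmp_extend] h au)
    then show "\<exists>h. h \<in> Arr C \<and> Dom C h = Dom C v \<and> Cod C h = Dom C k \<and> k \<cdot> h = u \<and> \<phi> \<cdot> h = v"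
      using h by (intro exI[of _ h]) simp
  next
    fix u v assume "u \<in> Arr C" "v \<in> Arr C" "Cod C u = Dom C k" "Cod C v = Dom C k" "k \<cdot> u = k \<cdot> v"
    then show "u = v" using monicD[OF is_kernel_monic[OF k], of u v] by simp
  qed simp_all
  then show ?thesis using rec pullback_regular_epi by blast
qed

section \<open>Internal relations and the Mal'tsev property\<close>

lemma jointly_monicD:
  assumes "r \<in> Arr C" "s \<in> Arr C" "Dom C s = Dom C r" "Cod C s = Cod C r" "monic C (tuple C r s)"
    "r \<cdot> u = r \<cdot> v" "s \<cdot> u = s \<cdot> v" "u \<in> Arr C" "v \<in> Arr C" "Cod C u = Dom C r" "Cod C v = Dom C r"
  shows "u = v"
proof (rule monicD[OF assms(5)])
  show "tuple C r s \<cdot> u = tuple C r s \<cdot> v"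
    by (rule prod_eqI[of "Cod C r" "Cod C r"]) (simp_all add: assms(1-4,6-))
qed (simp_all add: assms(1-4,8-))

text \<open>
  The relation is difunctional: \<open>x R y\<close>, \<open>z R y\<close> and \<open>z R w\<close> imply \<open>x R w\<close>. Triples
  \<open>(x R y, z R y, z R w)\<close> form a split epimorphism over the pairs \<open>(z R y, z R w)\<close>, and \<open>x R w\<close>
  is evident on its section (\<open>x = z\<close>) and on its kernel (\<open>z = y = w = 0\<close>).
\<close>

lemma difunctional:
  assumes [simp]: "r \<in> Arr C" "s \<in> Arr C" "Dom C s = Dom C r" "Cod C s = Cod C r"
    and jm: "monic C (tuple C r s)"
    and [simp]: "h1 \<in> Arr C" "h2 \<in> Arr C" "h3 \<in> Arr C" "Cod C h1 = Dom C r" "Cod C h2 = Dom C r" "Cod C h3 = Dom C r"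
    and h12: "s \<cdot> h1 = s \<cdot> h2" and h23: "r \<cdot> h2 = r \<cdot> h3"
  shows "\<exists>h. h \<in> Arr C \<and> Dom C h = Dom C h1 \<and> Cod C h = Dom C r \<and> r \<cdot> h = r \<cdot> h1 \<and> s \<cdot> h = s \<cdot> h3"
proof -
  have [simp]: "Dom C h2 = Dom C h1" "Dom C h3 = Dom C h1"
    using arg_cong[OF h12, of "Dom C"] arg_cong[OF h23, of "Dom C"] by simp_all
  obtain a1 b1 where pb1: "is_pullback C s s a1 b1" using pullback_exists[of s s] by auto
  have [simp]: "a1 \<in> Arr C" "b1 \<in> Arr C" "Cod C a1 = Dom C r" "Cod C b1 = Dom C r" "Dom C b1 = Dom C a1"
    and ab1: "s \<cdot> a1 = s \<cdot> b1"
    using pb1 by (auto elim!: is_pullbackE)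
  obtain a2 b2 where pb2: "is_pullback C r r a2 b2" using pullback_exists[of r r] by auto
  have [simp]: "a2 \<in> Arr C" "b2 \<in> Arr C" "Cod C a2 = Dom C r" "Cod C b2 = Dom C r" "Dom C b2 = Dom C a2"
    and ab2: "r \<cdot> a2 = r \<cdot> b2"
    using pb2 by (auto elim!: is_pullbackE)
  obtain g1 g2 where pb: "is_pullback C b1 a2 g1 g2" using pullback_exists[of b1 a2] by auto
  have [simp]: "g1 \<in> Arr C" "g2 \<in> Arr C" "Cod C g1 = Dom C a1" "Cod C g2 = Dom C a2" "Dom C g2 = Dom C g1"
    and g12: "b1 \<cdot> g1 = a2 \<cdot> g2"
    using pb by (auto elim!: is_pullbackE)
  let ?Y = "Cod C r"
  \<comment> \<open>The entries of a triple are \<open>a1 \<cdot> g1\<close>, then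
    \<open>b1 \<cdot> g1 = a2 \<cdot> g2\<close>, then \<open>b2 \<cdot> g2\<close>. The pullback
    leg \<open>m\<close> cuts out the triples for which \<open>x R w\<close> holds, and
    \<open>\<rho>\<close> is the witness.\<close>
  let ?xw = "tuple C (r \<cdot> (a1 \<cdot> g1)) (s \<cdot> (b2 \<cdot> g2))" and ?rs = "tuple C r s"
  obtain m \<rho> where pbm: "is_pullback C ?xw ?rs m \<rho>" using pullback_exists[of ?xw ?rs] by auto
  have [simp]: "m \<in> Arr C" "\<rho> \<in> Arr C" "Cod C m = Dom C g1" "Cod C \<rho> = Dom C r" "Dom C \<rho> = Dom C m"
    and mr: "?xw \<cdot> m = ?rs \<cdot> \<rho>"
    using pbm by (auto elim!: is_pullbackE)
  have rm: "r \<cdot> \<rho> = r \<cdot> (a1 \<cdot> (g1 \<cdot> m))" "s \<cdot> \<rho> = s \<cdot> (b2 \<cdot> (g2 \<cdot> m))"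
    using arg_cong[OF mr, of "\<lambda>x. pr1 C ?Y ?Y \<cdot> x"] arg_cong[OF mr, of "\<lambda>x. pr2 C ?Y ?Y \<cdot> x"] by simp_all
  have lift: "\<exists>x'. x' \<in> Arr C \<and> Dom C x' = Dom C x \<and> Cod C x' = Dom C m \<and> m \<cdot> x' = x \<and> \<rho> \<cdot> x' = y"
    if [simp]: "x \<in> Arr C" "Cod C x = Dom C g1" "y \<in> Arr C" "Cod C y = Dom C r" "Dom C y = Dom C x"
      and "r \<cdot> y = r \<cdot> (a1 \<cdot> (g1 \<cdot> x))" "s \<cdot> y = s \<cdot> (b2 \<cdot> (g2 \<cdot> x))" for x y
  proof -
    have "?xw \<cdot> x = ?rs \<cdot> y" by (rule prod_eqI[of ?Y ?Y]) (simp_all add: that(6,7))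
    then show ?thesis by (intro is_pullback_lift'[OF pbm]) simp_all
  qed
  have m: "monic C m"
  proof (rule monicI)
    fix u v assume [simp]: "u \<in> Arr C" "v \<in> Arr C" "Cod C u = Dom C m" "Cod C v = Dom C m" and uv: "m \<cdot> u = m \<cdot> v"
    have "\<rho> \<cdot> u = \<rho> \<cdot> v" by (rule jointly_monicD[OF _ _ _ _ jm]) (simp_all add: rm[THEN cmp_extend] uv)
    with uv show "u = v" by (intro is_pullback_eqI[OF pbm uv]) simp_all
  qed simp
  obtain \<delta> where [simp]: "\<delta> \<in> Arr C" "Dom C \<delta> = Dom C r" "Cod C \<delta> = Dom C a1"
    and d: "a1 \<cdot> \<delta> = ident C (Dom C r)" "b1 \<cdot> \<delta> = ident C (Dom C r)"
    by atomize_elim (rule is_pullback_lift'[OF pb1], simp_all)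
  obtain e where [simp]: "e \<in> Arr C" "Dom C e = Dom C a2" "Cod C e = Dom C g1"
    and e: "g1 \<cdot> e = \<delta> \<cdot> a2" "g2 \<cdot> e = ident C (Dom C a2)"
    by atomize_elim (rule is_pullback_lift'[OF pb], simp_all add: d[THEN cmp_extend])
  \<comment> \<open>The section \<open>e\<close> repeats \<open>z R y\<close> as the first entry, so
    there \<open>x = z\<close> and the third entry \<open>b2\<close> witnesses
    \<open>x R w\<close>.\<close>
  obtain e' where [simp]: "e' \<in> Arr C" "Dom C e' = Dom C a2" "Cod C e' = Dom C m" and e': "m \<cdot> e' = e"
    using lift[of e b2] by (auto simp: e d[THEN cmp_extend] ab2)
  have re: "regular_epi C (g2 \<cdot> m)"
    by (rule split_epi_regular_epi[of _ e']) (simp_all add: e' e)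
  obtain \<kappa> where ker: "is_kernel C \<kappa> g2" using kernel_exists[of g2] by auto
  then have [simp]: "\<kappa> \<in> Arr C" "Cod C \<kappa> = Dom C g1" and gk: "g2 \<cdot> \<kappa> = zero_arr C (Dom C \<kappa>) (Dom C a2)"
    by (auto elim!: is_kernelE)
  \<comment> \<open>On the kernel of \<open>g2\<close> both \<open>y\<close> and \<open>w\<close>
    are zero, so the first entry, the witness of \<open>x R y\<close>, also witnesses
    \<open>x R w\<close>.\<close>
  have "s \<cdot> (a1 \<cdot> (g1 \<cdot> \<kappa>)) = zero_arr C (Dom C \<kappa>) (Cod C r)"
    by (simp add: ab1[THEN cmp_extend] g12[THEN cmp_extend] gk)
  then obtain \<kappa>' where \<kappa>': "\<kappa>' \<in> Arr C" "Cod C \<kappa>' = Dom C m" "m \<cdot> \<kappa>' = \<kappa>"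
    using lift[of \<kappa> "a1 \<cdot> (g1 \<cdot> \<kappa>)"] by (auto simp: gk)
  have "iso C m"
    by (rule monic_iso_if_contains_kernel[OF m _ _ re ker, of \<kappa>']) (simp_all add: \<kappa>')
  then obtain m' where [simp]: "m' \<in> Arr C" "Dom C m' = Dom C g1" "Cod C m' = Dom C m"
    and m': "m \<cdot> m' = ident C (Dom C g1)"
    by (auto elim: isoE)
  obtain t1 where [simp]: "t1 \<in> Arr C" "Dom C t1 = Dom C h1" "Cod C t1 = Dom C a1" and t1: "a1 \<cdot> t1 = h1" "b1 \<cdot> t1 = h2"
    by atomize_elim (rule is_pullback_lift'[OF pb1], simp_all add: h12)
  obtain t2 where [simp]: "t2 \<in> Arr C" "Dom C t2 = Dom C h1" "Cod C t2 = Dom C a2" and t2: "a2 \<cdot> t2 = h2" "b2 \<cdot> t2 = h3"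
    by atomize_elim (rule is_pullback_lift'[OF pb2], simp_all add: h23)
  obtain t where [simp]: "t \<in> Arr C" "Dom C t = Dom C h1" "Cod C t = Dom C g1" and t: "g1 \<cdot> t = t1" "g2 \<cdot> t = t2"
    by atomize_elim (rule is_pullback_lift'[OF pb], simp_all add: t1 t2)
  show ?thesis
    by (rule exI[of _ "\<rho> \<cdot> (m' \<cdot> t)"]) (simp add: rm[THEN cmp_extend] m'[THEN cmp_extend] t t1 t2)
qed

text \<open>Difunctionality with diagonal pairs inserted: \<open>b R b\<close>,
  \<open>a R b\<close>, \<open>a R a\<close> give \<open>b R a\<close>, and \<open>a R b\<close>,
  \<open>b R b\<close>, \<open>b R c\<close> give \<open>a R c\<close>.\<close>

lemma reflexive_internal_equiv:
  assumes [simp]: "r \<in> Arr C" "s \<in> Arr C" "Dom C s = Dom C r" "Cod C s = Cod C r"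
    and jm: "monic C (tuple C r s)"
    and [simp]: "e \<in> Arr C" "Dom C e = Cod C r" "Cod C e = Dom C r"
    and re: "r \<cdot> e = ident C (Cod C r)" and se: "s \<cdot> e = ident C (Cod C r)"
  shows "internal_equiv C r s"
proof -
  have "inj_on (\<lambda>h. (r \<cdot> h, s \<cdot> h)) (hom C T (Dom C r)) \<and>
      equiv (hom C T (Cod C r)) ((\<lambda>h. (r \<cdot> h, s \<cdot> h)) ` hom C T (Dom C r))" (is "?inj \<and> equiv ?A ?R") for T
  proof
    show ?inj by (rule inj_onI, rule jointly_monicD[OF _ _ _ _ jm]) (auto simp: in_hom)
    show "equiv ?A ?R"
    proof (rule equivI)
      show "?R \<subseteq> ?A \<times> ?A" by (auto simp: in_hom)
      show "refl_on ?A ?R"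
      proof (rule refl_onI)
        fix u assume "u \<in> ?A"
        then show "(u, u) \<in> ?R"
          by (intro image_eqI[of _ _ "e \<cdot> u"]) (auto simp: in_hom re[THEN cmp_extend] se[THEN cmp_extend])
      qed
      show "sym ?R"
      proof (rule symI)
        fix a b assume "(a, b) \<in> ?R"
        then obtain h where [simp]: "h \<in> Arr C" "Cod C h = Dom C r" and h: "Dom C h = T" "a = r \<cdot> h" "b = s \<cdot> h"
          by (auto simp: in_hom)
        have "\<exists>h'. h' \<in> Arr C \<and> Dom C h' = Dom C (e \<cdot> (s \<cdot> h)) \<and> Cod C h' = Dom C r \<and>
            r \<cdot> h' = r \<cdot> (e \<cdot> (s \<cdot> h)) \<and> s \<cdot> h' = s \<cdot> (e \<cdot> (r \<cdot> h))"
          by (rule difunctional[OF _ _ _ _ jm, of _ h]) (simp_all add: re[THEN cmp_extend] se[THEN cmp_extend])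
        then obtain h' where "h' \<in> Arr C" "Dom C h' = Dom C (e \<cdot> (s \<cdot> h))" "Cod C h' = Dom C r"
          "r \<cdot> h' = r \<cdot> (e \<cdot> (s \<cdot> h))" "s \<cdot> h' = s \<cdot> (e \<cdot> (r \<cdot> h))" by blast
        then show "(b, a) \<in> ?R"
          using h by (intro image_eqI[of _ _ h']) (simp_all add: in_hom re[THEN cmp_extend] se[THEN cmp_extend])
      qed
      show "trans ?R"
      proof (rule transI)
        fix a b c assume "(a, b) \<in> ?R" "(b, c) \<in> ?R"
        then obtain h h' where [simp]: "h \<in> Arr C" "Cod C h = Dom C r" "h' \<in> Arr C" "Cod C h' = Dom C r"
          and h: "Dom C h = T" "a = r \<cdot> h" "b = s \<cdot> h" "Dom C h' = T" "b = r \<cdot> h'" "c = s \<cdot> h'"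
          by (auto simp: in_hom)
        have "\<exists>g. g \<in> Arr C \<and> Dom C g = Dom C h \<and> Cod C g = Dom C r \<and> r \<cdot> g = r \<cdot> h \<and> s \<cdot> g = s \<cdot> h'"
          by (rule difunctional[OF _ _ _ _ jm, of _ "e \<cdot> (s \<cdot> h)"])
            (use h in \<open>simp_all add: re[THEN cmp_extend] se[THEN cmp_extend]\<close>)
        then obtain g where "g \<in> Arr C" "Dom C g = Dom C h" "Cod C g = Dom C r"
          "r \<cdot> g = r \<cdot> h" "s \<cdot> g = s \<cdot> h'" by blast
        then show "(a, c) \<in> ?R"
          using h by (intro image_eqI[of _ _ g]) (simp_all add: in_hom)
      qed
    qed
  qed
  then show ?thesis unfolding internal_equiv_def
    by (intro exI[of _ "Dom C r"] exI[of _ "Cod C r"]) (simp add: in_hom)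
qed

end

section \<open>Reflexive graphs in semi-abelian categories\<close>

sublocale semi_abelian \<subseteq> homological
  using pointed barr_exact protomodular by unfold_locales (auto simp: barr_exact_def)

context semi_abelian
begin

text \<open>The image \<open>(r, s)\<close> of the graph is a reflexive relation, hence an
  equivalence relation, hence by exactness the kernel pair of some \<open>w\<close>. As
  \<open>w\<close> coequalizes \<open>p\<close> and \<open>q\<close>, it factors through
  \<open>c\<close>; so \<open>c \<cdot> u = c \<cdot> v\<close> puts the pair \<open>(u, v)\<close>
  into the relation. Lifting from the image to the graph costs the cover \<open>t\<close>.\<close>

lemma reflexive_graph_covers_kernel_pair:
  assumes [simp]: "p \<in> Arr C" "q \<in> Arr C" "e \<in> Arr C" "Dom C q = Dom C p" "Cod C q = Cod C p"
      "Dom C e = Cod C p" "Cod C e = Dom C p"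
    and pe: "p \<cdot> e = ident C (Cod C p)" and qe: "q \<cdot> e = ident C (Cod C p)"
    and co: "is_coequalizer C c p q"
    and [simp]: "u \<in> Arr C" "v \<in> Arr C" "Cod C u = Cod C p" "Cod C v = Cod C p" and uv: "c \<cdot> u = c \<cdot> v"
  shows "\<exists>t x. regular_epi C t \<and> Cod C t = Dom C u \<and> x \<in> Arr C \<and> Dom C x = Dom C t \<and> Cod C x = Dom C p \<and>
    p \<cdot> x = u \<cdot> t \<and> q \<cdot> x = v \<cdot> t"
proof -
  let ?Y = "Cod C p"
  have [simp]: "c \<in> Arr C" "Dom C c = ?Y" and cpq: "c \<cdot> p = c \<cdot> q" using co by (auto elim!: is_coequalizerE)
  have [simp]: "Dom C v = Dom C u" using arg_cong[OF uv, of "Dom C"] by simp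
  obtain m \<epsilon> where m: "monic C m" and eps: "regular_epi C \<epsilon>" and [simp]: "Dom C \<epsilon> = Dom C p" "Cod C \<epsilon> = Dom C m"
    "Cod C m = prod_obj C ?Y ?Y" and me: "m \<cdot> \<epsilon> = tuple C p q"
    using image_factorization[of "tuple C p q"] by auto
  have [simp]: "m \<in> Arr C" "\<epsilon> \<in> Arr C" using m eps by auto
  define r s where "r = pr1 C ?Y ?Y \<cdot> m" and "s = pr2 C ?Y ?Y \<cdot> m"
  have [simp]: "r \<in> Arr C" "s \<in> Arr C" "Dom C r = Dom C m" "Dom C s = Dom C m" "Cod C r = ?Y" "Cod C s = ?Y"
    by (simp_all add: r_def s_def)
  have rs: "r \<cdot> \<epsilon> = p" "s \<cdot> \<epsilon> = q" by (simp_all add: r_def s_def me)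
  have "internal_equiv C r s"
  proof (rule reflexive_internal_equiv[of r s "\<epsilon> \<cdot> e"])
    have "tuple C r s = m" by (rule prod_eqI[of ?Y ?Y]) (simp_all add: r_def s_def)
    then show "monic C (tuple C r s)" using m by simp
  qed (simp_all add: rs[THEN cmp_extend] pe qe)
  then obtain w where "is_kernel_pair C w r s" using barr_exact unfolding barr_exact_def by blast
  then have pb: "is_pullback C w w r s" by (simp add: is_kernel_pair_def)
  have [simp]: "w \<in> Arr C" and "Cod C r = Dom C w" and wrs: "w \<cdot> r = w \<cdot> s"
    using pb by (auto elim!: is_pullbackE)
  then have [simp]: "Dom C w = ?Y" by simp
  have wpq: "w \<cdot> p = w \<cdot> q" using cmp_extend[OF wrs, of \<epsilon>] by (simp add: rs)
  obtain t where [simp]: "t \<in> Arr C" "Dom C t = Cod C c" "Cod C t = Cod C w" and t: "t \<cdot> c = w"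
    by atomize_elim (rule is_coequalizer_lift'[OF co], simp_all add: wpq)
  have "t \<cdot> (c \<cdot> u) = t \<cdot> (c \<cdot> v)" using uv by simp
  then have wuv: "w \<cdot> u = w \<cdot> v" by (simp add: t[THEN cmp_extend])
  obtain y where [simp]: "y \<in> Arr C" "Dom C y = Dom C u" "Cod C y = Dom C m" and y: "r \<cdot> y = u" "s \<cdot> y = v"
    by atomize_elim (rule is_pullback_lift'[OF pb], simp_all add: wuv)
  obtain t x where t: "regular_epi C t" "Cod C t = Dom C u" and x [simp]: "x \<in> Arr C" "Dom C x = Dom C t"
    "Cod C x = Dom C p" and ex: "\<epsilon> \<cdot> x = y \<cdot> t"
    using regular_epi_local_lift[OF eps, of y] by auto
  have [simp]: "t \<in> Arr C" "Cod C t = Dom C u" using t by simp_all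
  have "r \<cdot> (\<epsilon> \<cdot> x) = u \<cdot> t" "s \<cdot> (\<epsilon> \<cdot> x) = v \<cdot> t" unfolding ex by (simp_all add: y[THEN cmp_extend])
  then have "p \<cdot> x = u \<cdot> t" "q \<cdot> x = v \<cdot> t" by (simp_all add: rs[THEN cmp_extend])
  then show ?thesis using t x by blast
qed

text \<open>Cover the pair consisting of \<open>l\<close> and zero. A local preimage is killed by
  \<open>q\<close>, hence lies in the kernel \<open>k\<close>, and \<open>\<alpha>\<close> sends it
  to the cover.\<close>

lemma reflexive_graph_kernel_regular_epi:
  assumes [simp]: "p \<in> Arr C" "q \<in> Arr C" "e \<in> Arr C" "Dom C q = Dom C p" "Cod C q = Cod C p"
      "Dom C e = Cod C p" "Cod C e = Dom C p"
    and pe: "p \<cdot> e = ident C (Cod C p)" and qe: "q \<cdot> e = ident C (Cod C p)"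
    and co: "is_coequalizer C c p q" and k: "is_kernel C k q" and l: "is_kernel C l c"
    and [simp]: "\<alpha> \<in> Arr C" "Cod C \<alpha> = Dom C l" and la: "l \<cdot> \<alpha> = p \<cdot> k"
  shows "regular_epi C \<alpha>"
proof -
  have [simp]: "c \<in> Arr C" "Dom C c = Cod C p" using co by (auto elim!: is_coequalizerE)
  have [simp]: "k \<in> Arr C" "Cod C k = Dom C p" using k by (auto elim!: is_kernelE)
  have [simp]: "l \<in> Arr C" "Cod C l = Cod C p" and cl: "c \<cdot> l = zero_arr C (Dom C l) (Cod C c)"
    using l by (auto elim!: is_kernelE)
  have [simp]: "Dom C \<alpha> = Dom C k" using arg_cong[OF la, of "Dom C"] by simp
  obtain t x where t: "regular_epi C t" and [simp]: "Cod C t = Dom C l" "x \<in> Arr C" "Dom C x = Dom C t"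
    "Cod C x = Dom C p" and px: "p \<cdot> x = l \<cdot> t" and "q \<cdot> x = zero_arr C (Dom C l) (Cod C p) \<cdot> t"
    using reflexive_graph_covers_kernel_pair[OF _ _ _ _ _ _ _ pe qe co, of l "zero_arr C (Dom C l) (Cod C p)"]
    by (auto simp: cl)
  moreover have [simp]: "t \<in> Arr C" using t by simp
  ultimately have qx: "q \<cdot> x = zero_arr C (Dom C t) (Cod C p)" by simp
  obtain y where [simp]: "y \<in> Arr C" "Dom C y = Dom C t" "Cod C y = Dom C k" and y: "k \<cdot> y = x"
    by atomize_elim (rule is_kernel_lift'[OF k], simp_all add: qx)
  have ay: "\<alpha> \<cdot> y = t"
    by (rule monicD[OF is_kernel_monic[OF l]]) (simp_all add: la[THEN cmp_extend] y px)
  show ?thesis by (rule regular_epi_cancel[of _ y]) (simp_all add: ay t)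
qed

section \<open>Chosen kernels, factorisations through them, and cokernels as coequalizers\<close>

lemma is_kernel_ker: "f \<in> Arr C \<Longrightarrow> is_kernel C (ker C f) f"
  unfolding ker_def by (rule someI_ex) (rule kernel_exists)

lemma factor_through_eq:
  assumes "monic C m" "h \<in> Arr C" "Cod C h = Dom C m" "m \<cdot> h = g"
  shows "factor_through C m g = h"
  unfolding factor_through_def
proof (rule the_equality)
  show "h \<in> hom C (Dom C g) (Dom C m) \<and> m \<cdot> h = g" using assms by (auto simp: in_hom)
  fix h' assume "h' \<in> hom C (Dom C g) (Dom C m) \<and> m \<cdot> h' = g"
  then show "h' = h" using monicD[OF assms(1), of h' h] assms by (auto simp: in_hom)
qed

lemma factor_through_kernel:
  assumes "is_kernel C k f" "g \<in> Arr C" "Cod C g = Dom C f" "f \<cdot> g = zero_arr C (Dom C g) (Cod C f)"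
  shows "factor_through C k g \<in> Arr C" "Dom C (factor_through C k g) = Dom C g"
    "Cod C (factor_through C k g) = Dom C k" "k \<cdot> factor_through C k g = g"
proof -
  obtain h where "h \<in> Arr C" "Dom C h = Dom C g" "Cod C h = Dom C k" "k \<cdot> h = g"
    using is_kernel_lift[OF assms] by blast
  moreover from this have "factor_through C k g = h"
    by (intro factor_through_eq[OF is_kernel_monic[OF assms(1)]])
  ultimately show "factor_through C k g \<in> Arr C" "Dom C (factor_through C k g) = Dom C g"
    "Cod C (factor_through C k g) = Dom C k" "k \<cdot> factor_through C k g = g" by simp_all
qed

lemma is_cokernelE:
  assumes "is_cokernel C f k"
  obtains "k \<in> Arr C" "f \<in> Arr C" "Dom C f = Cod C k" "f \<cdot> k = zero_arr C (Dom C k) (Cod C f)"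
  using assms unfolding is_cokernel_def in_hom by auto

lemma is_cokernel_is_coequalizer:
  assumes "is_cokernel C f k"
  shows "is_coequalizer C f k (zero_arr C (Dom C k) (Cod C k))"
proof -
  obtain K X Y where hom: "k \<in> hom C K X" "f \<in> hom C X Y" "f \<cdot> k = zero_arr C K Y"
    and univ: "\<forall>T. \<forall>g\<in>hom C X T. g \<cdot> k = zero_arr C K T \<longrightarrow> (\<exists>!h. h \<in> hom C Y T \<and> h \<cdot> f = g)"
    using assms unfolding is_cokernel_def by blast
  have K: "K = Dom C k" "X = Cod C k" "Y = Cod C f" and [simp]: "k \<in> Arr C" "f \<in> Arr C" "Dom C f = Cod C k"
    using hom by (auto simp: in_hom)
  show ?thesis unfolding is_coequalizer_def
  proof (intro exI conjI allI ballI impI)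
    show "k \<in> hom C K X" "zero_arr C (Dom C k) (Cod C k) \<in> hom C K X" "f \<in> hom C X Y"
      "f \<cdot> k = f \<cdot> zero_arr C (Dom C k) (Cod C k)"
      using hom by (auto simp: in_hom K)
    fix T g assume g: "g \<in> hom C X T" "g \<cdot> k = g \<cdot> zero_arr C (Dom C k) (Cod C k)"
    moreover have "g \<cdot> zero_arr C (Dom C k) (Cod C k) = zero_arr C K T"
      using g(1) by (auto simp: in_hom K)
    ultimately show "\<exists>!h. h \<in> hom C Y T \<and> h \<cdot> f = g" using univ by auto
  qed
qed

end

section \<open>Coproducts and cosmash products\<close>

context semi_abelian
begin

lemma is_coproduct_coprod:
  assumes "X \<in> Obj C" "Y \<in> Obj C"
  shows "is_coproduct C X Y (inl C X Y) (inr C X Y)"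
proof -
  have "\<exists>ij. case ij of (i, j) \<Rightarrow> is_coproduct C X Y i j"
    using has_finite_coproducts assms unfolding has_finite_coproducts_def by auto
  from someI_ex[OF this] show ?thesis unfolding inl_def inr_def by (simp add: case_prod_unfold)
qed

lemma coprod_simps [simp]:
  assumes "X \<in> Obj C" "Y \<in> Obj C"
  shows "inl C X Y \<in> Arr C" "inr C X Y \<in> Arr C" "Dom C (inl C X Y) = X" "Dom C (inr C X Y) = Y"
    "Cod C (inl C X Y) = X \<amalg> Y" "Cod C (inr C X Y) = X \<amalg> Y" "X \<amalg> Y \<in> Obj C"
  using is_coproduct_coprod[OF assms] unfolding is_coproduct_def in_hom coprod_def by auto

lemma coproduct_Ex1:
  assumes "f \<in> Arr C" "g \<in> Arr C" "Cod C g = Cod C f"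
  shows "\<exists>!h. h \<in> hom C (Dom C f \<amalg> Dom C g) (Cod C f) \<and>
     h \<cdot> inl C (Dom C f) (Dom C g) = f \<and> h \<cdot> inr C (Dom C f) (Dom C g) = g"
proof -
  have "f \<in> hom C (Dom C f) (Cod C f)" "g \<in> hom C (Dom C g) (Cod C f)"
    using assms by (auto simp: in_hom)
  moreover have "Cod C (inl C (Dom C f) (Dom C g)) = Dom C f \<amalg> Dom C g"
    using assms by simp
  ultimately show ?thesis
    using is_coproduct_coprod[of "Dom C f" "Dom C g"] assms unfolding is_coproduct_def
    by (metis Dom_in_Obj in_hom)
qed

lemma copair_simps [simp]:
  assumes "f \<in> Arr C" "g \<in> Arr C" "Cod C g = Cod C f"
  shows "copair C f g \<in> Arr C" "Dom C (copair C f g) = Dom C f \<amalg> Dom C g"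
    "Cod C (copair C f g) = Cod C f"
    "Dom C f = X \<Longrightarrow> Dom C g = Y \<Longrightarrow> copair C f g \<cdot> inl C X Y = f"
    "Dom C f = X \<Longrightarrow> Dom C g = Y \<Longrightarrow> copair C f g \<cdot> inr C X Y = g"
proof -
  have "copair C f g \<in> hom C (Dom C f \<amalg> Dom C g) (Cod C f) \<and>
     copair C f g \<cdot> inl C (Dom C f) (Dom C g) = f \<and> copair C f g \<cdot> inr C (Dom C f) (Dom C g) = g"
    unfolding copair_def by (rule theI'[OF coproduct_Ex1[OF assms]])
  then show "copair C f g \<in> Arr C" "Dom C (copair C f g) = Dom C f \<amalg> Dom C g"
    "Cod C (copair C f g) = Cod C f"
    "Dom C f = X \<Longrightarrow> Dom C g = Y \<Longrightarrow> copair C f g \<cdot> inl C X Y = f"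
    "Dom C f = X \<Longrightarrow> Dom C g = Y \<Longrightarrow> copair C f g \<cdot> inr C X Y = g"
    by (auto simp: in_hom)
qed

lemma copair_cmp_simps [simp]:
  assumes "f \<in> Arr C" "g \<in> Arr C" "Cod C g = Cod C f" "Dom C f = X" "Dom C g = Y" "t \<in> Arr C"
  shows "Cod C t = X \<Longrightarrow> copair C f g \<cdot> (inl C X Y \<cdot> t) = f \<cdot> t"
    "Cod C t = Y \<Longrightarrow> copair C f g \<cdot> (inr C X Y \<cdot> t) = g \<cdot> t"
proof -
  have "X \<in> Obj C" "Y \<in> Obj C" using assms by auto
  then show "Cod C t = X \<Longrightarrow> copair C f g \<cdot> (inl C X Y \<cdot> t) = f \<cdot> t"
    "Cod C t = Y \<Longrightarrow> copair C f g \<cdot> (inr C X Y \<cdot> t) = g \<cdot> t"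
    using assms cmp_extend[of "copair C f g" "inl C X Y" f t] cmp_extend[of "copair C f g" "inr C X Y" g t] by auto
qed

lemma coprod_eqI:
  assumes "u \<cdot> inl C X Y = v \<cdot> inl C X Y" "u \<cdot> inr C X Y = v \<cdot> inr C X Y" "u \<in> Arr C" "v \<in> Arr C"
    "Dom C u = X \<amalg> Y" "Dom C v = X \<amalg> Y" "X \<in> Obj C" "Y \<in> Obj C"
  shows "u = v"
proof -
  have "Cod C v = Cod C u" using arg_cong[OF assms(1), of "Cod C"] assms(3-) by simp
  then have "u \<in> hom C (X \<amalg> Y) (Cod C u)" "v \<in> hom C (X \<amalg> Y) (Cod C u)"
    using assms by (auto simp: in_hom)
  moreover have "\<exists>!h. h \<in> hom C (X \<amalg> Y) (Cod C u) \<and>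
     h \<cdot> inl C X Y = u \<cdot> inl C X Y \<and> h \<cdot> inr C X Y = u \<cdot> inr C X Y"
    using coproduct_Ex1[of "u \<cdot> inl C X Y" "u \<cdot> inr C X Y"] assms(3-) by simp
  ultimately show ?thesis using assms(1,2) by metis
qed

lemma coprod_map_simps [simp]:
  assumes "f \<in> Arr C" "g \<in> Arr C"
  shows "coprod_map C f g \<in> Arr C" "Dom C (coprod_map C f g) = Dom C f \<amalg> Dom C g"
    "Cod C (coprod_map C f g) = Cod C f \<amalg> Cod C g"
    "Dom C f = X \<Longrightarrow> Dom C g = Y \<Longrightarrow> coprod_map C f g \<cdot> inl C X Y = inl C (Cod C f) (Cod C g) \<cdot> f"
    "Dom C f = X \<Longrightarrow> Dom C g = Y \<Longrightarrow> coprod_map C f g \<cdot> inr C X Y = inr C (Cod C f) (Cod C g) \<cdot> g"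
  using assms by (auto simp: coprod_map_def)

lemma coprod_map_cmp_simps [simp]:
  assumes "f \<in> Arr C" "g \<in> Arr C" "Dom C f = X" "Dom C g = Y" "t \<in> Arr C"
  shows "Cod C t = X \<Longrightarrow> coprod_map C f g \<cdot> (inl C X Y \<cdot> t) = inl C (Cod C f) (Cod C g) \<cdot> (f \<cdot> t)"
    "Cod C t = Y \<Longrightarrow> coprod_map C f g \<cdot> (inr C X Y \<cdot> t) = inr C (Cod C f) (Cod C g) \<cdot> (g \<cdot> t)"
  using assms by (auto simp: coprod_map_def)

lemma coprod_map_cmp:
  assumes [simp]: "f \<in> Arr C" "g \<in> Arr C" "f' \<in> Arr C" "g' \<in> Arr C" "Cod C f' = Dom C f" "Cod C g' = Dom C g"
  shows "coprod_map C f g \<cdot> coprod_map C f' g' = coprod_map C (f \<cdot> f') (g \<cdot> g')"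
  by (rule coprod_eqI[of _ "Dom C f'" "Dom C g'"]) simp_all

lemma coprod_map_ident:
  assumes [simp]: "X \<in> Obj C" "Y \<in> Obj C"
  shows "coprod_map C (ident C X) (ident C Y) = ident C (X \<amalg> Y)"
  by (rule coprod_eqI[of _ X Y]) simp_all

lemma codiagonal_simps [simp]:
  assumes "Y \<in> Obj C"
  shows "codiagonal C Y \<in> Arr C" "Dom C (codiagonal C Y) = Y \<amalg> Y" "Cod C (codiagonal C Y) = Y"
    "codiagonal C Y \<cdot> inl C Y Y = ident C Y" "codiagonal C Y \<cdot> inr C Y Y = ident C Y"
  using assms by (simp_all add: codiagonal_def)

section \<open>Retractions of a coproduct and the binary cosmash product\<close>

abbreviation retr1 :: "'a \<Rightarrow> 'a \<Rightarrow> 'b" where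
  "retr1 X Y \<equiv> copair C (ident C X) (zero_arr C Y X)"

abbreviation retr2 :: "'a \<Rightarrow> 'a \<Rightarrow> 'b" where
  "retr2 X Y \<equiv> copair C (zero_arr C X Y) (ident C Y)"

lemma retr_coprod_map:
  assumes [simp]: "f \<in> Arr C" "g \<in> Arr C"
  shows "retr1 (Cod C f) (Cod C g) \<cdot> coprod_map C f g = f \<cdot> retr1 (Dom C f) (Dom C g)"
    "retr2 (Cod C f) (Cod C g) \<cdot> coprod_map C f g = g \<cdot> retr2 (Dom C f) (Dom C g)"
  by (rule coprod_eqI[of _ "Dom C f" "Dom C g"]; simp)+

lemma retr_coprod_map_cmp [simp]:
  assumes "f \<in> Arr C" "g \<in> Arr C" "Cod C f = X" "Cod C g = Y" "t \<in> Arr C" "Cod C t = Dom C f \<amalg> Dom C g"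
  shows "retr1 X Y \<cdot> (coprod_map C f g \<cdot> t) = f \<cdot> (retr1 (Dom C f) (Dom C g) \<cdot> t)"
    "retr2 X Y \<cdot> (coprod_map C f g \<cdot> t) = g \<cdot> (retr2 (Dom C f) (Dom C g) \<cdot> t)"
proof -
  have "X \<in> Obj C" "Y \<in> Obj C" using assms by auto
  then show "retr1 X Y \<cdot> (coprod_map C f g \<cdot> t) = f \<cdot> (retr1 (Dom C f) (Dom C g) \<cdot> t)"
    "retr2 X Y \<cdot> (coprod_map C f g \<cdot> t) = g \<cdot> (retr2 (Dom C f) (Dom C g) \<cdot> t)"
    using cmp_extend[OF retr_coprod_map(1), of f g t] cmp_extend[OF retr_coprod_map(2), of f g t] assms by auto
qed

lemma cosmash_incl_is_kernel:
  assumes "X \<in> Obj C" "Y \<in> Obj C"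
  shows "is_kernel C (cosmash_incl C X Y) (tuple C (retr1 X Y) (retr2 X Y))"
  unfolding cosmash_incl_def using assms by (intro is_kernel_ker) simp

lemma cosmash_incl_monic:
  assumes "X \<in> Obj C" "Y \<in> Obj C"
  shows "monic C (cosmash_incl C X Y)"
  using cosmash_incl_is_kernel[OF assms] is_kernel_monic by blast

lemma cosmash_incl_simps [simp]:
  assumes [simp]: "X \<in> Obj C" "Y \<in> Obj C"
  shows "cosmash_incl C X Y \<in> Arr C" "Dom C (cosmash_incl C X Y) = X \<diamond>\<^bsub>C\<^esub> Y"
    "Cod C (cosmash_incl C X Y) = X \<amalg> Y" "X \<diamond>\<^bsub>C\<^esub> Y \<in> Obj C"
    "retr1 X Y \<cdot> cosmash_incl C X Y = zero_arr C (X \<diamond>\<^bsub>C\<^esub> Y) X"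
    "retr2 X Y \<cdot> cosmash_incl C X Y = zero_arr C (X \<diamond>\<^bsub>C\<^esub> Y) Y"
proof -
  have [simp]: "cosmash_incl C X Y \<in> Arr C" "Cod C (cosmash_incl C X Y) = X \<amalg> Y" and
    z: "tuple C (retr1 X Y) (retr2 X Y) \<cdot> cosmash_incl C X Y = zero_arr C (X \<diamond>\<^bsub>C\<^esub> Y) (prod_obj C X Y)"
    using cosmash_incl_is_kernel[OF assms] by (auto elim!: is_kernelE simp: cosmash_def)
  show [simp]: "cosmash_incl C X Y \<in> Arr C" "Dom C (cosmash_incl C X Y) = X \<diamond>\<^bsub>C\<^esub> Y"
    "Cod C (cosmash_incl C X Y) = X \<amalg> Y" by (simp_all add: cosmash_def)
  show [simp]: "X \<diamond>\<^bsub>C\<^esub> Y \<in> Obj C" unfolding cosmash_def by (rule Dom_in_Obj) simp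
  show "retr1 X Y \<cdot> cosmash_incl C X Y = zero_arr C (X \<diamond>\<^bsub>C\<^esub> Y) X"
    "retr2 X Y \<cdot> cosmash_incl C X Y = zero_arr C (X \<diamond>\<^bsub>C\<^esub> Y) Y"
    using arg_cong[OF z, of "\<lambda>x. pr1 C X Y \<cdot> x"] arg_cong[OF z, of "\<lambda>x. pr2 C X Y \<cdot> x"] by simp_all
qed

lemma cosmash_incl_cmp_simps [simp]:
  assumes "X \<in> Obj C" "Y \<in> Obj C" "t \<in> Arr C" "Cod C t = X \<diamond>\<^bsub>C\<^esub> Y"
  shows "retr1 X Y \<cdot> (cosmash_incl C X Y \<cdot> t) = zero_arr C (Dom C t) X"
    "retr2 X Y \<cdot> (cosmash_incl C X Y \<cdot> t) = zero_arr C (Dom C t) Y"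
  using assms cmp_extend[OF cosmash_incl_simps(5), of X Y t] cmp_extend[OF cosmash_incl_simps(6), of X Y t] by auto

lemma cosmash_eqI:
  assumes "cosmash_incl C X Y \<cdot> u = cosmash_incl C X Y \<cdot> v" "u \<in> Arr C" "v \<in> Arr C"
    "Cod C u = X \<diamond>\<^bsub>C\<^esub> Y" "Cod C v = X \<diamond>\<^bsub>C\<^esub> Y" "X \<in> Obj C" "Y \<in> Obj C"
  shows "u = v"
  by (rule monicD[OF cosmash_incl_monic[of X Y]]) (simp_all add: assms)

lemma cosmash_kernel:
  assumes "X \<in> Obj C" "Y \<in> Obj C" "g \<in> Arr C" "Cod C g = X \<amalg> Y"
    "retr1 X Y \<cdot> g = zero_arr C (Dom C g) X" "retr2 X Y \<cdot> g = zero_arr C (Dom C g) Y"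
  shows "tuple C (retr1 X Y) (retr2 X Y) \<cdot> g = zero_arr C (Dom C g) (prod_obj C X Y)"
  by (rule prod_eqI[of X Y]) (simp_all add: assms)

lemma cosmash_lift:
  assumes "X \<in> Obj C" "Y \<in> Obj C" "g \<in> Arr C" "Cod C g = X \<amalg> Y"
    "retr1 X Y \<cdot> g = zero_arr C (Dom C g) X" "retr2 X Y \<cdot> g = zero_arr C (Dom C g) Y" "Dom C g = D"
  shows "\<exists>h. h \<in> Arr C \<and> Dom C h = D \<and> Cod C h = X \<diamond>\<^bsub>C\<^esub> Y \<and> cosmash_incl C X Y \<cdot> h = g"
  by (rule is_kernel_lift'[OF cosmash_incl_is_kernel[OF assms(1,2)]])
    (use assms cosmash_kernel[OF assms(1-6)] in simp_all)

lemma cosmash_factor_through: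
  assumes "X \<in> Obj C" "Y \<in> Obj C" "g \<in> Arr C" "Cod C g = X \<amalg> Y"
    "retr1 X Y \<cdot> g = zero_arr C (Dom C g) X" "retr2 X Y \<cdot> g = zero_arr C (Dom C g) Y"
  shows "factor_through C (cosmash_incl C X Y) g \<in> Arr C"
    "Dom C (factor_through C (cosmash_incl C X Y) g) = Dom C g"
    "Cod C (factor_through C (cosmash_incl C X Y) g) = X \<diamond>\<^bsub>C\<^esub> Y"
    "cosmash_incl C X Y \<cdot> factor_through C (cosmash_incl C X Y) g = g"
  using factor_through_kernel[OF cosmash_incl_is_kernel[OF assms(1,2)], of g] assms
    cosmash_kernel[OF assms] by simp_all

lemma cosmash_map_simps [simp]:
  assumes [simp]: "f \<in> Arr C" "g \<in> Arr C"
  shows "cosmash_map C f g \<in> Arr C" "Dom C (cosmash_map C f g) = Dom C f \<diamond>\<^bsub>C\<^esub> Dom C g"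
    "Cod C (cosmash_map C f g) = Cod C f \<diamond>\<^bsub>C\<^esub> Cod C g"
    "Cod C f = X \<Longrightarrow> Cod C g = Y \<Longrightarrow>
      cosmash_incl C X Y \<cdot> cosmash_map C f g = coprod_map C f g \<cdot> cosmash_incl C (Dom C f) (Dom C g)"
  using cosmash_factor_through[of "Cod C f" "Cod C g" "coprod_map C f g \<cdot> cosmash_incl C (Dom C f) (Dom C g)"]
  unfolding cosmash_map_def by auto

lemma cosmash_map_cmp_simps [simp]:
  assumes "f \<in> Arr C" "g \<in> Arr C" "Cod C f = X" "Cod C g = Y" "t \<in> Arr C" "Cod C t = Dom C f \<diamond>\<^bsub>C\<^esub> Dom C g"
  shows "cosmash_incl C X Y \<cdot> (cosmash_map C f g \<cdot> t) =
    coprod_map C f g \<cdot> (cosmash_incl C (Dom C f) (Dom C g) \<cdot> t)"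
proof -
  have "X \<in> Obj C" "Y \<in> Obj C" using assms by auto
  then show ?thesis using assms cmp_extend[OF cosmash_map_simps(4)[OF assms(1-4)], of t] by simp
qed

text \<open>Kernel restriction for the comparisons from coproducts to products, with
  \<open>\<beta>\<close> in the role of \<open>1 \<times> f\<close>. An element of its kernel has
  first entry zero and second entry killed by \<open>f\<close>. Its second entry, included by
  \<open>inr\<close>, is the correction term: it lifts the element to \<open>X \<amalg> B\<close>
  and is killed by \<open>1 + f\<close>.\<close>

lemma cosmash_map_regular_epi:
  assumes re: "regular_epi C (coprod_map C (ident C X) f)" and [simp]: "X \<in> Obj C" "f \<in> Arr C"
  shows "regular_epi C (cosmash_map C (ident C X) f)"
proof -
  let ?B = "Dom C f" and ?A = "Cod C f"
  define \<beta> where "\<beta> = tuple C (pr1 C X ?B) (f \<cdot> pr2 C X ?B)"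
  have [simp]: "\<beta> \<in> Arr C" "Dom C \<beta> = prod_obj C X ?B" "Cod C \<beta> = prod_obj C X ?A"
    and b: "pr1 C X ?A \<cdot> \<beta> = pr1 C X ?B" "pr2 C X ?A \<cdot> \<beta> = f \<cdot> pr2 C X ?B"
    by (simp_all add: \<beta>_def)
  obtain n where n: "is_kernel C n \<beta>" using kernel_exists[of \<beta>] by auto
  have [simp]: "n \<in> Arr C" "Cod C n = prod_obj C X ?B" and bn: "\<beta> \<cdot> n = zero_arr C (Dom C n) (prod_obj C X ?A)"
    using n by (auto elim!: is_kernelE)
  have pn: "pr1 C X ?B \<cdot> n = zero_arr C (Dom C n) X" "f \<cdot> (pr2 C X ?B \<cdot> n) = zero_arr C (Dom C n) ?A"
    using arg_cong[OF bn, of "\<lambda>x. pr1 C X ?A \<cdot> x"] arg_cong[OF bn, of "\<lambda>x. pr2 C X ?A \<cdot> x"]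
    by (simp_all add: b[THEN cmp_extend])
  show ?thesis
  proof (rule kernel_restriction_regular_epi[OF re])
    show "is_kernel C (cosmash_incl C X ?B) (tuple C (retr1 X ?B) (retr2 X ?B))"
      "is_kernel C (cosmash_incl C X ?A) (tuple C (retr1 X ?A) (retr2 X ?A))"
      by (simp_all add: cosmash_incl_is_kernel)
    show "is_kernel C n \<beta>" by (rule n)
    show "tuple C (retr1 X ?A) (retr2 X ?A) \<cdot> coprod_map C (ident C X) f = \<beta> \<cdot> tuple C (retr1 X ?B) (retr2 X ?B)"
      by (rule prod_eqI[of X ?A])
        (simp_all add: b[THEN cmp_extend] retr_coprod_map[of "ident C X" f, simplified])
    show "tuple C (retr1 X ?B) (retr2 X ?B) \<cdot> (inr C X ?B \<cdot> (pr2 C X ?B \<cdot> n)) = n"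
      by (rule prod_eqI[of X ?B]) (simp_all add: pn)
  qed (simp_all add: pn)
qed

text \<open>
  The kernel of \<open>1 + c\<^sub>0\<close> covers the kernel of \<open>1 + f\<close>; as \<open>X \<diamond> S\<close> and \<open>X \<diamond> B\<close> are cut out
  there by the retractions onto \<open>S\<close> and \<open>B\<close> alone, kernel restriction applies again.
\<close>

lemma cosmash_reflexive_graph_kernel_regular_epi:
  assumes [simp]: "X \<in> Obj C" "c0 \<in> Arr C" "c1 \<in> Arr C" "s \<in> Arr C" "Dom C c1 = Dom C c0" "Cod C c1 = Cod C c0"
      "Dom C s = Cod C c0" "Cod C s = Dom C c0"
    and cs: "c0 \<cdot> s = ident C (Cod C c0)" "c1 \<cdot> s = ident C (Cod C c0)"
    and f [simp]: "f \<in> Arr C" "Dom C f = Cod C c0" "f \<cdot> c1 = f \<cdot> c0"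
    and co: "is_coequalizer C (coprod_map C (ident C X) f) (coprod_map C (ident C X) c1) (coprod_map C (ident C X) c0)"
    and nu: "is_kernel C \<nu> (cosmash_map C (ident C X) c0)" and l1: "is_kernel C l1 (cosmash_map C (ident C X) f)"
  shows "\<exists>\<phi>. regular_epi C \<phi> \<and> Dom C \<phi> = Dom C \<nu> \<and> Cod C \<phi> = Dom C l1 \<and>
    l1 \<cdot> \<phi> = cosmash_map C (ident C X) c1 \<cdot> \<nu>"
proof -
  let ?S = "Dom C c0" and ?B = "Cod C c0" and ?A = "Cod C f"
  let ?p = "coprod_map C (ident C X) c1" and ?q = "coprod_map C (ident C X) c0" and ?F = "coprod_map C (ident C X) f"
  let ?iS = "cosmash_incl C X ?S" and ?iB = "cosmash_incl C X ?B" and ?iA = "cosmash_incl C X ?A"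
  have [simp]: "\<nu> \<in> Arr C" "Cod C \<nu> = X \<diamond>\<^bsub>C\<^esub> ?S"
    and qnu: "cosmash_map C (ident C X) c0 \<cdot> \<nu> = zero_arr C (Dom C \<nu>) (X \<diamond>\<^bsub>C\<^esub> ?B)"
    using nu by (auto elim!: is_kernelE)
  have [simp]: "l1 \<in> Arr C" "Cod C l1 = X \<diamond>\<^bsub>C\<^esub> ?B"
    and fl1: "cosmash_map C (ident C X) f \<cdot> l1 = zero_arr C (Dom C l1) (X \<diamond>\<^bsub>C\<^esub> ?A)"
    using l1 by (auto elim!: is_kernelE)
  have qinu: "?q \<cdot> (?iS \<cdot> \<nu>) = zero_arr C (Dom C \<nu>) (X \<amalg> ?B)"
    using arg_cong[OF qnu, of "\<lambda>x. ?iB \<cdot> x"] by simp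
  have Fil: "?F \<cdot> (?iB \<cdot> l1) = zero_arr C (Dom C l1) (X \<amalg> ?A)"
    using arg_cong[OF fl1, of "\<lambda>x. ?iA \<cdot> x"] by simp
  have Fpq: "?F \<cdot> ?p = ?F \<cdot> ?q" using co by (auto elim!: is_coequalizerE)

  obtain \<kappa> where ka: "is_kernel C \<kappa> ?q" using kernel_exists[of ?q] by auto
  have [simp]: "\<kappa> \<in> Arr C" "Cod C \<kappa> = X \<amalg> ?S" and qk: "?q \<cdot> \<kappa> = zero_arr C (Dom C \<kappa>) (X \<amalg> ?B)"
    using ka by (auto elim!: is_kernelE)
  obtain l where l: "is_kernel C l ?F" using kernel_exists[of ?F] by auto
  have [simp]: "l \<in> Arr C" "Cod C l = X \<amalg> ?B" and Fl: "?F \<cdot> l = zero_arr C (Dom C l) (X \<amalg> ?A)"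
    using l by (auto elim!: is_kernelE)
  have "?F \<cdot> (?p \<cdot> \<kappa>) = zero_arr C (Dom C \<kappa>) (X \<amalg> ?A)"
    by (simp add: Fpq[THEN cmp_extend] qk)
  then obtain \<alpha> where [simp]: "\<alpha> \<in> Arr C" "Dom C \<alpha> = Dom C \<kappa>" "Cod C \<alpha> = Dom C l" and la: "l \<cdot> \<alpha> = ?p \<cdot> \<kappa>"
    using is_kernel_lift[OF l, of "?p \<cdot> \<kappa>"] by auto
  have re: "regular_epi C \<alpha>"
    by (rule reflexive_graph_kernel_regular_epi[OF _ _ _ _ _ _ _ _ _ co ka l, of "coprod_map C (ident C X) s"])
      (simp_all add: coprod_map_cmp cs coprod_map_ident la)

  obtain nD where nD: "is_kernel C nD c0" using kernel_exists[of c0] by auto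
  have [simp]: "nD \<in> Arr C" "Cod C nD = ?S" and cnD: "c0 \<cdot> nD = zero_arr C (Dom C nD) ?B"
    using nD by (auto elim!: is_kernelE)
  have "retr2 X ?B \<cdot> (?q \<cdot> \<kappa>) = zero_arr C (Dom C \<kappa>) ?B" unfolding qk by simp
  then have "c0 \<cdot> (retr2 X ?S \<cdot> \<kappa>) = zero_arr C (Dom C \<kappa>) ?B" by simp
  then obtain d where [simp]: "d \<in> Arr C" "Dom C d = Dom C \<kappa>" "Cod C d = Dom C nD" and d: "nD \<cdot> d = retr2 X ?S \<cdot> \<kappa>"
    using is_kernel_lift[OF nD, of "retr2 X ?S \<cdot> \<kappa>"] by auto
  \<comment> \<open>The second components of \<open>\<kappa>\<close> and \<open>l\<close> are
    compared by \<open>c1\<close>, restricted to the kernel of \<open>c0\<close>. The restriction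
    matters: with \<open>d\<close> taken into the whole of \<open>K \<amalg> B\<close>, an element
    killed by \<open>c1\<close> need not be killed by \<open>c0\<close>, and its inclusion
    \<open>j\<close> would not land in the kernel of \<open>1 + c0\<close>. Here
    \<open>K \<amalg> B\<close> stands for the domain of \<open>c0\<close>.\<close>
  define \<beta> where "\<beta> = c1 \<cdot> nD"
  have [simp]: "\<beta> \<in> Arr C" "Dom C \<beta> = Dom C nD" "Cod C \<beta> = ?B" by (simp_all add: \<beta>_def)
  obtain n where n: "is_kernel C n \<beta>" using kernel_exists[of \<beta>] by auto
  have [simp]: "n \<in> Arr C" "Cod C n = Dom C nD" and bn: "c1 \<cdot> (nD \<cdot> n) = zero_arr C (Dom C n) ?B"
    using n by (auto elim!: is_kernelE simp: \<beta>_def)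
  \<comment> \<open>The correction term: an element killed by both \<open>c0\<close> and
    \<open>c1\<close>, placed in the second summand. The first property puts it into the kernel of
    \<open>?q\<close>, the second makes \<open>\<alpha>\<close> kill it.\<close>
  obtain j where [simp]: "j \<in> Arr C" "Dom C j = Dom C n" "Cod C j = Dom C \<kappa>" and j: "\<kappa> \<cdot> j = inr C X ?S \<cdot> (nD \<cdot> n)"
    by atomize_elim (rule is_kernel_lift'[OF ka], simp_all add: cnD[THEN cmp_extend])

  obtain v where [simp]: "v \<in> Arr C" "Dom C v = Dom C \<nu>" "Cod C v = Dom C \<kappa>" and v: "\<kappa> \<cdot> v = ?iS \<cdot> \<nu>"
    by atomize_elim (rule is_kernel_lift'[OF ka], simp_all add: qinu)
  obtain v' where [simp]: "v' \<in> Arr C" "Dom C v' = Dom C l1" "Cod C v' = Dom C l" and v': "l \<cdot> v' = ?iB \<cdot> l1"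
    by atomize_elim (rule is_kernel_lift'[OF l], simp_all add: Fil)
  have kv: "is_kernel C v d"
  proof (rule is_kernelI)
    show "monic C v"
    proof (rule monicI)
      fix g h assume [simp]: "g \<in> Arr C" "h \<in> Arr C" "Cod C g = Dom C v" "Cod C h = Dom C v" and "v \<cdot> g = v \<cdot> h"
      then have "\<kappa> \<cdot> (v \<cdot> g) = \<kappa> \<cdot> (v \<cdot> h)" by simp
      then have "\<nu> \<cdot> g = \<nu> \<cdot> h" by (intro cosmash_eqI[of X ?S "\<nu> \<cdot> g" "\<nu> \<cdot> h"]) (simp_all add: v[THEN cmp_extend])
      then show "g = h" by (rule monicD[OF is_kernel_monic[OF nu]]) simp_all
    qed simp
    show "d \<cdot> v = zero_arr C (Dom C v) (Cod C d)"
      by (rule monicD[OF is_kernel_monic[OF nD]]) (simp_all add: d[THEN cmp_extend] v)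
    fix g assume [simp]: "g \<in> Arr C" "Cod C g = Dom C d" and dg: "d \<cdot> g = zero_arr C (Dom C g) (Cod C d)"
    have r2: "retr2 X ?S \<cdot> (\<kappa> \<cdot> g) = zero_arr C (Dom C g) ?S"
      using cmp_extend[OF d, of g] by (simp add: dg)
    \<comment> \<open>The same composite is evaluated twice. Without naturality of the retraction it
      vanishes, as \<open>?q \<cdot> \<kappa>\<close> is zero. With naturality it is the
      \<open>X\<close>-component of \<open>\<kappa> \<cdot> g\<close>, because \<open>?q\<close> is
      the identity on \<open>X\<close>. So on the kernel of \<open>?q\<close> only the second
      retraction remains a condition.\<close>
    have "retr1 X ?B \<cdot> (?q \<cdot> (\<kappa> \<cdot> g)) = zero_arr C (Dom C g) X" by (simp add: qk[THEN cmp_extend] del: retr_coprod_map_cmp)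
    then have r1: "retr1 X ?S \<cdot> (\<kappa> \<cdot> g) = zero_arr C (Dom C g) X" by simp
    obtain x where [simp]: "x \<in> Arr C" "Dom C x = Dom C g" "Cod C x = X \<diamond>\<^bsub>C\<^esub> ?S" and x: "?iS \<cdot> x = \<kappa> \<cdot> g"
      by atomize_elim (rule cosmash_lift, simp_all add: r1 r2)
    have qx: "cosmash_map C (ident C X) c0 \<cdot> x = zero_arr C (Dom C g) (X \<diamond>\<^bsub>C\<^esub> ?B)"
      by (rule cosmash_eqI[of X ?B]) (simp_all add: x qk[THEN cmp_extend])
    obtain y where [simp]: "y \<in> Arr C" "Dom C y = Dom C g" "Cod C y = Dom C \<nu>" and y: "\<nu> \<cdot> y = x"
      by atomize_elim (rule is_kernel_lift'[OF nu], simp_all add: qx)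
    have "v \<cdot> y = g"
      by (rule monicD[OF is_kernel_monic[OF ka]]) (simp_all add: v[THEN cmp_extend] y x)
    then show "\<exists>h. h \<in> Arr C \<and> Dom C h = Dom C g \<and> Cod C h = Dom C v \<and> v \<cdot> h = g"
      by (intro exI[of _ y]) simp
  qed simp_all
  have kv': "is_kernel C v' (retr2 X ?B \<cdot> l)"
  proof (rule is_kernelI)
    show "monic C v'"
    proof (rule monicI)
      fix g h assume [simp]: "g \<in> Arr C" "h \<in> Arr C" "Cod C g = Dom C v'" "Cod C h = Dom C v'" and "v' \<cdot> g = v' \<cdot> h"
      then have "l \<cdot> (v' \<cdot> g) = l \<cdot> (v' \<cdot> h)" by simp
      then have "l1 \<cdot> g = l1 \<cdot> h" by (intro cosmash_eqI[of X ?B "l1 \<cdot> g" "l1 \<cdot> h"]) (simp_all add: v'[THEN cmp_extend])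
      then show "g = h" by (rule monicD[OF is_kernel_monic[OF l1]]) simp_all
    qed simp
    show "(retr2 X ?B \<cdot> l) \<cdot> v' = zero_arr C (Dom C v') (Cod C (retr2 X ?B \<cdot> l))"
      by (simp add: v')
    fix g assume [simp]: "g \<in> Arr C" and "Cod C g = Dom C (retr2 X ?B \<cdot> l)"
      and dg: "(retr2 X ?B \<cdot> l) \<cdot> g = zero_arr C (Dom C g) (Cod C (retr2 X ?B \<cdot> l))"
    then have [simp]: "Cod C g = Dom C l" by simp
    have r2: "retr2 X ?B \<cdot> (l \<cdot> g) = zero_arr C (Dom C g) ?B" using dg by simp
    have "retr1 X ?A \<cdot> (?F \<cdot> (l \<cdot> g)) = zero_arr C (Dom C g) X" by (simp add: Fl[THEN cmp_extend] del: retr_coprod_map_cmp)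
    then have r1: "retr1 X ?B \<cdot> (l \<cdot> g) = zero_arr C (Dom C g) X" by simp
    obtain x where [simp]: "x \<in> Arr C" "Dom C x = Dom C g" "Cod C x = X \<diamond>\<^bsub>C\<^esub> ?B" and x: "?iB \<cdot> x = l \<cdot> g"
      by atomize_elim (rule cosmash_lift, simp_all add: r1 r2)
    have fx: "cosmash_map C (ident C X) f \<cdot> x = zero_arr C (Dom C g) (X \<diamond>\<^bsub>C\<^esub> ?A)"
      by (rule cosmash_eqI[of X ?A]) (simp_all add: x Fl[THEN cmp_extend])
    obtain y where [simp]: "y \<in> Arr C" "Dom C y = Dom C g" "Cod C y = Dom C l1" and y: "l1 \<cdot> y = x"
      by atomize_elim (rule is_kernel_lift'[OF l1], simp_all add: fx)
    have "v' \<cdot> y = g"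
      by (rule monicD[OF is_kernel_monic[OF l]]) (simp_all add: v'[THEN cmp_extend] y x)
    then show "\<exists>h. h \<in> Arr C \<and> Dom C h = Dom C g \<and> Cod C h = Dom C v' \<and> v' \<cdot> h = g"
      by (intro exI[of _ y]) simp
  qed simp_all
  have fh: "cosmash_map C (ident C X) f \<cdot> (cosmash_map C (ident C X) c1 \<cdot> \<nu>) = zero_arr C (Dom C \<nu>) (X \<diamond>\<^bsub>C\<^esub> ?A)"
    by (rule cosmash_eqI[of X ?A]) (simp_all add: Fpq[THEN cmp_extend] qinu)
  obtain \<phi> where [simp]: "\<phi> \<in> Arr C" "Dom C \<phi> = Dom C \<nu>" "Cod C \<phi> = Dom C l1"
    and phi: "l1 \<cdot> \<phi> = cosmash_map C (ident C X) c1 \<cdot> \<nu>"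
    by atomize_elim (rule is_kernel_lift'[OF l1], simp_all add: fh)
  have "regular_epi C \<phi>"
  proof (rule kernel_restriction_regular_epi[OF re _ _ _ _ _ _ _ _ kv kv' n])
    show "(retr2 X ?B \<cdot> l) \<cdot> \<alpha> = \<beta> \<cdot> d" by (simp add: la \<beta>_def d)
    show "d \<cdot> j = n" by (rule monicD[OF is_kernel_monic[OF nD]]) (simp_all add: d[THEN cmp_extend] j)
    show "\<alpha> \<cdot> j = zero_arr C (Dom C j) (Cod C \<alpha>)"
      by (rule monicD[OF is_kernel_monic[OF l]]) (simp_all add: la[THEN cmp_extend] j bn)
    show "v' \<cdot> \<phi> = \<alpha> \<cdot> v"
      by (rule monicD[OF is_kernel_monic[OF l]]) (simp_all add: la[THEN cmp_extend] v'[THEN cmp_extend] v phi)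
  qed simp_all
  then show ?thesis using phi by (intro exI[of _ \<phi>]) simp
qed

section \<open>Right exactness of the cosmash product\<close>

text \<open>The two parallel morphisms agree on the summands \<open>X\<close> and \<open>B\<close>,
  while on \<open>K\<close> they give \<open>k\<close> and zero. So \<open>u\<close> coequalizes
  them exactly if its restriction to \<open>B\<close> kills \<open>k\<close>, that is, factors
  through \<open>f\<close>.\<close>

lemma coprod_map_cokernel_coequalizer:
  assumes co: "is_cokernel C f k" and [simp]: "X \<in> Obj C"
  shows "is_coequalizer C (coprod_map C (ident C X) f)
    (coprod_map C (ident C X) (copair C k (ident C (Cod C k))))
    (coprod_map C (ident C X) (copair C (zero_arr C (Dom C k) (Cod C k)) (ident C (Cod C k))))"
    (is "is_coequalizer C ?F ?p ?q")
proof -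
  let ?K = "Dom C k" and ?B = "Cod C k"
  have [simp]: "k \<in> Arr C" "f \<in> Arr C" "Dom C f = ?B" and fk: "f \<cdot> k = zero_arr C ?K (Cod C f)"
    using co by (auto elim!: is_cokernelE)
  note ce = is_cokernel_is_coequalizer[OF co]
  show ?thesis
  proof (rule is_coequalizerI)
    have "f \<cdot> copair C k (ident C ?B) = f \<cdot> copair C (zero_arr C ?K ?B) (ident C ?B)"
      by (rule coprod_eqI[of _ ?K ?B]) (simp_all add: fk)
    then show "?F \<cdot> ?p = ?F \<cdot> ?q" by (simp add: coprod_map_cmp)
  next
    fix u assume [simp]: "u \<in> Arr C" "Dom C u = Dom C ?F" and u: "u \<cdot> ?p = u \<cdot> ?q"
    let ?i = "inr C X (?K \<amalg> ?B) \<cdot> inl C ?K ?B"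
    have "(u \<cdot> ?p) \<cdot> ?i = (u \<cdot> ?q) \<cdot> ?i" unfolding u ..
    then have uk: "u \<cdot> (inr C X ?B \<cdot> k) = zero_arr C ?K (Cod C u)" by simp
    obtain t where [simp]: "t \<in> Arr C" "Dom C t = Cod C f" "Cod C t = Cod C u" and t: "t \<cdot> f = u \<cdot> inr C X ?B"
      by atomize_elim (rule is_coequalizer_lift'[OF ce], simp_all add: uk)
    have "copair C (u \<cdot> inl C X ?B) t \<cdot> ?F = u"
      by (rule coprod_eqI[of _ X ?B]) (simp_all add: t)
    then show "\<exists>h. h \<in> Arr C \<and> Dom C h = Cod C ?F \<and> Cod C h = Cod C u \<and> h \<cdot> ?F = u"
      by (intro exI[of _ "copair C (u \<cdot> inl C X ?B) t"]) simp
  next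
    fix u v assume [simp]: "u \<in> Arr C" "v \<in> Arr C" "Dom C u = Cod C ?F" "Dom C v = Cod C ?F" "Cod C u = Cod C v"
      and uv: "u \<cdot> ?F = v \<cdot> ?F"
    have *: "(u \<cdot> ?F) \<cdot> inl C X ?B = (v \<cdot> ?F) \<cdot> inl C X ?B" "(u \<cdot> ?F) \<cdot> inr C X ?B = (v \<cdot> ?F) \<cdot> inr C X ?B"
      unfolding uv by (rule refl)+
    then have "(u \<cdot> inr C X (Cod C f)) \<cdot> f = (v \<cdot> inr C X (Cod C f)) \<cdot> f" by simp
    then have "u \<cdot> inr C X (Cod C f) = v \<cdot> inr C X (Cod C f)"
      by (rule is_coequalizer_eqI[OF ce]) simp_all
    with * show "u = v" by (intro coprod_eqI[of u X "Cod C f" v]) simp_all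
  qed simp_all
qed

section \<open>The ternary cosmash product and the folding operation\<close>

abbreviation pr_XY :: "'a \<Rightarrow> 'a \<Rightarrow> 'a \<Rightarrow> 'b" where
  "pr_XY X Y Z \<equiv> copair C (inl C X Y) (copair C (inr C X Y) (zero_arr C Z (X \<amalg> Y)))"

abbreviation pr_XZ :: "'a \<Rightarrow> 'a \<Rightarrow> 'a \<Rightarrow> 'b" where
  "pr_XZ X Y Z \<equiv> copair C (inl C X Z) (copair C (zero_arr C Y (X \<amalg> Z)) (inr C X Z))"

abbreviation pr_YZ :: "'a \<Rightarrow> 'a \<Rightarrow> 'a \<Rightarrow> 'b" where
  "pr_YZ X Y Z \<equiv> retr2 X (Y \<amalg> Z)"

lemma cosmash3_incl_is_kernel:
  assumes "X \<in> Obj C" "Y \<in> Obj C" "Z \<in> Obj C"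
  shows "is_kernel C (cosmash3_incl C X Y Z) (tuple C (pr_XY X Y Z) (tuple C (pr_XZ X Y Z) (pr_YZ X Y Z)))"
  unfolding cosmash3_incl_def using assms by (intro is_kernel_ker) simp

lemma cosmash3_incl_simps [simp]:
  assumes [simp]: "X \<in> Obj C" "Y \<in> Obj C" "Z \<in> Obj C"
  shows "cosmash3_incl C X Y Z \<in> Arr C" "Dom C (cosmash3_incl C X Y Z) = cosmash3 C X Y Z"
    "Cod C (cosmash3_incl C X Y Z) = X \<amalg> (Y \<amalg> Z)" "cosmash3 C X Y Z \<in> Obj C"
    "pr_XY X Y Z \<cdot> cosmash3_incl C X Y Z = zero_arr C (cosmash3 C X Y Z) (X \<amalg> Y)"
    "pr_XZ X Y Z \<cdot> cosmash3_incl C X Y Z = zero_arr C (cosmash3 C X Y Z) (X \<amalg> Z)"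
    "pr_YZ X Y Z \<cdot> cosmash3_incl C X Y Z = zero_arr C (cosmash3 C X Y Z) (Y \<amalg> Z)"
proof -
  let ?U = "tuple C (pr_XZ X Y Z) (pr_YZ X Y Z)"
  let ?P = "prod_obj C (X \<amalg> Y) (prod_obj C (X \<amalg> Z) (Y \<amalg> Z))"
  have [simp]: "cosmash3_incl C X Y Z \<in> Arr C" "Cod C (cosmash3_incl C X Y Z) = X \<amalg> (Y \<amalg> Z)" and
    z: "tuple C (pr_XY X Y Z) ?U \<cdot> cosmash3_incl C X Y Z = zero_arr C (cosmash3 C X Y Z) ?P"
    using cosmash3_incl_is_kernel[OF assms] by (auto elim!: is_kernelE simp: cosmash3_def)
  show [simp]: "cosmash3_incl C X Y Z \<in> Arr C" "Dom C (cosmash3_incl C X Y Z) = cosmash3 C X Y Z"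
    "Cod C (cosmash3_incl C X Y Z) = X \<amalg> (Y \<amalg> Z)" by (simp_all add: cosmash3_def)
  show [simp]: "cosmash3 C X Y Z \<in> Obj C" unfolding cosmash3_def by (rule Dom_in_Obj) simp
  have z2: "?U \<cdot> cosmash3_incl C X Y Z = zero_arr C (cosmash3 C X Y Z) (prod_obj C (X \<amalg> Z) (Y \<amalg> Z))"
    and xy: "pr_XY X Y Z \<cdot> cosmash3_incl C X Y Z = zero_arr C (cosmash3 C X Y Z) (X \<amalg> Y)"
    using arg_cong[OF z, of "\<lambda>x. pr1 C (X \<amalg> Y) (prod_obj C (X \<amalg> Z) (Y \<amalg> Z)) \<cdot> x"]
      arg_cong[OF z, of "\<lambda>x. pr2 C (X \<amalg> Y) (prod_obj C (X \<amalg> Z) (Y \<amalg> Z)) \<cdot> x"] by simp_all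
  show "pr_XY X Y Z \<cdot> cosmash3_incl C X Y Z = zero_arr C (cosmash3 C X Y Z) (X \<amalg> Y)"
    "pr_XZ X Y Z \<cdot> cosmash3_incl C X Y Z = zero_arr C (cosmash3 C X Y Z) (X \<amalg> Z)"
    "pr_YZ X Y Z \<cdot> cosmash3_incl C X Y Z = zero_arr C (cosmash3 C X Y Z) (Y \<amalg> Z)"
    using arg_cong[OF z2, of "\<lambda>x. pr1 C (X \<amalg> Z) (Y \<amalg> Z) \<cdot> x"]
      arg_cong[OF z2, of "\<lambda>x. pr2 C (X \<amalg> Z) (Y \<amalg> Z) \<cdot> x"] by (simp_all add: xy)
qed

lemma cosmash3_kernel:
  assumes "X \<in> Obj C" "Y \<in> Obj C" "Z \<in> Obj C" "g \<in> Arr C" "Cod C g = X \<amalg> (Y \<amalg> Z)"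
    "pr_XY X Y Z \<cdot> g = zero_arr C (Dom C g) (X \<amalg> Y)" "pr_XZ X Y Z \<cdot> g = zero_arr C (Dom C g) (X \<amalg> Z)"
    "pr_YZ X Y Z \<cdot> g = zero_arr C (Dom C g) (Y \<amalg> Z)"
  shows "tuple C (pr_XY X Y Z) (tuple C (pr_XZ X Y Z) (pr_YZ X Y Z)) \<cdot> g =
    zero_arr C (Dom C g) (prod_obj C (X \<amalg> Y) (prod_obj C (X \<amalg> Z) (Y \<amalg> Z)))"
proof -
  note [simp] = assms
  have *: "tuple C (pr_XZ X Y Z) (pr_YZ X Y Z) \<cdot> g = zero_arr C (Dom C g) (prod_obj C (X \<amalg> Z) (Y \<amalg> Z))"
    by (rule prod_eqI[of "X \<amalg> Z" "Y \<amalg> Z"]) simp_all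
  show ?thesis
    by (rule prod_eqI[of "X \<amalg> Y" "prod_obj C (X \<amalg> Z) (Y \<amalg> Z)"]) (simp_all add: *)
qed

lemma cosmash3_map_simps:
  assumes [simp]: "f \<in> Arr C" "g \<in> Arr C" "h \<in> Arr C"
  shows "cosmash3_map C f g h \<in> Arr C"
    "Dom C (cosmash3_map C f g h) = cosmash3 C (Dom C f) (Dom C g) (Dom C h)"
    "Cod C (cosmash3_map C f g h) = cosmash3 C (Cod C f) (Cod C g) (Cod C h)"
    "cosmash3_incl C (Cod C f) (Cod C g) (Cod C h) \<cdot> cosmash3_map C f g h =
      coprod_map C f (coprod_map C g h) \<cdot> cosmash3_incl C (Dom C f) (Dom C g) (Dom C h)"
proof -
  let ?X = "Dom C f" and ?Y = "Dom C g" and ?Z = "Dom C h"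
  let ?X' = "Cod C f" and ?Y' = "Cod C g" and ?Z' = "Cod C h"
  let ?m = "coprod_map C f (coprod_map C g h)"
  have xy: "pr_XY ?X' ?Y' ?Z' \<cdot> ?m = coprod_map C f g \<cdot> pr_XY ?X ?Y ?Z"
    by (rule coprod_eqI[of _ ?X "?Y \<amalg> ?Z"], simp, rule coprod_eqI[of _ ?Y ?Z]) simp_all
  have xz: "pr_XZ ?X' ?Y' ?Z' \<cdot> ?m = coprod_map C f h \<cdot> pr_XZ ?X ?Y ?Z"
    by (rule coprod_eqI[of _ ?X "?Y \<amalg> ?Z"], simp, rule coprod_eqI[of _ ?Y ?Z]) simp_all
  have "tuple C (pr_XY ?X' ?Y' ?Z') (tuple C (pr_XZ ?X' ?Y' ?Z') (pr_YZ ?X' ?Y' ?Z')) \<cdot>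
      (?m \<cdot> cosmash3_incl C ?X ?Y ?Z) = zero_arr C (Dom C (?m \<cdot> cosmash3_incl C ?X ?Y ?Z))
        (prod_obj C (?X' \<amalg> ?Y') (prod_obj C (?X' \<amalg> ?Z') (?Y' \<amalg> ?Z')))"
    by (intro cosmash3_kernel) (simp_all add: xy[THEN cmp_extend] xz[THEN cmp_extend])
  then show "cosmash3_map C f g h \<in> Arr C"
    "Dom C (cosmash3_map C f g h) = cosmash3 C (Dom C f) (Dom C g) (Dom C h)"
    "Cod C (cosmash3_map C f g h) = cosmash3 C (Cod C f) (Cod C g) (Cod C h)"
    "cosmash3_incl C (Cod C f) (Cod C g) (Cod C h) \<cdot> cosmash3_map C f g h =
      coprod_map C f (coprod_map C g h) \<cdot> cosmash3_incl C (Dom C f) (Dom C g) (Dom C h)"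
    using factor_through_kernel[OF cosmash3_incl_is_kernel[of ?X' ?Y' ?Z'], of "?m \<cdot> cosmash3_incl C ?X ?Y ?Z"]
    unfolding cosmash3_map_def[symmetric] by simp_all
qed

text \<open>The retraction onto \<open>X\<close> factors through \<open>pr_XY\<close>. Together with
  the vanishing of \<open>pr_YZ\<close> this places the ternary cosmash product inside
  \<open>X \<diamond> (Y \<amalg> Z)\<close>.\<close>

lemma cosmash3_incl_retr1:
  assumes [simp]: "X \<in> Obj C" "Y \<in> Obj C" "Z \<in> Obj C"
  shows "retr1 X (Y \<amalg> Z) \<cdot> cosmash3_incl C X Y Z = zero_arr C (cosmash3 C X Y Z) X"
proof -
  have "retr1 X Y \<cdot> pr_XY X Y Z = retr1 X (Y \<amalg> Z)"
    by (rule coprod_eqI[of _ X "Y \<amalg> Z"], simp, rule coprod_eqI[of _ Y Z]) simp_all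
  from cmp_extend[OF this, of "cosmash3_incl C X Y Z"] show ?thesis by simp
qed

lemma S12_simps:
  assumes [simp]: "X \<in> Obj C" "Y \<in> Obj C"
  shows "S12 C X Y \<in> Arr C" "Dom C (S12 C X Y) = cosmash3 C X Y Y" "Cod C (S12 C X Y) = X \<diamond>\<^bsub>C\<^esub> Y"
    "cosmash_incl C X Y \<cdot> S12 C X Y = coprod_map C (ident C X) (codiagonal C Y) \<cdot> cosmash3_incl C X Y Y"
  using cosmash_factor_through[of X Y "coprod_map C (ident C X) (codiagonal C Y) \<cdot> cosmash3_incl C X Y Y"]
  unfolding S12_def[symmetric] by (simp_all add: cosmash3_incl_retr1)

text \<open>Uniqueness comes from the split epimorphism \<open>\<rho>\<close> induced by the
  retraction of \<open>K \<amalg> B\<close> onto \<open>K\<close>. An element of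
  \<open>X \<diamond> (K \<amalg> B)\<close> is killed by \<open>pr_YZ\<close>, membership in the
  semidirect product adds \<open>pr_XZ\<close>, and the kernel of \<open>\<rho>\<close> adds
  \<open>pr_XY\<close>; these are the three conditions that define
  \<open>X \<diamond> K \<diamond> B\<close>.\<close>

lemma restricts_to_iff:
  assumes [simp]: "X \<in> Obj C" "k \<in> Arr C" "Cod C k = B" "Dom C k = K"
  shows "restricts_to C X K B h (S12 C X B \<cdot> cosmash3_map C (ident C X) k (ident C B)) (cosmash_map C (ident C X) k)
    \<longleftrightarrow> h = cosmash_map C (ident C X) (copair C k (ident C B)) \<cdot> semidirect_incl C X K B"
proof -
  have [simp]: "K \<in> Obj C" "B \<in> Obj C" using assms Dom_in_Obj Cod_in_Obj by blast+
  let ?S = "K \<amalg> B"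
  let ?q = "cosmash_map C (ident C X) (retr2 K B)" and ?p = "cosmash_map C (ident C X) (copair C k (ident C B))"
  let ?\<nu> = "semidirect_incl C X K B" and ?V = "semidirect C X K B" and ?\<iota> = "cosmash_incl C X ?S"
  let ?\<iota>3 = "cosmash3_incl C X K B"
  have nu: "is_kernel C ?\<nu> ?q" unfolding semidirect_incl_def by (rule is_kernel_ker) simp
  have [simp]: "?\<nu> \<in> Arr C" "Dom C ?\<nu> = ?V" "Cod C ?\<nu> = X \<diamond>\<^bsub>C\<^esub> ?S"
    and qnu: "?q \<cdot> ?\<nu> = zero_arr C ?V (X \<diamond>\<^bsub>C\<^esub> B)"
    using nu by (auto elim!: is_kernelE simp: semidirect_def)
  have [simp]: "?V \<in> Obj C" unfolding semidirect_def by (rule Dom_in_Obj) simp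
  have mono: "u = v" if [simp]: "u \<in> Arr C" "v \<in> Arr C" "Cod C u = ?V" "Cod C v = ?V"
    and e: "?\<iota> \<cdot> (?\<nu> \<cdot> u) = ?\<iota> \<cdot> (?\<nu> \<cdot> v)" for u v
    by (rule monicD[OF is_kernel_monic[OF nu]], rule cosmash_eqI[OF e]) simp_all
  have qnu': "coprod_map C (ident C X) (retr2 K B) \<cdot> (?\<iota> \<cdot> ?\<nu>) = zero_arr C ?V (X \<amalg> B)"
    using arg_cong[OF qnu, of "\<lambda>x. cosmash_incl C X B \<cdot> x"] by simp

  have pXZ: "coprod_map C (ident C X) (retr2 K B) = pr_XZ X K B"
    by (rule coprod_eqI[of _ X ?S], simp, rule coprod_eqI[of _ K B]) simp_all
  have pXY: "coprod_map C (ident C X) (retr1 K B) = pr_XY X K B"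
    by (rule coprod_eqI[of _ X ?S], simp, rule coprod_eqI[of _ K B]) simp_all

  define j3 where "j3 = factor_through C ?\<iota> ?\<iota>3"
  have [simp]: "j3 \<in> Arr C" "Dom C j3 = cosmash3 C X K B" "Cod C j3 = X \<diamond>\<^bsub>C\<^esub> ?S" and j3: "?\<iota> \<cdot> j3 = ?\<iota>3"
    using cosmash_factor_through[of X ?S ?\<iota>3] by (simp_all add: j3_def cosmash3_incl_retr1)
  have "?q \<cdot> j3 = zero_arr C (cosmash3 C X K B) (X \<diamond>\<^bsub>C\<^esub> B)"
    by (rule cosmash_eqI[of X B]) (simp_all add: j3 pXZ)
  then have [simp]: "semidirect_ker C X K B \<in> Arr C" "Dom C (semidirect_ker C X K B) = cosmash3 C X K B"
    "Cod C (semidirect_ker C X K B) = ?V" and nk: "?\<nu> \<cdot> semidirect_ker C X K B = j3"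
    using factor_through_kernel[OF nu, of j3] unfolding semidirect_ker_def j3_def[symmetric] by simp_all
  \<comment> \<open>\<open>1 + 0\<close> factors through the retraction onto \<open>X\<close>, which
    vanishes on \<open>X \<diamond> K\<close>.\<close>
  have z: "coprod_map C (ident C X) (zero_arr C K B) = inl C X B \<cdot> retr1 X K"
    by (rule coprod_eqI[of _ X K]) simp_all
  have "?q \<cdot> cosmash_map C (ident C X) (inl C K B) = zero_arr C (X \<diamond>\<^bsub>C\<^esub> K) (X \<diamond>\<^bsub>C\<^esub> B)"
    by (rule cosmash_eqI[of X B]) (simp_all add: coprod_map_cmp[THEN cmp_extend] z)
  then have [simp]: "semidirect_split C X K B \<in> Arr C" "Dom C (semidirect_split C X K B) = X \<diamond>\<^bsub>C\<^esub> K"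
    "Cod C (semidirect_split C X K B) = ?V"
    and ns: "?\<nu> \<cdot> semidirect_split C X K B = cosmash_map C (ident C X) (inl C K B)"
    using factor_through_kernel[OF nu, of "cosmash_map C (ident C X) (inl C K B)"]
    unfolding semidirect_split_def by simp_all

  have restr: "(?p \<cdot> ?\<nu>) \<cdot> semidirect_ker C X K B = S12 C X B \<cdot> cosmash3_map C (ident C X) k (ident C B)"
  proof (rule cosmash_eqI[of X B])
    \<comment> \<open>Factoring through the codiagonal is what makes the folding operation appear:
      \<open>1 + (k + 1)\<close> restricts to the ternary cosmash map and
      \<open>1 + \<nabla>\<close> to \<open>S12\<close>.\<close>
    have "copair C k (ident C B) = codiagonal C B \<cdot> coprod_map C k (ident C B)"
      by (rule coprod_eqI[of _ K B]) (simp_all add: codiagonal_simps(4)[THEN cmp_extend])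
    then show "cosmash_incl C X B \<cdot> ((?p \<cdot> ?\<nu>) \<cdot> semidirect_ker C X K B) =
      cosmash_incl C X B \<cdot> (S12 C X B \<cdot> cosmash3_map C (ident C X) k (ident C B))"
      using cosmash3_map_simps[of "ident C X" k "ident C B"]
      by (simp add: nk j3 S12_simps cmp_extend[OF S12_simps(4)] coprod_map_cmp[THEN cmp_extend])
  qed (use cosmash3_map_simps[of "ident C X" k "ident C B"] in \<open>simp_all add: S12_simps\<close>)
  have split: "(?p \<cdot> ?\<nu>) \<cdot> semidirect_split C X K B = cosmash_map C (ident C X) k"
    by (rule cosmash_eqI[of X B]) (simp_all add: ns coprod_map_cmp[THEN cmp_extend])

  define \<rho> where "\<rho> = cosmash_map C (ident C X) (retr1 K B) \<cdot> ?\<nu>"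
  have [simp]: "\<rho> \<in> Arr C" "Dom C \<rho> = ?V" "Cod C \<rho> = X \<diamond>\<^bsub>C\<^esub> K" by (simp_all add: \<rho>_def)
  have rs: "\<rho> \<cdot> semidirect_split C X K B = ident C (X \<diamond>\<^bsub>C\<^esub> K)"
    by (rule cosmash_eqI[of X K]) (simp_all add: \<rho>_def ns coprod_map_cmp[THEN cmp_extend] coprod_map_ident)
  have rk: "is_kernel C (semidirect_ker C X K B) \<rho>"
  proof (rule is_kernelI)
    show "monic C (semidirect_ker C X K B)"
    proof (rule monicI)
      fix g h assume [simp]: "g \<in> Arr C" "h \<in> Arr C" "Cod C g = Dom C (semidirect_ker C X K B)"
        "Cod C h = Dom C (semidirect_ker C X K B)" and "semidirect_ker C X K B \<cdot> g = semidirect_ker C X K B \<cdot> h"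
      then have "?\<iota> \<cdot> (?\<nu> \<cdot> (semidirect_ker C X K B \<cdot> g)) = ?\<iota> \<cdot> (?\<nu> \<cdot> (semidirect_ker C X K B \<cdot> h))" by simp
      then have "?\<iota>3 \<cdot> g = ?\<iota>3 \<cdot> h" by (simp add: nk[THEN cmp_extend] j3[THEN cmp_extend])
      then show "g = h" by (rule monicD[OF is_kernel_monic[OF cosmash3_incl_is_kernel[of X K B]], rotated 3]) simp_all
    qed simp
    show "\<rho> \<cdot> semidirect_ker C X K B = zero_arr C (Dom C (semidirect_ker C X K B)) (Cod C \<rho>)"
      unfolding Cod_cmp by (rule cosmash_eqI[of X K]) (simp_all add: \<rho>_def nk j3 pXY)
    fix g assume [simp]: "g \<in> Arr C" "Cod C g = Dom C \<rho>" and g: "\<rho> \<cdot> g = zero_arr C (Dom C g) (Cod C \<rho>)"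
    let ?y = "?\<iota> \<cdot> (?\<nu> \<cdot> g)"
    have "pr_XY X K B \<cdot> ?y = zero_arr C (Dom C g) (X \<amalg> K)"
      using arg_cong[OF g, of "\<lambda>x. cosmash_incl C X K \<cdot> x"] by (simp add: \<rho>_def pXY)
    moreover have "pr_XZ X K B \<cdot> ?y = zero_arr C (Dom C g) (X \<amalg> B)"
      using cmp_extend3[OF qnu', of g] by (simp add: pXZ)
    ultimately obtain x where [simp]: "x \<in> Arr C" "Dom C x = Dom C g" "Cod C x = cosmash3 C X K B" and x: "?\<iota>3 \<cdot> x = ?y"
      using is_kernel_lift[OF cosmash3_incl_is_kernel[of X K B], of ?y] cosmash3_kernel[of X K B ?y] by auto
    have "semidirect_ker C X K B \<cdot> x = g"
      by (rule mono) (simp_all add: nk[THEN cmp_extend] j3[THEN cmp_extend] x)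
    then show "\<exists>h. h \<in> Arr C \<and> Dom C h = Dom C g \<and> Cod C h = Dom C (semidirect_ker C X K B) \<and>
        semidirect_ker C X K B \<cdot> h = g"
      by (intro exI[of _ x]) simp
  qed simp_all
  show ?thesis
  proof
    assume "restricts_to C X K B h (S12 C X B \<cdot> cosmash3_map C (ident C X) k (ident C B)) (cosmash_map C (ident C X) k)"
    then have h: "h \<in> Arr C" "Dom C h = ?V" "h \<cdot> semidirect_ker C X K B = (?p \<cdot> ?\<nu>) \<cdot> semidirect_ker C X K B"
      "h \<cdot> semidirect_split C X K B = (?p \<cdot> ?\<nu>) \<cdot> semidirect_split C X K B"
      unfolding restr split by (simp_all add: restricts_to_def in_hom)
    show "h = ?p \<cdot> ?\<nu>"
      by (rule kernel_section_jointly_epic[OF rk _ _ _ _ _ _ _ h(3,4)]) (simp_all add: rs h(1,2))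
  next
    assume "h = ?p \<cdot> ?\<nu>"
    then show "restricts_to C X K B h (S12 C X B \<cdot> cosmash3_map C (ident C X) k (ident C B)) (cosmash_map C (ident C X) k)"
      using restr split by (auto simp: restricts_to_def in_hom)
  qed
qed

text \<open>With \<open>l\<close> the kernel of \<open>1 \<diamond> f\<close>, the morphism factors
  as \<open>l \<cdot> \<phi>\<close> with \<open>\<phi>\<close> a regular epimorphism. This is its
  image factorisation, so it is proper. As \<open>\<phi>\<close> is epic, it has the same cokernel
  as \<open>l\<close>, namely \<open>1 \<diamond> f\<close>.\<close>

lemma right_exact_cosmash_map:
  assumes co: "is_cokernel C f k" and [simp]: "X \<in> Obj C" and [simp]: "Dom C k = K" "Cod C k = B"
  shows "right_exact C (cosmash_map C (ident C X) (copair C k (ident C B)) \<cdot> semidirect_incl C X K B)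
    (cosmash_map C (ident C X) f)"
proof -
  have [simp]: "k \<in> Arr C" "f \<in> Arr C" "Dom C f = B" and fk: "f \<cdot> k = zero_arr C K (Cod C f)"
    using co by (auto elim!: is_cokernelE)
  have [simp]: "K \<in> Obj C" "B \<in> Obj C"
    using Dom_in_Obj[of k] Cod_in_Obj[of k] by simp_all
  let ?c1 = "copair C k (ident C B)" and ?g = "cosmash_map C (ident C X) f"
  let ?\<nu> = "semidirect_incl C X K B" and ?h = "cosmash_map C (ident C X) ?c1 \<cdot> semidirect_incl C X K B"
  have ce: "is_coequalizer C (coprod_map C (ident C X) f) (coprod_map C (ident C X) ?c1)
      (coprod_map C (ident C X) (retr2 K B))"
    using coprod_map_cokernel_coequalizer[OF co, of X] by simp
  have re: "regular_epi C ?g"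
    by (rule cosmash_map_regular_epi) (use ce in \<open>auto simp: regular_epi_def\<close>)
  have nu: "is_kernel C ?\<nu> (cosmash_map C (ident C X) (retr2 K B))"
    unfolding semidirect_incl_def by (rule is_kernel_ker) simp
  have [simp]: "?\<nu> \<in> Arr C" "Cod C ?\<nu> = X \<diamond>\<^bsub>C\<^esub> (K \<amalg> B)" using nu by (auto elim!: is_kernelE)
  obtain l where l: "is_kernel C l ?g" using kernel_exists[of ?g] by auto
  have [simp]: "l \<in> Arr C" "Cod C l = X \<diamond>\<^bsub>C\<^esub> B" and gl: "?g \<cdot> l = zero_arr C (Dom C l) (X \<diamond>\<^bsub>C\<^esub> Cod C f)"
    using l by (auto elim!: is_kernelE)
  have fc: "f \<cdot> ?c1 = f \<cdot> retr2 K B"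
    by (rule coprod_eqI[of _ K B]) (simp_all add: fk)
  have "\<exists>\<phi>. regular_epi C \<phi> \<and> Dom C \<phi> = Dom C ?\<nu> \<and> Cod C \<phi> = Dom C l \<and> l \<cdot> \<phi> = ?h"
    by (rule cosmash_reflexive_graph_kernel_regular_epi[where s = "inr C K B", OF _ _ _ _ _ _ _ _ _ _ _ _ _ _ nu l])
      (simp_all add: ce fc)
  then obtain \<phi> where phi: "regular_epi C \<phi>" and [simp]: "Dom C \<phi> = Dom C ?\<nu>" "Cod C \<phi> = Dom C l" and lp: "l \<cdot> \<phi> = ?h"
    by blast
  have [simp]: "\<phi> \<in> Arr C" using phi by simp
  have "is_image C l ?h" unfolding is_image_def
    using is_kernel_monic[OF l] phi lp by (auto simp: in_hom intro!: bexI[of _ \<phi>])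
  then have "proper C ?h" unfolding proper_def normal_mono_def using l by blast
  moreover have "is_cokernel C ?g ?h" unfolding is_cokernel_def
  proof (intro exI conjI allI ballI impI)
    show "?h \<in> hom C (Dom C ?\<nu>) (X \<diamond>\<^bsub>C\<^esub> B)" "?g \<in> hom C (X \<diamond>\<^bsub>C\<^esub> B) (X \<diamond>\<^bsub>C\<^esub> Cod C f)"
      by (simp_all add: in_hom)
    show "?g \<cdot> ?h = zero_arr C (Dom C ?\<nu>) (X \<diamond>\<^bsub>C\<^esub> Cod C f)"
      unfolding lp[symmetric] by (simp add: gl[THEN cmp_extend])
    fix T u assume u: "u \<in> hom C (X \<diamond>\<^bsub>C\<^esub> B) T" and "u \<cdot> ?h = zero_arr C (Dom C ?\<nu>) T"
    then have [simp]: "u \<in> Arr C" "Dom C u = X \<diamond>\<^bsub>C\<^esub> B" "Cod C u = T" "T \<in> Obj C"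
      and ulp: "u \<cdot> (l \<cdot> \<phi>) = zero_arr C (Dom C ?\<nu>) T"
      by (auto simp: in_hom lp)
    have "u \<cdot> l = zero_arr C (Dom C l) T"
      by (rule regular_epi_eqI[OF phi]) (simp_all add: ulp)
    then obtain t where t: "t \<in> Arr C" "Dom C t = X \<diamond>\<^bsub>C\<^esub> Cod C f" "Cod C t = T" "t \<cdot> ?g = u"
      using regular_epi_cokernel_of_kernel[OF re l, of u] by auto
    show "\<exists>!t. t \<in> hom C (X \<diamond>\<^bsub>C\<^esub> Cod C f) T \<and> t \<cdot> ?g = u"
    proof (rule ex1I[of _ t])
      show "t \<in> hom C (X \<diamond>\<^bsub>C\<^esub> Cod C f) T \<and> t \<cdot> ?g = u" using t by (simp add: in_hom)
      fix t' assume "t' \<in> hom C (X \<diamond>\<^bsub>C\<^esub> Cod C f) T \<and> t' \<cdot> ?g = u"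
      then show "t' = t" using t regular_epi_eqI[OF re, of t' t] by (simp add: in_hom)
    qed
  qed
  ultimately show ?thesis unfolding right_exact_def by blast
qed

end

theorem theorem4p11:
  fixes C :: "('o, 'm, 'x) cat_data_scheme" (structure)
    and X K B A :: 'o and k f :: 'm
  assumes "semi_abelian C"
    and "X \<in> Obj C"
    and "k \<in> hom C K B"
    and "f \<in> hom C B A"
    and "is_cokernel C f k"
  shows "(\<exists>!h. restricts_to C X K B h
             (S12 C X B \<cdot> cosmash3_map C (ident C X) k (ident C B))
             (cosmash_map C (ident C X) k)) \<and>
    (\<forall>h. restricts_to C X K B h
             (S12 C X B \<cdot> cosmash3_map C (ident C X) k (ident C B))
             (cosmash_map C (ident C X) k) \<longrightarrow>
         right_exact C h (cosmash_map C (ident C X) f))"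
proof -
  interpret semi_abelian C by fact
  have k: "k \<in> Arr C" "Cod C k = B" "Dom C k = K" using assms(3) by (simp_all add: in_hom)
  show ?thesis
    unfolding restricts_to_iff[OF assms(2) k]
    using right_exact_cosmash_map[OF assms(5,2) k(3,2)] by blast
qed

end
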